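(* Let $K$ and $L$ be index sets. For each $N$, let $(\mathbf{A}_k)_{k\in K}$ be a family of $N\times N$ complex random matrices and $(\mathbf{M}_\ell)_{\ell\in L}$ a family of $N\times N$ deterministic complex matrices (both implicitly depending on $N$), satisfying: (a) for every deterministic $N\times N$ unitary matrix $\mathbf{U}$, $(\mathbf{A}_k)_{k\in K}$ and $(\mathbf{U}\mathbf{A}_k\mathbf{U}^* )_{k\in K}$ have the same joint distribution; (b) for each $k\in K$ and each $p,q\ge 1$, $\frac1N\operatorname{Tr}(\mathbf{A}_k\mathbf{A}_k^* )^p$ is bounded in $L^q$ uniformly in $N$; (c) for each $k,k'\in K$ there are deterministic complex numbers $\tau(k,k')$ and $\tau(k,\overline{k'})$ such that, in $L^2$, $\frac1N\operatorname{Tr}\mathbf{A}_k\mathbf{A}_{k'}-\frac1N\operatorname{Tr}\mathbf{A}_k\cdot\frac1N\operatorname{Tr}\mathbf{A}_{k'}\to\tau(k,k')$ and $\frac1N\operatorname{Tr}\mathbf{A}_k\mathbf{A}_{k'}^*-\frac1N\operatorname{Tr}\mathbf{A}_k\cdot\frac1N\operatorname{Tr}\mathbf{A}_{k'}^*\to\tau(k,\overline{k'})$; (d) for each $\ell,\ell'\in L$ there are complex numbers $\eta_{\ell\ell'}$, $\beta_{\ell\ell'}$ with $\lim_{N\to\infty}\frac1N\operatorname{Tr}\mathbf{M}_\ell\mathbf{M}_{\ell'}-\frac1N\operatorname{Tr}\mathbf{M}_\ell\cdot\frac1N\operatorname{Tr}\mathbf{M}_{\ell'}=\eta_{\ell\ell'}$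 and $\lim_{N\to\infty}\frac1N\operatorname{Tr}\mathbf{M}_\ell\mathbf{M}_{\ell'}^*-\frac1N\operatorname{Tr}\mathbf{M}_\ell\cdot\frac1N\operatorname{Tr}\mathbf{M}_{\ell'}^*=\beta_{\ell\ell'}$. If moreover $\operatorname{Tr}(\mathbf{M}_\ell)=0$ for every $\ell\in L$, then the finite-dimensional marginal distributions of $\big(\operatorname{Tr}(\mathbf{A}_k\mathbf{M}_\ell)\big)_{k\in K,\ell\in L}$ converge, as $N\to\infty$, to those of a complex centered Gaussian vector $(\mathcal{G}_{k,\ell})_{k\in K,\ell\in L}$ with covariance $\mathbb{E}[\mathcal{G}_{k,\ell}\mathcal{G}_{k',\ell'}]=\eta_{\ell\ell'}\tau(k,k')$ and $\mathbb{E}[\mathcal{G}_{k,\ell}\overline{\mathcal{G}_{k',\ell'}}]=\beta_{\ell\ell'}\tau(k,\overline{k'})$.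
   Context: $\tau(k,\overline{k'})$ is just notation for the second limit in (c), indexed by the pair $(k,k')$. *)

theory Defs
  imports "HOL-Probability.Probability"
begin

text \<open>N x N complex matrices are represented as functions nat \<Rightarrow> nat \<Rightarrow> complex;
  only the entries with indices < N are relevant.\<close>

type_synonym cmat = "nat \<Rightarrow> nat \<Rightarrow> complex"

definition mtrace :: "nat \<Rightarrow> cmat \<Rightarrow> complex" where
  "mtrace N A = (\<Sum>i<N. A i i)"

definition mmult :: "nat \<Rightarrow> cmat \<Rightarrow> cmat \<Rightarrow> cmat" where
  "mmult N A B = (\<lambda>i j. \<Sum>r<N. A i r * B r j)"

definition madj :: "cmat \<Rightarrow> cmat" where
  "madj A = (\<lambda>i j. cnj (A j i))"

definition mid :: cmat where
  "mid = (\<lambda>i j. if i = j then 1 else 0)"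

fun mpow :: "nat \<Rightarrow> cmat \<Rightarrow> nat \<Rightarrow> cmat" where
  "mpow N A 0 = mid"
| "mpow N A (Suc p) = mmult N A (mpow N A p)"

definition unitary_mat :: "nat \<Rightarrow> cmat \<Rightarrow> bool" where
  "unitary_mat N U \<longleftrightarrow> (\<forall>i<N. \<forall>j<N. mmult N (madj U) U i j = mid i j)"

definition joint_law :: "'a measure \<Rightarrow> nat \<Rightarrow> ('k \<Rightarrow> 'a \<Rightarrow> cmat)
    \<Rightarrow> ('k \<times> nat \<times> nat \<Rightarrow> complex) measure" where
  "joint_law P N A = distr P (PiM UNIV (\<lambda>_. borel))
     (\<lambda>\<omega> (k, i, j). if i < N \<and> j < N then A k \<omega> i j else 0)"

definition centered_real_gaussian :: "'a measure \<Rightarrow> ('a \<Rightarrow> real) \<Rightarrow> bool" where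
  "centered_real_gaussian P X \<longleftrightarrow>
     (\<exists>\<sigma>>0. distributed P lborel X (normal_density 0 \<sigma>)) \<or> (AE \<omega> in P. X \<omega> = 0)"

definition complex_centered_gaussian :: "'a measure \<Rightarrow> ('i \<Rightarrow> 'a \<Rightarrow> complex) \<Rightarrow> bool" where
  "complex_centered_gaussian P G \<longleftrightarrow>
     (\<forall>I a b. finite I \<longrightarrow>
        centered_real_gaussian P (\<lambda>\<omega>. \<Sum>i\<in>I. a i * Re (G i \<omega>) + b i * Im (G i \<omega>)))"

definition fdd_converges ::
  "(nat \<Rightarrow> 'a measure) \<Rightarrow> (nat \<Rightarrow> 'i \<Rightarrow> 'a \<Rightarrow> complex)
     \<Rightarrow> 'b measure \<Rightarrow> ('i \<Rightarrow> 'b \<Rightarrow> complex) \<Rightarrow> bool" where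
  "fdd_converges P X Q G \<longleftrightarrow>
     (\<forall>(m::nat) (idx::nat \<Rightarrow> 'i) (f::(nat \<Rightarrow> complex) \<Rightarrow> real).
        continuous_on UNIV f \<longrightarrow> bounded (range f) \<longrightarrow>
        (\<lambda>N. \<integral>\<omega>. f (\<lambda>i. if i < m then X N (idx i) \<omega> else 0) \<partial>P N)
          \<longlonglongrightarrow> (\<integral>\<omega>. f (\<lambda>i. if i < m then G (idx i) \<omega> else 0) \<partial>Q))"

end

theory Submission
  imports Defs
begin

text \<open>
  Conjugation by the unitary groups \<open>exp (i \<theta> v v\<^sup>*)\<close> gives an integration by parts formula: the derivative of an
  observable along any matrix unit has mean zero under a unitarily invariant law. Summed over all matrix units it
  becomes the Laplacian of the unitary group, for which \<open>Tr (A M)\<close> with \<open>Tr M = 0\<close> is an eigenfunction of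
  eigenvalue \<open>2 N\<close>. Hence a real linear statistic \<open>Y\<close> satisfies
  \<open>E Y e\<^sup>i\<^sup>t\<^sup>Y = i t E \<Gamma> e\<^sup>i\<^sup>t\<^sup>Y\<close> where \<open>\<Gamma>\<close> is made of traces of products of commutators \<open>[A, M]\<close>. The same formula
  bounds the second moments of \<open>Tr (A M)\<close> and \<open>Tr (A M A' M')\<close> for centered matrices, which shows that \<open>\<Gamma>\<close> converges
  in \<open>L\<^sup>1\<close> to the limiting variance although the operator norms of the \<open>M\<close> may be of order \<open>N\<^sup>1\<^sup>/\<^sup>2\<close>. The characteristic
  function of \<open>Y\<close> therefore solves \<open>\<phi>' = - v t \<phi>\<close> in the limit.
\<close>

subsection \<open>Frobenius norm and traces\<close>

text \<open>For a unit vector the group generated by its rank-one projection is explicit: 1 plus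
  (e^(it) - 1) times the projection. Neither a matrix exponential nor Haar measure enters; the
  derivative of a mean along this group is a quadratic form in the vector, and polarization isolates
  the matrix units. Integrability is the first obstacle: an observable carries an envelope over its
  whole orbit with moments of all orders, so that products stay admissible. The second is that
  submultiplicativity of the Frobenius norm loses a factor N. It is regained from Schur's lemma: a
  covariant C has scalar mean, whence E |C B|^2 = E |C|^2 |B|^2 / N, even under a
  conjugation-invariant weight; the weight is what handles products of two traces. The limit process
  has to be constructed: nonnegativity of the carre du champ survives in the limit and makes the
  covariance kernel positive semidefinite, and Kolmogorov extension then covers arbitrary index
  sets. Convergence of marginals is drawn from characteristic functions by Stone-Weierstrass and
  uniform second moments, in place of a tightness argument.\<close>

definition fro :: "nat \<Rightarrow> cmat \<Rightarrow> real" where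
  "fro N A = (\<Sum>i<N. \<Sum>j<N. (cmod (A i j))\<^sup>2)"

lemma fro_nonneg [simp]: "0 \<le> fro N A"
  by (simp add: fro_def sum_nonneg)

lemma mmult_assoc: "mmult N (mmult N A B) C = mmult N A (mmult N B C)"
proof (intro ext)
  fix i j
  have "mmult N (mmult N A B) C i j = (\<Sum>r<N. \<Sum>s<N. A i s * B s r * C r j)"
    by (simp add: mmult_def sum_distrib_right)
  also have "\<dots> = (\<Sum>s<N. \<Sum>r<N. A i s * B s r * C r j)"
    by (rule sum.swap)
  also have "\<dots> = mmult N A (mmult N B C) i j"
    by (simp add: mmult_def sum_distrib_left mult.assoc)
  finally show "mmult N (mmult N A B) C i j = mmult N A (mmult N B C) i j" .
qed

lemma mtrace_commute: "mtrace N (mmult N A B) = mtrace N (mmult N B A)"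
  unfolding mtrace_def mmult_def by (subst sum.swap) (simp add: mult.commute)

lemma madj_madj [simp]: "madj (madj A) = A"
  by (simp add: madj_def)

lemma madj_mmult: "madj (mmult N A B) = mmult N (madj B) (madj A)"
  by (simp add: madj_def mmult_def mult.commute)

lemma mtrace_madj: "mtrace N (madj A) = cnj (mtrace N A)"
  by (simp add: mtrace_def madj_def)

lemma fro_madj [simp]: "fro N (madj A) = fro N A"
  unfolding fro_def madj_def by (subst sum.swap) simp

lemma fro_eq_mtrace: "complex_of_real (fro N A) = mtrace N (mmult N A (madj A))"
  by (simp add: fro_def mtrace_def mmult_def madj_def complex_norm_square flip: of_real_power)

lemma fro_cong: "(\<And>i j. i < N \<Longrightarrow> j < N \<Longrightarrow> A i j = B i j) \<Longrightarrow> fro N A = fro N B"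
  by (simp add: fro_def)

lemma cauchy_schwarz_complex:
  fixes f g :: "'i \<Rightarrow> complex"
  shows "(cmod (\<Sum>i\<in>I. f i * g i))\<^sup>2 \<le> (\<Sum>i\<in>I. (cmod (f i))\<^sup>2) * (\<Sum>i\<in>I. (cmod (g i))\<^sup>2)"
proof -
  have "cmod (\<Sum>i\<in>I. f i * g i) \<le> (\<Sum>i\<in>I. cmod (f i) * cmod (g i))"
    by (rule order_trans[OF norm_sum]) (simp add: norm_mult)
  then have "(cmod (\<Sum>i\<in>I. f i * g i))\<^sup>2 \<le> (\<Sum>i\<in>I. cmod (f i) * cmod (g i))\<^sup>2"
    by (rule power_mono) simp
  also have "\<dots> \<le> (\<Sum>i\<in>I. (cmod (f i))\<^sup>2) * (\<Sum>i\<in>I. (cmod (g i))\<^sup>2)"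
    by (rule Cauchy_Schwarz_ineq_sum)
  finally show ?thesis .
qed

lemma fro_mmult_le: "fro N (mmult N A B) \<le> fro N A * fro N B"
proof -
  have "fro N (mmult N A B) \<le>
      (\<Sum>i<N. \<Sum>j<N. (\<Sum>r<N. (cmod (A i r))\<^sup>2) * (\<Sum>r<N. (cmod (B r j))\<^sup>2))"
    unfolding fro_def mmult_def by (intro sum_mono cauchy_schwarz_complex)
  also have "\<dots> = fro N A * (\<Sum>j<N. \<Sum>r<N. (cmod (B r j))\<^sup>2)"
    by (simp add: fro_def sum_product)
  also have "(\<Sum>j<N. \<Sum>r<N. (cmod (B r j))\<^sup>2) = fro N B"
    unfolding fro_def by (rule sum.swap)
  finally show ?thesis .
qed

lemma mtrace_mmult_le: "(cmod (mtrace N (mmult N A B)))\<^sup>2 \<le> fro N A * fro N B"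
proof -
  \<comment> \<open>The adjoint of the entrywise conjugate is the transpose, so \<open>A i j\<close>
    is paired with \<open>B j i\<close>; writing it through \<open>madj\<close> lets
    \<open>fro_madj\<close> absorb the transposition.\<close>
  have "mtrace N (mmult N A B) = (\<Sum>(i,j)\<in>{..<N}\<times>{..<N}. A i j * madj (\<lambda>i j. cnj (B i j)) i j)"
    by (simp add: mtrace_def mmult_def madj_def sum.cartesian_product)
  moreover have "(cmod (\<Sum>z\<in>{..<N}\<times>{..<N}. (case z of (i,j) \<Rightarrow> A i j) * (case z of (i,j) \<Rightarrow> madj (\<lambda>i j. cnj (B i j)) i j)))\<^sup>2
     \<le> (\<Sum>z\<in>{..<N}\<times>{..<N}. (cmod (case z of (i,j) \<Rightarrow> A i j))\<^sup>2)
       * (\<Sum>z\<in>{..<N}\<times>{..<N}. (cmod (case z of (i,j) \<Rightarrow> madj (\<lambda>i j. cnj (B i j)) i j))\<^sup>2)"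
    by (rule cauchy_schwarz_complex)
  moreover have "(\<Sum>z\<in>{..<N}\<times>{..<N}. (cmod (case z of (i,j) \<Rightarrow> A i j))\<^sup>2) = fro N A" for A :: cmat
    by (simp add: fro_def sum.cartesian_product case_prod_unfold)
  moreover have "fro N (madj (\<lambda>i j. cnj (B i j))) = fro N B"
    unfolding fro_madj by (simp add: fro_def)
  ultimately show ?thesis
    by (simp add: case_prod_unfold)
qed

lemma fro_diff_le: "fro N (\<lambda>i j. A i j - B i j) \<le> 2 * fro N A + 2 * fro N B"
proof -
  have *: "(cmod (a - b))\<^sup>2 \<le> 2 * (cmod a)\<^sup>2 + 2 * (cmod b)\<^sup>2" for a b :: complex
  proof -
    have "(cmod (a - b))\<^sup>2 \<le> (cmod a + cmod b)\<^sup>2"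
      by (intro power_mono norm_triangle_ineq4) simp
    also have "\<dots> \<le> 2 * (cmod a)\<^sup>2 + 2 * (cmod b)\<^sup>2"
      using sum_squares_bound[of "cmod a" "cmod b"] by (simp add: power2_sum)
    finally show ?thesis .
  qed
  have "fro N (\<lambda>i j. A i j - B i j) \<le> (\<Sum>i<N. \<Sum>j<N. 2 * (cmod (A i j))\<^sup>2 + 2 * (cmod (B i j))\<^sup>2)"
    unfolding fro_def by (intro sum_mono *)
  then show ?thesis
    by (simp add: fro_def sum.distrib sum_distrib_left)
qed

text \<open>The Frobenius inner product of \<open>A\<^sup>* A M\<close> and \<open>M B B\<^sup>*\<close> is the squared norm of \<open>A M B\<close>.\<close>

lemma fro_sandwich_le:
  "fro N (mmult N A (mmult N M B)) \<le>
     (fro N (mmult N (mmult N (madj A) A) M) + fro N (mmult N M (mmult N B (madj B)))) / 2"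
proof -
  let ?X = "mmult N (mmult N (madj A) A) M" and ?Y = "mmult N M (mmult N B (madj B))"
  have "complex_of_real (fro N (mmult N A (mmult N M B))) = mtrace N (mmult N ?Y (madj ?X))"
    unfolding fro_eq_mtrace madj_mmult madj_madj mmult_assoc
    by (subst mtrace_commute) (simp add: mmult_assoc)
  then have "(fro N (mmult N A (mmult N M B)))\<^sup>2 = (cmod (mtrace N (mmult N ?Y (madj ?X))))\<^sup>2"
    by (metis norm_of_real power2_abs)
  also have "\<dots> \<le> fro N ?Y * fro N ?X"
    using mtrace_mmult_le[of N ?Y "madj ?X"] by simp
  also have "\<dots> \<le> ((fro N ?X + fro N ?Y) / 2)\<^sup>2"
    using sum_squares_bound[of "fro N ?X" "fro N ?Y"] by (simp add: power2_eq_square field_simps)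
  finally show ?thesis
    by (rule power2_le_imp_le) simp
qed

lemma sum_mid_left [simp]: "i < N \<Longrightarrow> (\<Sum>r<N. mid i r * f r) = f i"
  by (simp add: mid_def if_distrib[of "\<lambda>x. x * _"] cong: if_cong)

lemma sum_mid_right [simp]: "i < N \<Longrightarrow> (\<Sum>r<N. f r * mid r i) = f i"
  by (simp add: mid_def if_distrib[of "\<lambda>x. _ * x"] cong: if_cong)

lemma mmult_mid_left: "i < N \<Longrightarrow> mmult N mid A i j = A i j"
  by (simp add: mmult_def)

lemma mmult_mid_right: "j < N \<Longrightarrow> mmult N A mid i j = A i j"
  by (simp add: mmult_def)

lemma fro_mmult_mid: "fro N (mmult N mid A) = fro N A" "fro N (mmult N A mid) = fro N A"
  by (auto intro!: fro_cong simp: mmult_mid_left mmult_mid_right)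

lemma fro_madj_commute: "fro N (mmult N A (madj A)) = fro N (mmult N (madj A) A)"
proof -
  have "complex_of_real (fro N (mmult N A (madj A))) = complex_of_real (fro N (mmult N (madj A) A))"
    unfolding fro_eq_mtrace madj_mmult madj_madj mmult_assoc
    by (subst mtrace_commute) (simp add: mmult_assoc)
  then show ?thesis unfolding of_real_eq_iff .
qed

lemma mtrace_le_fro: "(cmod (mtrace N A))\<^sup>2 \<le> real N * fro N A"
proof -
  have "mtrace N (mmult N mid A) = mtrace N A"
    by (simp add: mtrace_def mmult_mid_left)
  moreover have "fro N mid = real N"
    by (simp add: fro_def mid_def if_distrib[of "\<lambda>x. (cmod x)\<^sup>2"] cong: if_cong)
  ultimately show ?thesis
    using mtrace_mmult_le[of N mid A] by simp
qed

subsection \<open>One-parameter unitary groups\<close>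

type_synonym 'k entries = "'k \<times> nat \<times> nat \<Rightarrow> complex"

definition unit_vec :: "nat \<Rightarrow> (nat \<Rightarrow> complex) \<Rightarrow> bool" where
  "unit_vec N v \<longleftrightarrow> (\<Sum>p<N. v p * cnj (v p)) = 1"

text \<open>The unitary group generated by \<open>i v v\<^sup>*\<close>; such rank-one generators span all matrices.\<close>

definition phase :: "(nat \<Rightarrow> complex) \<Rightarrow> real \<Rightarrow> cmat" where
  "phase v \<theta> = (\<lambda>i j. mid i j + (cis \<theta> - 1) * v i * cnj (v j))"

text \<open>Entries outside the N by N block are sent to 0, as in \<open>joint_law\<close>, so that
  invariance can be stated as equality of measures on the full product space.\<close>

definition conj_act :: "nat \<Rightarrow> cmat \<Rightarrow> 'k entries \<Rightarrow> 'k entries" where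
  "conj_act N U x = (\<lambda>(k, i, j). if i < N \<and> j < N
     then \<Sum>r<N. \<Sum>s<N. U i r * x (k, r, s) * cnj (U j s) else 0)"

abbreviation rot :: "nat \<Rightarrow> (nat \<Rightarrow> complex) \<Rightarrow> real \<Rightarrow> 'k entries \<Rightarrow> 'k entries" where
  "rot N v \<theta> \<equiv> conj_act N (phase v \<theta>)"

lemma unitary_phase:
  assumes "unit_vec N v" shows "unitary_mat N (phase v \<theta>)"
  unfolding unitary_mat_def
proof (intro allI impI)
  fix i j assume i: "i < N" and j: "j < N"
  let ?z = "cis \<theta> - 1"
  have v: "(\<Sum>p<N. v p * cnj (v p)) = 1"
    using assms by (simp add: unit_vec_def)
  have "mmult N (madj (phase v \<theta>)) (phase v \<theta>) i j
     = (\<Sum>r<N. mid i r * mid r j + mid i r * (?z * v r * cnj (v j))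
        + (cnj ?z * v i * cnj (v r)) * mid r j + cnj ?z * ?z * v i * cnj (v j) * (v r * cnj (v r)))"
    unfolding mmult_def madj_def phase_def
    by (intro sum.cong refl) (auto simp: algebra_simps mid_def)
  also have "\<dots> = mid i j + ?z * v i * cnj (v j) + cnj ?z * v i * cnj (v j) + cnj ?z * ?z * v i * cnj (v j)"
    using i j by (simp add: sum.distrib v flip: sum_distrib_left)
  also have "\<dots> = mid i j"
  proof -
    \<comment> \<open>Expansion of |1 + z|^2 = 1 for 1 + z = \<open>cis \<theta>\<close>.\<close>
    have "?z + cnj ?z + cnj ?z * ?z = 0"
      by (simp add: algebra_simps cis_cnj cis_mult)
    then have "(?z + cnj ?z + cnj ?z * ?z) * (v i * cnj (v j)) = 0"
      by simp
    then show ?thesis by (simp add: algebra_simps)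
  qed
  finally show "mmult N (madj (phase v \<theta>)) (phase v \<theta>) i j = mid i j" .
qed

text \<open>A unit vector is an eigenvector of the group that it generates. This turns the
  derivative of a rotation, which contains the unrotated entries, into an expression in the rotated
  entries alone.\<close>

lemma phase_eigen:
  assumes "unit_vec N v" "r < N"
  shows "(\<Sum>q<N. cnj (v q) * phase v \<theta> q r) = cis \<theta> * cnj (v r)"
proof -
  have "(\<Sum>q<N. cnj (v q) * phase v \<theta> q r)
      = (\<Sum>q<N. cnj (v q) * mid q r + (cis \<theta> - 1) * cnj (v r) * (v q * cnj (v q)))"
    by (simp add: phase_def algebra_simps)
  also have "\<dots> = cnj (v r) + (cis \<theta> - 1) * cnj (v r) * (\<Sum>q<N. v q * cnj (v q))"
    using assms(2) by (simp add: sum.distrib flip: sum_distrib_left)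
  finally show ?thesis
    using assms(1) by (simp add: unit_vec_def algebra_simps)
qed

lemma unit_vec_le_1:
  assumes "unit_vec N v" "p < N" shows "cmod (v p) \<le> 1"
proof -
  have "complex_of_real (\<Sum>p<N. (cmod (v p))\<^sup>2) = of_real 1"
    using assms(1) by (simp add: unit_vec_def complex_norm_square del: of_real_power flip: of_real_power)
  then have "(\<Sum>p<N. (cmod (v p))\<^sup>2) = 1"
    unfolding of_real_eq_iff .
  moreover have "(cmod (v p))\<^sup>2 \<le> (\<Sum>p<N. (cmod (v p))\<^sup>2)"
    using assms(2) by (intro member_le_sum) auto
  ultimately show ?thesis
    by (simp add: power_le_one_iff abs_square_le_1)
qed

lemma phase_bound:
  assumes "unit_vec N v" "i < N" "j < N" shows "cmod (phase v \<theta> i j) \<le> 3"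
proof -
  have "cmod ((cis \<theta> - 1) * v i * cnj (v j)) \<le> 2 * 1 * 1"
    unfolding norm_mult complex_mod_cnj
    by (intro mult_mono unit_vec_le_1[OF assms(1)] assms order_trans[OF norm_triangle_ineq4]) auto
  moreover have "cmod (mid i j) \<le> 1"
    by (simp add: mid_def)
  ultimately show ?thesis
    unfolding phase_def using norm_triangle_mono[of "mid i j" 1 _ 2] by fastforce
qed

lemma phase_vector_derivative:
  "((\<lambda>\<theta>. phase v \<theta> i j) has_vector_derivative (\<i> * v i * (cis \<theta> * cnj (v j)))) (at \<theta>)"
  unfolding phase_def by (auto intro!: derivative_eq_intros simp: has_vector_derivative_def
      has_derivative_cis scaleR_conv_of_real algebra_simps simp flip: cis_conv_exp)

lemma borel_measurable_cis [measurable (raw)]: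
  "f \<in> borel_measurable M \<Longrightarrow> (\<lambda>x. cis (f x)) \<in> borel_measurable M"
  by (rule borel_measurable_continuous_on[where f = cis]) (auto intro: continuous_intros)

text \<open>The factor 9 is 3 times 3, one \<open>phase_bound\<close> for each side of the
  conjugation. The bound depends neither on the angle nor on \<open>v\<close>, so it serves as an
  envelope over the whole orbit.\<close>

lemma conj_act_bound:
  assumes "unit_vec N v"
  shows "cmod (rot N v \<theta> x (k, i, j)) \<le> 9 * (\<Sum>r<N. \<Sum>s<N. cmod (x (k, r, s)))"
proof (cases "i < N \<and> j < N")
  case True
  have "cmod (rot N v \<theta> x (k, i, j))
      \<le> (\<Sum>r<N. \<Sum>s<N. cmod (phase v \<theta> i r * x (k, r, s) * cnj (phase v \<theta> j s)))"
    using True by (auto simp: conj_act_def intro!: order_trans[OF norm_sum] sum_mono)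
  also have "\<dots> \<le> (\<Sum>r<N. \<Sum>s<N. 3 * cmod (x (k, r, s)) * 3)"
    unfolding norm_mult complex_mod_cnj
    by (intro sum_mono mult_mono phase_bound[OF assms]) (use True in auto)
  finally show ?thesis
    by (simp add: sum_distrib_left mult.assoc)
next
  case False
  then show ?thesis
    by (auto simp: conj_act_def intro!: sum_nonneg)
qed

text \<open>The derivative of the rotated matrix Y is i times the commutator of the projection onto
  \<open>v\<close> with Y. Expanding the projection in matrix units E_pq, the bracket is the (i, j)
  entry of E_pq Y - Y E_pq.\<close>

lemma rot_vector_derivative:
  assumes v: "unit_vec N v" and i: "i < N" and j: "j < N"
  shows "((\<lambda>\<theta>. rot N v \<theta> x (k, i, j)) has_vector_derivative
     (\<i> * (\<Sum>p<N. \<Sum>q<N. v p * cnj (v q) *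
        ((if i = p then rot N v \<theta> x (k, q, j) else 0)
          - (if q = j then rot N v \<theta> x (k, i, p) else 0))))) (at \<theta>)"
proof -
  let ?U = "phase v \<theta>" and ?c = "cis \<theta>"
  let ?Y = "\<lambda>i j. rot N v \<theta> x (k, i, j)"
  have cnj: "((\<lambda>\<theta>. cnj (phase v \<theta> j s)) has_vector_derivative cnj (\<i> * v j * (?c * cnj (v s)))) (at \<theta>)" for s
    by (rule bounded_linear.has_vector_derivative[OF bounded_linear_cnj phase_vector_derivative])
  have eig2: "(\<Sum>p<N. v p * cnj (phase v \<theta> p s)) = cnj (cis \<theta> * cnj (v s))" if "s < N" for s
    using arg_cong[OF phase_eigen[OF v that, of \<theta>], of cnj] by (simp add: mult.commute)
  have "((\<lambda>\<theta>. \<Sum>r<N. \<Sum>s<N. phase v \<theta> i r * x (k, r, s) * cnj (phase v \<theta> j s)) has_vector_derivative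
     (\<Sum>r<N. \<Sum>s<N. ?U i r * x (k, r, s) * cnj (\<i> * v j * (?c * cnj (v s)))
         + (\<i> * v i * (?c * cnj (v r))) * x (k, r, s) * cnj (?U j s))) (at \<theta>)"
    by (intro has_vector_derivative_sum)
      (rule has_vector_derivative_mult[OF has_vector_derivative_mult_left[OF phase_vector_derivative] cnj])
  also have "(\<Sum>r<N. \<Sum>s<N. ?U i r * x (k, r, s) * cnj (\<i> * v j * (?c * cnj (v s)))
         + (\<i> * v i * (?c * cnj (v r))) * x (k, r, s) * cnj (?U j s))
     = (\<Sum>r<N. \<Sum>s<N. ?U i r * x (k, r, s) * cnj (\<i> * v j * (?c * cnj (v s))))
       + (\<Sum>r<N. \<Sum>s<N. (\<i> * v i * (?c * cnj (v r))) * x (k, r, s) * cnj (?U j s))"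
    by (simp only: sum.distrib)
  also have "(\<Sum>r<N. \<Sum>s<N. ?U i r * x (k, r, s) * cnj (\<i> * v j * (?c * cnj (v s))))
      = - \<i> * (\<Sum>p<N. v p * cnj (v j) * ?Y i p)"
  proof -
    have "(\<Sum>p<N. v p * cnj (v j) * ?Y i p)
       = (\<Sum>p<N. \<Sum>r<N. \<Sum>s<N. cnj (v j) * ?U i r * x (k, r, s) * (v p * cnj (?U p s)))"
      using i by (simp add: conj_act_def sum_distrib_left algebra_simps)
    also have "\<dots> = (\<Sum>r<N. \<Sum>p<N. \<Sum>s<N. cnj (v j) * ?U i r * x (k, r, s) * (v p * cnj (?U p s)))"
      by (rule sum.swap)
    also have "\<dots> = (\<Sum>r<N. \<Sum>s<N. \<Sum>p<N. cnj (v j) * ?U i r * x (k, r, s) * (v p * cnj (?U p s)))"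
      by (intro sum.cong refl sum.swap)
    also have "\<dots> = (\<Sum>r<N. \<Sum>s<N. cnj (v j) * ?U i r * x (k, r, s) * cnj (cis \<theta> * cnj (v s)))"
      by (simp add: eig2 flip: sum_distrib_left)
    finally show ?thesis
      by (simp add: sum_distrib_left algebra_simps)
  qed
  also have "(\<Sum>r<N. \<Sum>s<N. (\<i> * v i * (?c * cnj (v r))) * x (k, r, s) * cnj (?U j s))
      = \<i> * (\<Sum>q<N. v i * cnj (v q) * ?Y q j)"
  proof -
    have "(\<Sum>q<N. v i * cnj (v q) * ?Y q j)
       = (\<Sum>q<N. \<Sum>r<N. \<Sum>s<N. v i * x (k, r, s) * cnj (?U j s) * (cnj (v q) * ?U q r))"
      using j by (simp add: conj_act_def sum_distrib_left algebra_simps)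
    also have "\<dots> = (\<Sum>r<N. \<Sum>q<N. \<Sum>s<N. v i * x (k, r, s) * cnj (?U j s) * (cnj (v q) * ?U q r))"
      by (rule sum.swap)
    also have "\<dots> = (\<Sum>r<N. \<Sum>s<N. \<Sum>q<N. v i * x (k, r, s) * cnj (?U j s) * (cnj (v q) * ?U q r))"
      by (intro sum.cong refl sum.swap)
    also have "\<dots> = (\<Sum>r<N. \<Sum>s<N. v i * x (k, r, s) * cnj (?U j s) * (?c * cnj (v r)))"
      by (simp add: phase_eigen[OF v] flip: sum_distrib_left)
    finally show ?thesis
      by (simp add: sum_distrib_left algebra_simps)
  qed
  also have "- \<i> * (\<Sum>p<N. v p * cnj (v j) * ?Y i p) + \<i> * (\<Sum>q<N. v i * cnj (v q) * ?Y q j)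
     = \<i> * (\<Sum>p<N. \<Sum>q<N. v p * cnj (v q) * ((if i = p then ?Y q j else 0) - (if q = j then ?Y i p else 0)))"
  proof -
    have "(\<Sum>p<N. \<Sum>q<N. v p * cnj (v q) * ((if i = p then ?Y q j else 0) - (if q = j then ?Y i p else 0)))
       = (\<Sum>p<N. \<Sum>q<N. if i = p then v p * cnj (v q) * ?Y q j else 0)
        - (\<Sum>p<N. \<Sum>q<N. if q = j then v p * cnj (v q) * ?Y i p else 0)"
      unfolding sum_subtractf[symmetric]
      by (intro sum.cong refl) (simp add: algebra_simps)
    also have "(\<Sum>p<N. \<Sum>q<N. if i = p then v p * cnj (v q) * ?Y q j else 0)
        = (\<Sum>q<N. \<Sum>p<N. if i = p then v p * cnj (v q) * ?Y q j else 0)"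
      by (rule sum.swap)
    also have "\<dots> - (\<Sum>p<N. \<Sum>q<N. if q = j then v p * cnj (v q) * ?Y i p else 0)
        = (\<Sum>q<N. v i * cnj (v q) * ?Y q j) - (\<Sum>p<N. v p * cnj (v j) * ?Y i p)"
      using i j by simp
    finally have T: "(\<Sum>p<N. \<Sum>q<N. v p * cnj (v q) * ((if i = p then ?Y q j else 0) - (if q = j then ?Y i p else 0)))
       = (\<Sum>q<N. v i * cnj (v q) * ?Y q j) - (\<Sum>p<N. v p * cnj (v j) * ?Y i p)" .
    show ?thesis
      unfolding T by (simp add: algebra_simps)
  qed
  finally have "((\<lambda>\<theta>. \<Sum>r<N. \<Sum>s<N. phase v \<theta> i r * x (k, r, s) * cnj (phase v \<theta> j s)) has_vector_derivative
     (\<i> * (\<Sum>p<N. \<Sum>q<N. v p * cnj (v q) *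
        ((if i = p then ?Y q j else 0) - (if q = j then ?Y i p else 0))))) (at \<theta>)" .
  moreover have "(\<lambda>\<theta>. rot N v \<theta> x (k, i, j)) = (\<lambda>\<theta>. \<Sum>r<N. \<Sum>s<N. phase v \<theta> i r * x (k, r, s) * cnj (phase v \<theta> j s))"
    using i j by (simp add: conj_act_def)
  ultimately show ?thesis
    by (simp only:)
qed

section \<open>Random variables with moments of all orders\<close>

lemma power_add_le_double:
  fixes a b :: real
  assumes "0 \<le> a" "0 \<le> b" shows "(a + b) ^ n \<le> 2 ^ n * (a ^ n + b ^ n)"
proof -
  have "(a + b) ^ n \<le> (2 * max a b) ^ n"
    using assms by (intro power_mono) auto
  also have "\<dots> \<le> 2 ^ n * (a ^ n + b ^ n)"
    using assms by (auto simp: power_mult_distrib max_def)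
  finally show ?thesis .
qed

lemma power_mult_le_double:
  fixes a b :: real
  shows "\<bar>a * b\<bar> ^ n \<le> \<bar>a\<bar> ^ (2 * n) + \<bar>b\<bar> ^ (2 * n)"
proof -
  have "\<bar>a * b\<bar> ^ n = \<bar>a\<bar> ^ n * \<bar>b\<bar> ^ n"
    by (simp add: abs_mult power_mult_distrib)
  also have "\<dots> \<le> (\<bar>a\<bar> ^ n)\<^sup>2 + (\<bar>b\<bar> ^ n)\<^sup>2"
  proof -
    have "0 \<le> \<bar>a\<bar> ^ n * \<bar>b\<bar> ^ n"
      by simp
    then show ?thesis
      using sum_squares_bound[of "\<bar>a\<bar> ^ n" "\<bar>b\<bar> ^ n"] by linarith
  qed
  finally show ?thesis
    by (simp add: power_even_eq)
qed

text \<open>All powers are required at once because the class must be closed under products;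
  integrability of one fixed order would be lost with the first multiplication.\<close>

definition all_moments :: "'x measure \<Rightarrow> ('x \<Rightarrow> real) \<Rightarrow> bool" where
  "all_moments M W \<longleftrightarrow> W \<in> borel_measurable M \<and> (\<forall>n. integrable M (\<lambda>x. \<bar>W x\<bar> ^ n))"

lemma all_moments_add:
  assumes "all_moments M V" "all_moments M W" shows "all_moments M (\<lambda>x. V x + W x)"
  unfolding all_moments_def
proof (intro conjI allI)
  show m: "(\<lambda>x. V x + W x) \<in> borel_measurable M"
    using assms by (auto simp: all_moments_def)
  fix n
  have "integrable M (\<lambda>x. 2 ^ n * (\<bar>V x\<bar> ^ n + \<bar>W x\<bar> ^ n))"
    using assms by (auto simp: all_moments_def)
  then show "integrable M (\<lambda>x. \<bar>V x + W x\<bar> ^ n)"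
  proof (rule Bochner_Integration.integrable_bound)
    have "\<bar>V x + W x\<bar> ^ n \<le> 2 ^ n * (\<bar>V x\<bar> ^ n + \<bar>W x\<bar> ^ n)" for x
      by (rule order_trans[OF power_mono[OF abs_triangle_ineq] power_add_le_double]) auto
    then show "AE x in M. norm (\<bar>V x + W x\<bar> ^ n) \<le> norm (2 ^ n * (\<bar>V x\<bar> ^ n + \<bar>W x\<bar> ^ n))"
      by (intro AE_I2) (simp add: power_abs)
  qed (use m in measurable)
qed

lemma all_moments_mult:
  assumes "all_moments M V" "all_moments M W" shows "all_moments M (\<lambda>x. V x * W x)"
  unfolding all_moments_def
proof (intro conjI allI)
  show m: "(\<lambda>x. V x * W x) \<in> borel_measurable M"
    using assms by (auto simp: all_moments_def)
  fix n
  have "integrable M (\<lambda>x. \<bar>V x\<bar> ^ (2 * n) + \<bar>W x\<bar> ^ (2 * n))"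
    using assms by (auto simp: all_moments_def)
  then show "integrable M (\<lambda>x. \<bar>V x * W x\<bar> ^ n)"
  proof (rule Bochner_Integration.integrable_bound)
    show "AE x in M. norm (\<bar>V x * W x\<bar> ^ n) \<le> norm (\<bar>V x\<bar> ^ (2 * n) + \<bar>W x\<bar> ^ (2 * n))"
      by (intro AE_I2) (simp add: power_mult_le_double power_abs del: abs_mult power_even_abs)
  qed (use m in measurable)
qed

lemma (in finite_measure) all_moments_const [simp]: "all_moments M (\<lambda>x. c)"
  by (simp add: all_moments_def)

lemma (in finite_measure) all_moments_sum:
  "(\<And>i. i \<in> I \<Longrightarrow> all_moments M (W i)) \<Longrightarrow> all_moments M (\<lambda>x. \<Sum>i\<in>I. W i x)"
  by (induction I rule: infinite_finite_induct) (auto intro: all_moments_add)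

lemma all_moments_integrable: "all_moments M W \<Longrightarrow> integrable M W"
  unfolding all_moments_def
  by (metis (no_types, lifting) ext integrable_abs_iff power_one_right)

subsection \<open>Observables of a unitarily invariant family\<close>

text \<open>The sample space is the space of entries itself, so that rotations act on it and an
  observable becomes a function of the angle along each orbit. Invariance is asked along the
  rank-one groups, whose derivatives determine every direction by polarization.\<close>

locale unitary_invariant =
  fixes N :: nat and \<mu> :: "'k entries measure"
  assumes prob: "prob_space \<mu>"
    and sets_mu [measurable_cong, simp]: "sets \<mu> = sets (PiM UNIV (\<lambda>_. borel))"
    and inv: "unit_vec N v \<Longrightarrow> distr \<mu> (PiM UNIV (\<lambda>_. borel)) (rot N v \<theta>) = \<mu>"
    and mom: "i < N \<Longrightarrow> j < N \<Longrightarrow> all_moments \<mu> (\<lambda>x. cmod (x (k, i, j)))"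
begin

sublocale prob_space \<mu> by (rule prob)

lemma rot_measurable [measurable]: "rot N v \<theta> \<in> measurable \<mu> \<mu>"
proof -
  have "rot N v \<theta> \<in> measurable \<mu> (PiM UNIV (\<lambda>_. borel))"
  proof (rule measurable_PiM_single')
    show "rot N v \<theta> \<in> space \<mu> \<rightarrow> (\<Pi>\<^sub>E i\<in>UNIV. space borel)"
      by simp
    fix z :: "'k \<times> nat \<times> nat"
    obtain k i j where z: "z = (k, i, j)" by (cases z) auto
    have [measurable]: "(\<lambda>x. x z) \<in> borel_measurable \<mu>" for z
      unfolding measurable_cong_sets[OF sets_mu refl] by (rule measurable_component_singleton) simp
    show "(\<lambda>x. rot N v \<theta> x z) \<in> borel_measurable \<mu>"
      unfolding z conj_act_def by simp
  qed
  then show ?thesis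
    by (simp cong: measurable_cong_sets)
qed

text \<open>Differentiating in the angle under the integral needs one dominating function for all
  points of an orbit: \<open>W\<close> is this envelope, uniform in the direction \<open>v\<close>
  as well, and with moments of all orders so that products of observables are again
  dominated.\<close>

definition good :: "('k entries \<Rightarrow> complex) \<Rightarrow> bool" where
  "good F \<longleftrightarrow> F \<in> borel_measurable \<mu> \<and>
     (\<exists>W. all_moments \<mu> W \<and> (\<forall>v \<theta> x. unit_vec N v \<longrightarrow> cmod (F (rot N v \<theta> x)) \<le> W x))"

text \<open>\<open>D p q\<close> is the derivative of \<open>F\<close> under the infinitesimal conjugation by the matrix unit
  \<open>E\<^bsub>pq\<^esub>\<close>, in the sense of the complexified Lie algebra.\<close>

definition obs :: "('k entries \<Rightarrow> complex) \<Rightarrow>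
    (nat \<Rightarrow> nat \<Rightarrow> 'k entries \<Rightarrow> complex) \<Rightarrow> bool" where
  "obs F D \<longleftrightarrow> good F \<and> (\<forall>p<N. \<forall>q<N. good (D p q)) \<and>
     (\<forall>v \<theta> x. unit_vec N v \<longrightarrow> ((\<lambda>\<theta>. F (rot N v \<theta> x)) has_vector_derivative
        (\<i> * (\<Sum>p<N. \<Sum>q<N. v p * cnj (v q) * D p q (rot N v \<theta> x)))) (at \<theta>))"

lemma good_const [simp]: "good (\<lambda>x. c)"
  unfolding good_def using all_moments_const[of "cmod c"] by force

lemma good_add:
  assumes "good F" "good G" shows "good (\<lambda>x. F x + G x)"
proof -
  obtain V W where "all_moments \<mu> V" "\<forall>v \<theta> x. unit_vec N v \<longrightarrow> cmod (F (rot N v \<theta> x)) \<le> V x"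
     "all_moments \<mu> W" "\<forall>v \<theta> x. unit_vec N v \<longrightarrow> cmod (G (rot N v \<theta> x)) \<le> W x"
    using assms unfolding good_def by metis
  then show ?thesis
    using assms unfolding good_def
    by (auto intro!: exI[of _ "\<lambda>x. V x + W x"] all_moments_add order_trans[OF norm_triangle_ineq] add_mono)
qed

lemma good_mult:
  assumes "good F" "good G" shows "good (\<lambda>x. F x * G x)"
proof -
  obtain V W where V: "all_moments \<mu> V" "\<And>v \<theta> x. unit_vec N v \<Longrightarrow> cmod (F (rot N v \<theta> x)) \<le> V x"
     and W: "all_moments \<mu> W" "\<And>v \<theta> x. unit_vec N v \<Longrightarrow> cmod (G (rot N v \<theta> x)) \<le> W x"
    using assms unfolding good_def by metis
  have "cmod (F (rot N v \<theta> x) * G (rot N v \<theta> x)) \<le> V x * W x" if "unit_vec N v" for v \<theta> x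
    unfolding norm_mult using V(2)[OF that, of \<theta> x] W(2)[OF that, of \<theta> x]
    by (intro mult_mono) (auto intro: order_trans[OF norm_ge_zero])
  then show ?thesis
    using assms V W unfolding good_def
    by (auto intro!: exI[of _ "\<lambda>x. V x * W x"] all_moments_mult)
qed

lemma good_sum: "(\<And>i. i \<in> I \<Longrightarrow> good (F i)) \<Longrightarrow> good (\<lambda>x. \<Sum>i\<in>I. F i x)"
  by (induction I rule: infinite_finite_induct) (auto intro: good_add)

lemma good_cmult: "good F \<Longrightarrow> good (\<lambda>x. c * F x)"
  by (intro good_mult good_const)

lemma good_uminus: "good F \<Longrightarrow> good (\<lambda>x. - F x)"
  using good_cmult[of F "-1"] by simp

lemma good_diff: "good F \<Longrightarrow> good G \<Longrightarrow> good (\<lambda>x. F x - G x)"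
  using good_add[of F "\<lambda>x. - G x"] good_uminus[of G] by simp

lemma good_cnj: "good F \<Longrightarrow> good (\<lambda>x. cnj (F x))"
  unfolding good_def
  by (auto intro: borel_measurable_continuous_on[where f = cnj] continuous_on_cnj)

lemma good_entry: "i < N \<Longrightarrow> j < N \<Longrightarrow> good (\<lambda>x. x (k, i, j))"
  unfolding good_def
proof (intro conjI exI allI impI)
  show "(\<lambda>x. x (k, i, j)) \<in> borel_measurable \<mu>"
    unfolding measurable_cong_sets[OF sets_mu refl] by (rule measurable_component_singleton) simp
  show "all_moments \<mu> (\<lambda>x. 9 * (\<Sum>r<N. \<Sum>s<N. cmod (x (k, r, s))))"
    by (intro all_moments_mult all_moments_const all_moments_sum mom) auto
qed (rule conj_act_bound)

definition e0 :: "nat \<Rightarrow> complex" where "e0 = (\<lambda>p. if p = 0 then 1 else 0)"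

lemma unit_vec_e0: "0 < N \<Longrightarrow> unit_vec N e0"
  by (simp add: unit_vec_def e0_def if_distrib[of "\<lambda>x. x * _"] cong: if_cong)

lemma integral_rot:
  assumes "unit_vec N v" "F \<in> borel_measurable \<mu>"
  shows "(\<integral>x. F (rot N v \<theta> x) \<partial>\<mu>) = (\<integral>x. (F x :: complex) \<partial>\<mu>)"
proof -
  have "(\<integral>x. F x \<partial>\<mu>) = (\<integral>x. F x \<partial>distr \<mu> (PiM UNIV (\<lambda>_. borel)) (rot N v \<theta>))"
    using inv[OF assms(1)] by simp
  also have "\<dots> = (\<integral>x. F (rot N v \<theta> x) \<partial>\<mu>)"
    using assms(2) rot_measurable
    by (subst integral_distr) (auto simp: measurable_cong_sets[OF refl sets_mu] measurable_cong_sets[OF sets_mu refl])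
  finally show ?thesis ..
qed

lemma good_rot_integrable:
  assumes "good F" "unit_vec N v" shows "integrable \<mu> (\<lambda>x. F (rot N v \<theta> x))"
proof -
  obtain W where W: "all_moments \<mu> W" "\<And>v \<theta> x. unit_vec N v \<Longrightarrow> cmod (F (rot N v \<theta> x)) \<le> W x"
    using assms unfolding good_def by metis
  have [measurable]: "F \<in> borel_measurable \<mu>" using assms by (simp add: good_def)
  show ?thesis
  proof (rule Bochner_Integration.integrable_bound[OF all_moments_integrable[OF W(1)]])
    show "AE x in \<mu>. norm (F (rot N v \<theta> x)) \<le> norm (W x)"
      using W(2)[OF assms(2)] by (intro AE_I2) (auto intro: order_trans[OF _ abs_ge_self])
  qed measurable
qed

text \<open>The envelope bounds \<open>F\<close> only at rotated points, and even the rotation by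
  angle 0 is not the identity, as it erases the entries outside the block. Invariance of the law
  carries integrability back to \<open>F\<close>.\<close>

lemma good_integrable:
  assumes "good F" "0 < N" shows "integrable \<mu> F"
proof -
  have [measurable]: "F \<in> borel_measurable \<mu>" using assms by (simp add: good_def)
  have "integrable (distr \<mu> (PiM UNIV (\<lambda>_. borel)) (rot N e0 0)) F"
    using good_rot_integrable[OF assms(1) unit_vec_e0[OF assms(2)], of 0] rot_measurable
    by (subst integrable_distr_eq) (auto simp: measurable_cong_sets[OF refl sets_mu] measurable_cong_sets[OF sets_mu refl])
  then show ?thesis
    by (simp add: inv[OF unit_vec_e0[OF assms(2)]])
qed

end

text \<open>Basis vectors give the diagonal. The vectors (e_p + w e_q) / sqrt 2 with |w| = 1 then
  leave \<open>w * f q p + cnj w * f p q = 0\<close>; \<open>w = 1\<close> and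
  \<open>w = \<i>\<close> give the sum and the difference of the two off-diagonal entries.\<close>

lemma polarize_zero:
  fixes f :: "nat \<Rightarrow> nat \<Rightarrow> complex"
  assumes z: "\<And>v. unit_vec N v \<Longrightarrow> (\<Sum>p<N. \<Sum>q<N. v p * cnj (v q) * f p q) = 0"
    and pq: "p < N" "q < N"
  shows "f p q = 0"
proof -
  have form: "(\<Sum>r<N. \<Sum>s<N. v r * cnj (v s) * g r s) = (\<Sum>r\<in>S. \<Sum>s\<in>S. v r * cnj (v s) * g r s)"
    if "S \<subseteq> {..<N}" "\<And>r. r \<notin> S \<Longrightarrow> v r = 0" for S and v :: "nat \<Rightarrow> complex" and g
  proof -
    have "(\<Sum>r<N. \<Sum>s<N. v r * cnj (v s) * g r s) = (\<Sum>r<N. \<Sum>s\<in>S. v r * cnj (v s) * g r s)"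
      using that by (intro sum.cong refl sum.mono_neutral_right) auto
    also have "\<dots> = (\<Sum>r\<in>S. \<Sum>s\<in>S. v r * cnj (v s) * g r s)"
      using that by (intro sum.mono_neutral_right) auto
    finally show ?thesis .
  qed
  have unit: "unit_vec N v" if "S \<subseteq> {..<N}" "\<And>r. r \<notin> S \<Longrightarrow> v r = 0" "(\<Sum>r\<in>S. v r * cnj (v r)) = 1" for S v
    unfolding unit_vec_def using that(3)
    by (subst sum.mono_neutral_right[of _ S]) (use that in auto)
  have diag: "f p p = 0" if "p < N" for p
  proof -
    define v :: "nat \<Rightarrow> complex" where "v = (\<lambda>r. if r = p then 1 else 0)"
    have "unit_vec N v"
      by (rule unit[of "{p}"]) (use that in \<open>auto simp: v_def\<close>)
    then show ?thesis
      using z[of v] form[of "{p}" v f] that by (auto simp: v_def)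
  qed
  show ?thesis
  proof (cases "p = q")
    case True
    then show ?thesis using diag pq by simp
  next
    case False
    have eq: "w * f q p + cnj w * f p q = 0" if w: "w * cnj w = 1" for w
    proof -
      define h :: complex where "h = of_real (1 / sqrt 2)"
      have h: "h * cnj h = 1/2"
        by (simp add: h_def flip: of_real_mult)
      define v :: "nat \<Rightarrow> complex" where "v = (\<lambda>r. if r = p then h else if r = q then h * w else 0)"
      have hw: "h * w * cnj (h * w) = 1/2"
      proof -
        have "h * w * cnj (h * w) = (h * cnj h) * (w * cnj w)"
          by (simp add: mult_ac)
        then show ?thesis
          by (simp only: h w mult_1_right)
      qed
      have "unit_vec N v"
      proof (rule unit[of "{p,q}"])
        have "(\<Sum>r\<in>{p,q}. v r * cnj (v r)) = h * cnj h + h * w * cnj (h * w)"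
          using False by (simp add: v_def)
        then show "(\<Sum>r\<in>{p,q}. v r * cnj (v r)) = 1"
          by (simp only: h hw) simp
      qed (use pq in \<open>auto simp: v_def\<close>)
      then have "(\<Sum>r\<in>{p,q}. \<Sum>s\<in>{p,q}. v r * cnj (v s) * f r s) = 0"
        using z[of v] form[of "{p,q}" v f] pq by (auto simp: v_def)
      then have "(h * cnj h) * (w * f q p + cnj w * f p q) = 0"
        using False diag[OF pq(1)] diag[OF pq(2)] by (simp add: v_def algebra_simps)
      then show ?thesis
        using h by auto
    qed
    from eq[of 1] eq[of \<i>] show ?thesis
      by (simp add: algebra_simps add_eq_0_iff)
  qed
qed

lemma difference_quotient_LIMSEQ:
  fixes f :: "real \<Rightarrow> 'b::real_normed_vector"
  assumes "(f has_vector_derivative G) (at 0)"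
  shows "(\<lambda>n. real (Suc n) *\<^sub>R (f (1 / real (Suc n)) - f 0)) \<longlonglongrightarrow> G"
proof -
  have "((\<lambda>h. norm (f (0 + h) - f 0 - h *\<^sub>R G) / norm h) \<longlongrightarrow> 0) (at 0)"
    using assms unfolding has_vector_derivative_def has_derivative_at by blast
  moreover have "filterlim (\<lambda>n. 1 / real (Suc n)) (at 0) sequentially"
    unfolding filterlim_at using LIMSEQ_inverse_real_of_nat by (auto simp: inverse_eq_divide)
  ultimately have "(\<lambda>n. norm (f (0 + 1 / real (Suc n)) - f 0 - (1 / real (Suc n)) *\<^sub>R G) / norm (1 / real (Suc n))) \<longlonglongrightarrow> 0"
    by (rule filterlim_compose)
  moreover have "norm (f (0 + 1 / real (Suc n)) - f 0 - (1 / real (Suc n)) *\<^sub>R G) / norm (1 / real (Suc n))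
     = norm (real (Suc n) *\<^sub>R (f (1 / real (Suc n)) - f 0) - G)" for n
  proof -
    have "real (Suc n) *\<^sub>R (f (1 / real (Suc n)) - f 0) - G
      = real (Suc n) *\<^sub>R (f (0 + 1 / real (Suc n)) - f 0 - (1 / real (Suc n)) *\<^sub>R G)"
      by (simp add: scaleR_diff_right)
    then show ?thesis
      by (simp only: norm_scaleR) (simp add: field_simps)
  qed
  ultimately have "(\<lambda>n. norm (real (Suc n) *\<^sub>R (f (1 / real (Suc n)) - f 0) - G)) \<longlonglongrightarrow> 0"
    by (simp only:)
  then show ?thesis
    using LIM_zero_cancel tendsto_norm_zero_iff by blast
qed

context unitary_invariant
begin

text \<open>By invariance the mean of \<open>F\<close> along an orbit is constant in the angle. Its
  derivative at 0 is, up to the factor i, the quadratic form in \<open>v\<close> with coefficients E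
  \<open>D p q\<close>, which hence vanishes on unit vectors; polarization kills each
  coefficient.\<close>

lemma integral_derivation_zero:
  assumes F: "obs F D" and pq: "p < N" "q < N"
  shows "(\<integral>x. D p q x \<partial>\<mu>) = 0"
proof -
  from pq have N: "0 < N" by simp
  have "(\<Sum>p<N. \<Sum>q<N. v p * cnj (v q) * (\<integral>x. D p q x \<partial>\<mu>)) = 0" if v: "unit_vec N v" for v
  proof -
    define G where "G x = \<i> * (\<Sum>p<N. \<Sum>q<N. v p * cnj (v q) * D p q x)" for x
    have gG: "good G"
      unfolding G_def using F by (intro good_cmult good_sum) (auto simp: obs_def)
    then obtain W where W: "all_moments \<mu> W" "\<And>v \<theta> x. unit_vec N v \<Longrightarrow> cmod (G (rot N v \<theta> x)) \<le> W x"
      unfolding good_def by metis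
    have gF: "good F" using F by (simp add: obs_def)
    have [measurable]: "F \<in> borel_measurable \<mu>" "G \<in> borel_measurable \<mu>"
      using gF gG by (auto simp: good_def)
    have der: "((\<lambda>\<theta>. F (rot N v \<theta> x)) has_vector_derivative G (rot N v \<theta> x)) (at \<theta>)" for \<theta> x
      using F v by (simp add: obs_def G_def)
    \<comment> \<open>Difference quotients along the steps 1 / (n + 1), because dominated
      convergence is applied to sequences.\<close>
    define Q where "Q n x = real (Suc n) *\<^sub>R (F (rot N v (1 / real (Suc n)) x) - F (rot N v 0 x))" for n x
    have "(\<lambda>n. \<integral>x. Q n x \<partial>\<mu>) \<longlonglongrightarrow> (\<integral>x. G (rot N v 0 x) \<partial>\<mu>)"
    proof (rule integral_dominated_convergence[where w = W])
      show "integrable \<mu> W" by (rule all_moments_integrable[OF W(1)])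
      show "AE x in \<mu>. (\<lambda>n. Q n x) \<longlonglongrightarrow> G (rot N v 0 x)"
      proof (rule AE_I2)
        fix x
        show "(\<lambda>n. Q n x) \<longlonglongrightarrow> G (rot N v 0 x)"
          unfolding Q_def by (rule difference_quotient_LIMSEQ[OF der])
      qed
      show "AE x in \<mu>. norm (Q n x) \<le> W x" for n
      proof (rule AE_I2)
        fix x
        \<comment> \<open>Mean value inequality along the orbit: the envelope of the derivative
          dominates all quotients at once.\<close>
        have "norm (F (rot N v (1 / real (Suc n)) x) - F (rot N v 0 x)) \<le> W x * norm (1 / real (Suc n) - 0)"
        proof (rule differentiable_bound[of UNIV _ "\<lambda>s h. h *\<^sub>R G (rot N v s x)"])
          show "onorm (\<lambda>h. h *\<^sub>R G (rot N v s x)) \<le> W x" for s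
            using W(2)[OF v, of s x] by (intro onorm_le) (simp add: mult.commute mult_left_mono)
          show "((\<lambda>\<theta>. F (rot N v \<theta> x)) has_derivative (\<lambda>h. h *\<^sub>R G (rot N v s x))) (at s within UNIV)" for s
            using der[of x s] by (simp add: has_vector_derivative_def)
        qed auto
        then show "norm (Q n x) \<le> W x"
          by (simp only: Q_def norm_scaleR) (simp add: field_simps)
      qed
    qed (simp_all add: Q_def)
    moreover have "(\<integral>x. Q n x \<partial>\<mu>) = 0" for n
      unfolding Q_def
      by (subst integral_scaleR_right, subst Bochner_Integration.integral_diff)
        (auto intro: good_rot_integrable[OF gF v] simp: integral_rot[OF v])
    ultimately have "(\<integral>x. G (rot N v 0 x) \<partial>\<mu>) = 0"
      by (simp add: LIMSEQ_const_iff)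
    then have "(\<integral>x. G x \<partial>\<mu>) = 0"
      by (simp add: integral_rot[OF v])
    then have "(\<integral>x. (\<Sum>p<N. \<Sum>q<N. v p * cnj (v q) * D p q x) \<partial>\<mu>) = 0"
      by (simp add: G_def)
    moreover have "integrable \<mu> (D p q)" if "p < N" "q < N" for p q
      using F that by (intro good_integrable N) (auto simp: obs_def)
    ultimately show ?thesis
      by (subst (asm) Bochner_Integration.integral_sum)
        (auto simp: Bochner_Integration.integral_sum)
  qed
  from polarize_zero[OF this pq] show ?thesis .
qed

section \<open>Derivation rules for observables\<close>

lemma obs_good: "obs F D \<Longrightarrow> good F"
  by (simp add: obs_def)

lemma obs_cong:
  assumes "obs F D" "\<And>p q x. p < N \<Longrightarrow> q < N \<Longrightarrow> D p q x = D' p q x"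
  shows "obs F D'"
proof -
  have "D p q = D' p q" if "p < N" "q < N" for p q
    using assms(2)[OF that] by auto
  then show ?thesis
    using assms(1) unfolding obs_def by simp
qed

lemma obs_const: "obs (\<lambda>x. c) (\<lambda>p q x. 0)"
  by (simp add: obs_def)

lemma obs_add:
  assumes F: "obs F D" and G: "obs G E" shows "obs (\<lambda>x. F x + G x) (\<lambda>p q x. D p q x + E p q x)"
  unfolding obs_def
proof (intro conjI allI impI)
  fix v \<theta> and x :: "'k entries" assume v: "unit_vec N v"
  let ?w = "\<lambda>D. \<i> * (\<Sum>p<N. \<Sum>q<N. v p * cnj (v q) * D p q (rot N v \<theta> x))"
  have "((\<lambda>\<theta>. F (rot N v \<theta> x) + G (rot N v \<theta> x)) has_vector_derivative ?w D + ?w E) (at \<theta>)"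
    using F G v by (intro has_vector_derivative_add) (auto simp: obs_def)
  also have "?w D + ?w E = ?w (\<lambda>p q x. D p q x + E p q x)"
    by (simp only: distrib_left sum.distrib)
  finally show "((\<lambda>\<theta>. F (rot N v \<theta> x) + G (rot N v \<theta> x)) has_vector_derivative
      ?w (\<lambda>p q x. D p q x + E p q x)) (at \<theta>)" .
qed (use F G in \<open>auto simp: obs_def intro: good_add\<close>)

lemma obs_mult:
  assumes F: "obs F D" and G: "obs G E"
  shows "obs (\<lambda>x. F x * G x) (\<lambda>p q x. D p q x * G x + F x * E p q x)"
  unfolding obs_def
proof (intro conjI allI impI)
  fix v \<theta> and x :: "'k entries" assume v: "unit_vec N v"
  let ?y = "rot N v \<theta> x"
  let ?w = "\<lambda>D. \<i> * (\<Sum>p<N. \<Sum>q<N. v p * cnj (v q) * D p q (rot N v \<theta> x))"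
  have "((\<lambda>\<theta>. F (rot N v \<theta> x) * G (rot N v \<theta> x)) has_vector_derivative F ?y * ?w E + ?w D * G ?y) (at \<theta>)"
    using F G v by (intro has_vector_derivative_mult) (auto simp: obs_def)
  also have "F ?y * ?w E + ?w D * G ?y = ?w (\<lambda>p q x. D p q x * G x + F x * E p q x)"
  proof -
    have "?w (\<lambda>p q x. D p q x * G x + F x * E p q x)
      = \<i> * (\<Sum>p<N. \<Sum>q<N. v p * cnj (v q) * D p q ?y * G ?y) + \<i> * (\<Sum>p<N. \<Sum>q<N. F ?y * (v p * cnj (v q) * E p q ?y))"
      by (simp only: distrib_left sum.distrib mult_ac)
    then show ?thesis
      by (simp only: sum_distrib_left[symmetric] sum_distrib_right[symmetric]) (simp only: mult_ac add_ac)
  qed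
  finally show "((\<lambda>\<theta>. F (rot N v \<theta> x) * G (rot N v \<theta> x)) has_vector_derivative
      ?w (\<lambda>p q x. D p q x * G x + F x * E p q x)) (at \<theta>)" .
qed (use F G in \<open>auto simp: obs_def intro!: good_add good_mult\<close>)

lemma obs_cmult: "obs F D \<Longrightarrow> obs (\<lambda>x. c * F x) (\<lambda>p q x. c * D p q x)"
  by (rule obs_cong[OF obs_mult[OF obs_const]]) auto

lemma obs_diff:
  assumes "obs F D" "obs G E" shows "obs (\<lambda>x. F x - G x) (\<lambda>p q x. D p q x - E p q x)"
  using obs_add[OF assms(1) obs_cmult[OF assms(2), of "-1"]] by simp

lemma obs_sum:
  "(\<And>i. i \<in> I \<Longrightarrow> obs (F i) (D i)) \<Longrightarrow> obs (\<lambda>x. \<Sum>i\<in>I. F i x) (\<lambda>p q x. \<Sum>i\<in>I. D i p q x)"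
  by (induction I rule: infinite_finite_induct) (auto intro: obs_add obs_const)

text \<open>Conjugating the factor i produces the sign, and conjugating
  \<open>v p * cnj (v q)\<close> exchanges p and q, in accordance with E_qp being the adjoint of
  E_pq.\<close>

lemma obs_cnj:
  assumes "obs F D" shows "obs (\<lambda>x. cnj (F x)) (\<lambda>p q x. - cnj (D q p x))"
  unfolding obs_def
proof (intro conjI allI impI)
  show "good (\<lambda>x. cnj (F x))"
    using assms by (auto simp: obs_def intro: good_cnj)
  show "good (\<lambda>x. - cnj (D q p x))" if "p < N" "q < N" for p q
    using assms that by (auto simp: obs_def intro!: good_cnj good_uminus)
  fix v \<theta> and x :: "'k entries" assume v: "unit_vec N v"
  have "((\<lambda>\<theta>. cnj (F (rot N v \<theta> x))) has_vector_derivative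
      cnj (\<i> * (\<Sum>p<N. \<Sum>q<N. v p * cnj (v q) * D p q (rot N v \<theta> x)))) (at \<theta>)"
    using assms v by (intro bounded_linear.has_vector_derivative[OF bounded_linear_cnj]) (simp add: obs_def)
  also have "cnj (\<i> * (\<Sum>p<N. \<Sum>q<N. v p * cnj (v q) * D p q (rot N v \<theta> x)))
     = \<i> * (\<Sum>p<N. \<Sum>q<N. v q * cnj (v p) * - cnj (D p q (rot N v \<theta> x)))"
    by (simp add: sum_negf algebra_simps)
  also have "(\<Sum>p<N. \<Sum>q<N. v q * cnj (v p) * - cnj (D p q (rot N v \<theta> x)))
     = (\<Sum>p<N. \<Sum>q<N. v p * cnj (v q) * - cnj (D q p (rot N v \<theta> x)))"
    by (rule sum.swap)
  finally show "((\<lambda>\<theta>. cnj (F (rot N v \<theta> x))) has_vector_derivative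
      \<i> * (\<Sum>p<N. \<Sum>q<N. v p * cnj (v q) * - cnj (D q p (rot N v \<theta> x)))) (at \<theta>)" .
qed

text \<open>Reality of \<open>Y\<close> gives the exponential modulus 1 and thus a constant
  envelope; the exponential of a complex observable need not have moments.\<close>

lemma obs_exp:
  assumes Y: "obs Y D" and real: "\<And>x. Im (Y x) = 0"
  shows "obs (\<lambda>x. exp (\<i> * of_real t * Y x)) (\<lambda>p q x. \<i> * of_real t * D p q x * exp (\<i> * of_real t * Y x))"
proof -
  have n: "cmod (exp (\<i> * of_real t * Y x)) = 1" for x
    using real[of x] by simp
  have "good (\<lambda>x. exp (\<i> * of_real t * Y x))"
    unfolding good_def
  proof (intro conjI exI allI impI)
    show "all_moments \<mu> (\<lambda>x. 1)" by simp
    have [measurable]: "Y \<in> borel_measurable \<mu>"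
      using Y by (auto simp: obs_def good_def)
    show "(\<lambda>x. exp (\<i> * of_real t * Y x)) \<in> borel_measurable \<mu>"
      by measurable
  qed (simp only: n order_refl)
  moreover have "((\<lambda>\<theta>. exp (\<i> * of_real t * Y (rot N v \<theta> x))) has_vector_derivative
      \<i> * (\<Sum>p<N. \<Sum>q<N. v p * cnj (v q) * (\<i> * of_real t * D p q (rot N v \<theta> x) * exp (\<i> * of_real t * Y (rot N v \<theta> x))))) (at \<theta>)"
    if v: "unit_vec N v" for v \<theta> x
  proof -
    let ?d = "\<i> * (\<Sum>p<N. \<Sum>q<N. v p * cnj (v q) * D p q (rot N v \<theta> x))"
    have "((\<lambda>\<theta>. \<i> * of_real t * Y (rot N v \<theta> x)) has_vector_derivative \<i> * of_real t * ?d) (at \<theta>)"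
      using Y v by (intro has_vector_derivative_mult_right) (simp add: obs_def)
    from field_vector_diff_chain_at[OF this DERIV_exp]
    have "((\<lambda>\<theta>. exp (\<i> * of_real t * Y (rot N v \<theta> x))) has_vector_derivative
        (\<i> * of_real t * ?d) * exp (\<i> * of_real t * Y (rot N v \<theta> x))) (at \<theta>)"
      by (simp add: o_def)
    also have "(\<i> * of_real t * ?d) * exp (\<i> * of_real t * Y (rot N v \<theta> x))
      = \<i> * (\<Sum>p<N. \<Sum>q<N. v p * cnj (v q) * (\<i> * of_real t * D p q (rot N v \<theta> x) * exp (\<i> * of_real t * Y (rot N v \<theta> x))))"
      unfolding sum_distrib_left sum_distrib_right by (intro sum.cong refl) (simp only: mult_ac)
    finally show ?thesis .
  qed
  ultimately show ?thesis
    using Y unfolding obs_def by (auto intro!: good_mult)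
qed

text \<open>A matrix observable \<open>C\<close> is covariant when it transforms like the matrices of the family:
  its derivative along \<open>E\<^bsub>pq\<^esub>\<close> is the commutator \<open>E\<^bsub>pq\<^esub> C - C E\<^bsub>pq\<^esub>\<close>.\<close>

definition covariant :: "('k entries \<Rightarrow> cmat) \<Rightarrow> bool" where
  "covariant C \<longleftrightarrow> (\<forall>i<N. \<forall>j<N. obs (\<lambda>x. C x i j)
     (\<lambda>p q x. (if i = p then C x q j else 0) - (if q = j then C x i p else 0)))"

definition invariant :: "('k entries \<Rightarrow> complex) \<Rightarrow> bool" where
  "invariant \<phi> \<longleftrightarrow> obs \<phi> (\<lambda>p q x. 0)"

lemma covariant_obs:
  "covariant C \<Longrightarrow> i < N \<Longrightarrow> j < N \<Longrightarrow>
    obs (\<lambda>x. C x i j) (\<lambda>p q x. (if i = p then C x q j else 0) - (if q = j then C x i p else 0))"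
  by (simp add: covariant_def)

lemma covariant_good: "covariant C \<Longrightarrow> i < N \<Longrightarrow> j < N \<Longrightarrow> good (\<lambda>x. C x i j)"
  by (auto dest: covariant_obs obs_good)

lemma covariant_entry: "covariant (\<lambda>x i j. x (k, i, j))"
  unfolding covariant_def obs_def
proof (intro allI impI conjI)
  fix i j p q assume "i < N" "j < N" "p < N" "q < N"
  then show "good (\<lambda>x. (if i = p then x (k, q, j) else 0) - (if q = j then x (k, i, p) else 0))"
    by (cases "i = p"; cases "q = j"; simp add: good_entry good_diff good_uminus)
qed (auto intro!: good_entry rot_vector_derivative)

lemma covariant_madj:
  assumes "covariant C" shows "covariant (\<lambda>x. madj (C x))"
  unfolding covariant_def madj_def
  by (intro allI impI, rule obs_cong[OF obs_cnj[OF covariant_obs[OF assms]]]) auto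

text \<open>The product rule inserts E_pq in four places; the two insertions between the factors
  carry opposite signs and cancel.\<close>

lemma covariant_mmult:
  assumes "covariant A" "covariant B" shows "covariant (\<lambda>x. mmult N (A x) (B x))"
  unfolding covariant_def mmult_def
proof (intro allI impI)
  fix i j assume i: "i < N" and j: "j < N"
  have "obs (\<lambda>x. \<Sum>r<N. A x i r * B x r j)
     (\<lambda>p q x. \<Sum>r<N. ((if i = p then A x q r else 0) - (if q = r then A x i p else 0)) * B x r j
         + A x i r * ((if r = p then B x q j else 0) - (if q = j then B x r p else 0)))"
    using i j by (intro obs_sum obs_mult covariant_obs assms) auto
  then show "obs (\<lambda>x. \<Sum>r<N. A x i r * B x r j)
     (\<lambda>p q x. (if i = p then \<Sum>r<N. A x q r * B x r j else 0)
         - (if q = j then \<Sum>r<N. A x i r * B x r p else 0))"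
  proof (rule obs_cong)
    fix p q and x :: "'k entries" assume p: "p < N" and q: "q < N"
    have "(\<Sum>r<N. ((if i = p then A x q r else 0) - (if q = r then A x i p else 0)) * B x r j
         + A x i r * ((if r = p then B x q j else 0) - (if q = j then B x r p else 0)))
      = (\<Sum>r<N. if i = p then A x q r * B x r j else 0) - (\<Sum>r<N. if q = r then A x i p * B x r j else 0)
        + ((\<Sum>r<N. if r = p then A x i r * B x q j else 0) - (\<Sum>r<N. if q = j then A x i r * B x r p else 0))"
      unfolding sum.distrib[symmetric] sum_subtractf[symmetric]
      by (intro sum.cong refl) (simp add: algebra_simps)
    then show "(\<Sum>r<N. ((if i = p then A x q r else 0) - (if q = r then A x i p else 0)) * B x r j
         + A x i r * ((if r = p then B x q j else 0) - (if q = j then B x r p else 0)))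
      = (if i = p then \<Sum>r<N. A x q r * B x r j else 0) - (if q = j then \<Sum>r<N. A x i r * B x r p else 0)"
      using p q by simp
  qed
qed

lemma invariant_mtrace:
  assumes "covariant C" shows "invariant (\<lambda>x. mtrace N (C x))"
proof -
  have "obs (\<lambda>x. \<Sum>i<N. C x i i) (\<lambda>p q x. \<Sum>i<N. (if i = p then C x q i else 0) - (if q = i then C x i p else 0))"
    by (intro obs_sum covariant_obs assms) auto
  then show ?thesis
    unfolding invariant_def mtrace_def by (rule obs_cong) (simp add: sum_subtractf)
qed

lemma invariant_const: "invariant (\<lambda>x. c)"
  by (simp add: invariant_def obs_const)

lemma invariant_mult: "invariant F \<Longrightarrow> invariant G \<Longrightarrow> invariant (\<lambda>x. F x * G x)"
  unfolding invariant_def by (rule obs_cong[OF obs_mult]) auto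

lemma invariant_good: "invariant F \<Longrightarrow> good F"
  by (simp add: invariant_def obs_def)

lemma covariant_scale:
  assumes "invariant \<phi>" "covariant C" shows "covariant (\<lambda>x i j. \<phi> x * C x i j)"
  unfolding covariant_def
  by (intro allI impI, rule obs_cong[OF obs_mult[OF assms(1)[unfolded invariant_def] covariant_obs[OF assms(2)]]])
    (auto simp: algebra_simps)

lemma covariant_diff:
  assumes "covariant A" "covariant B" shows "covariant (\<lambda>x i j. A x i j - B x i j)"
  unfolding covariant_def
  by (intro allI impI, rule obs_cong[OF obs_diff[OF covariant_obs[OF assms(1)] covariant_obs[OF assms(2)]]])
    auto

lemma covariant_mid: "covariant (\<lambda>x. mid)"
  unfolding covariant_def mid_def
  by (intro allI impI, rule obs_cong[OF obs_const]) auto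

end

section \<open>Means of covariant matrices and second moments of linear traces\<close>

definition comm :: "nat \<Rightarrow> cmat \<Rightarrow> cmat \<Rightarrow> cmat" where
  "comm N A B = (\<lambda>i j. mmult N A B i j - mmult N B A i j)"

lemma sum_eq_mmult: "(\<Sum>r<N. A i r * B r j) = mmult N A B i j"
  by (simp add: mmult_def)

context unitary_invariant
begin

definition mgood :: "('k entries \<Rightarrow> cmat) \<Rightarrow> bool" where
  "mgood C \<longleftrightarrow> (\<forall>i<N. \<forall>j<N. good (\<lambda>x. C x i j))"

lemma covariant_mgood: "covariant C \<Longrightarrow> mgood C"
  by (simp add: mgood_def covariant_good)

lemma mgood_const [simp]: "mgood (\<lambda>x. B)"
  by (simp add: mgood_def)

lemma mgood_mmult: "mgood A \<Longrightarrow> mgood B \<Longrightarrow> mgood (\<lambda>x. mmult N (A x) (B x))"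
  unfolding mgood_def mmult_def by (auto intro!: good_sum good_mult)

lemma mgood_madj: "mgood A \<Longrightarrow> mgood (\<lambda>x. madj (A x))"
  unfolding mgood_def madj_def by (auto intro!: good_cnj)

lemma mgood_diff: "mgood A \<Longrightarrow> mgood B \<Longrightarrow> mgood (\<lambda>x i j. A x i j - B x i j)"
  unfolding mgood_def by (auto intro!: good_diff)

lemma mgood_add: "mgood A \<Longrightarrow> mgood B \<Longrightarrow> mgood (\<lambda>x i j. A x i j + B x i j)"
  unfolding mgood_def by (auto intro!: good_add)

lemma mgood_comm: "mgood A \<Longrightarrow> mgood B \<Longrightarrow> mgood (\<lambda>x. comm N (A x) (B x))"
  unfolding comm_def by (intro mgood_diff mgood_mmult)

lemma good_mtrace: "mgood A \<Longrightarrow> good (\<lambda>x. mtrace N (A x))"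
  unfolding mgood_def mtrace_def by (auto intro!: good_sum)

definition rgood :: "('k entries \<Rightarrow> real) \<Rightarrow> bool" where
  "rgood f \<longleftrightarrow> good (\<lambda>x. complex_of_real (f x))"

lemma rgood_integrable: "rgood f \<Longrightarrow> 0 < N \<Longrightarrow> integrable \<mu> f"
  unfolding rgood_def by (drule (1) good_integrable) (simp add: complex_of_real_integrable_eq)

lemma rgood_const [simp]: "rgood (\<lambda>x. c)"
  by (simp add: rgood_def)

lemma rgood_mult: "rgood f \<Longrightarrow> rgood g \<Longrightarrow> rgood (\<lambda>x. f x * g x)"
  by (simp add: rgood_def good_mult)

lemma rgood_norm: "good F \<Longrightarrow> rgood (\<lambda>x. (cmod (F x))\<^sup>2)"
  unfolding rgood_def complex_norm_square by (intro good_mult good_cnj)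

lemma rgood_fro: "mgood A \<Longrightarrow> rgood (\<lambda>x. fro N (A x))"
  unfolding rgood_def fro_eq_mtrace by (intro good_mtrace mgood_mmult mgood_madj)

lemma integral_sum_derivation_zero:
  assumes "\<And>p q. p < N \<Longrightarrow> q < N \<Longrightarrow> obs (G p q) (E p q)"
  shows "(\<integral>x. (\<Sum>p<N. \<Sum>q<N. E p q p q x) \<partial>\<mu>) = 0"
proof (cases "0 < N")
  case True
  have "integrable \<mu> (E p q p q)" if "p < N" "q < N" for p q
    using assms[OF that] that True by (intro good_integrable) (auto simp: obs_def)
  then have "(\<integral>x. (\<Sum>q<N. E p q p q x) \<partial>\<mu>) = (\<Sum>q<N. \<integral>x. E p q p q x \<partial>\<mu>)"
      "integrable \<mu> (\<lambda>x. \<Sum>q<N. E p q p q x)" if "p < N" for p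
    using that by (auto intro: Bochner_Integration.integral_sum Bochner_Integration.integrable_sum)
  then have "(\<integral>x. (\<Sum>p<N. \<Sum>q<N. E p q p q x) \<partial>\<mu>) = (\<Sum>p<N. \<Sum>q<N. \<integral>x. E p q p q x \<partial>\<mu>)"
    by (subst Bochner_Integration.integral_sum) auto
  also have "\<dots> = 0"
    by (intro sum.neutral ballI integral_derivation_zero[OF assms]) auto
  finally show ?thesis .
qed simp

text \<open>Schur's lemma: the mean of a covariant matrix commutes with every matrix unit, hence is
  a scalar matrix, and the scalar is read off from the trace.\<close>

lemma mean_mtrace_mmult:
  assumes C: "covariant C"
  shows "(\<integral>x. mtrace N (mmult N (C x) B) \<partial>\<mu>) = (\<integral>x. mtrace N (C x) \<partial>\<mu>) * mtrace N B / of_nat N"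
proof (cases "0 < N")
  case N: True
  define e where "e i j = (\<integral>x. C x i j \<partial>\<mu>)" for i j
  have eq: "(if i = p then e q j else 0) = (if q = j then e i p else 0)"
    if "i < N" "j < N" "p < N" "q < N" for i j p q
  proof -
    have "integrable \<mu> (\<lambda>x. C x i j)" if "i < N" "j < N" for i j
      using C that N by (intro good_integrable covariant_good)
    then have "(\<integral>x. (if i = p then C x q j else 0) - (if q = j then C x i p else 0) \<partial>\<mu>)
        = (if i = p then e q j else 0) - (if q = j then e i p else 0)"
      using that by (cases "i = p"; cases "q = j"; simp add: e_def Bochner_Integration.integral_diff)
    moreover have "(\<integral>x. (if i = p then C x q j else 0) - (if q = j then C x i p else 0) \<partial>\<mu>) = 0"
      by (rule integral_derivation_zero[OF covariant_obs[OF C]]) (use that in auto)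
    ultimately show ?thesis by simp
  qed
  obtain c where e: "\<And>i j. i < N \<Longrightarrow> j < N \<Longrightarrow> e i j = mid i j * c"
  proof
    fix i j assume ij: "i < N" "j < N"
    show "e i j = mid i j * e 0 0"
      \<comment> \<open>Commutation with E_0i, read at the entry (0, j), says that
        \<open>e i j\<close> is \<open>e 0 0\<close> if i = j and 0 otherwise.\<close>
      using eq[of 0 j 0 i] eq[of 0 i 0 i] ij N by (cases "i = j") (auto simp: mid_def split: if_splits)
  qed
  have int: "integrable \<mu> (\<lambda>x. C x i j)" if "i < N" "j < N" for i j
    using C that N by (intro good_integrable covariant_good)
  have "(\<integral>x. mtrace N (C x) \<partial>\<mu>) = (\<Sum>i<N. e i i)"
    unfolding mtrace_def e_def using int by (subst Bochner_Integration.integral_sum) auto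
  also have "\<dots> = of_nat N * c"
    using e by (simp add: mid_def)
  finally have tr: "(\<integral>x. mtrace N (C x) \<partial>\<mu>) = of_nat N * c" .
  have "(\<integral>x. mtrace N (mmult N (C x) B) \<partial>\<mu>) = (\<Sum>i<N. \<Sum>r<N. e i r * B r i)"
    unfolding mtrace_def mmult_def e_def using int
    by (subst Bochner_Integration.integral_sum) (auto simp: Bochner_Integration.integral_sum)
  also have "\<dots> = (\<Sum>i<N. \<Sum>r<N. mid i r * (c * B r i))"
    using e by (simp add: mult.assoc)
  also have "\<dots> = c * mtrace N B"
    by (simp add: mtrace_def sum_distrib_left)
  finally show ?thesis
    using tr N by simp
qed (simp add: mtrace_def)

text \<open>This is \<open>mean_mtrace_mmult\<close> for the covariant matrix
  \<open>mmult N (C x) (madj (C x))\<close>, scaled by the invariant weight and tested against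
  \<open>mmult N (madj B) B\<close>. The gain of 1/N over \<open>fro_mmult_le\<close> is what
  compensates for deterministic matrices whose squared norm is of order N.\<close>

lemma mean_fro_mmult:
  assumes C: "covariant C" and \<phi>: "invariant (\<lambda>x. complex_of_real (\<phi> x))"
  shows "(\<integral>x. \<phi> x * fro N (mmult N (C x) B) \<partial>\<mu>) = (\<integral>x. \<phi> x * fro N (C x) \<partial>\<mu>) * fro N B / real N"
    and "(\<integral>x. \<phi> x * fro N (mmult N B (C x)) \<partial>\<mu>) = (\<integral>x. \<phi> x * fro N (C x) \<partial>\<mu>) * fro N B / real N"
proof -
  have *: "(\<integral>x. \<phi> x * fro N (mmult N B (C x)) \<partial>\<mu>) = (\<integral>x. \<phi> x * fro N (C x) \<partial>\<mu>) * fro N B / real N"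
    if C: "covariant C" for C B
  proof -
    let ?C = "\<lambda>x i j. complex_of_real (\<phi> x) * mmult N (C x) (madj (C x)) i j"
    let ?B = "mmult N (madj B) B"
    have cov: "covariant ?C"
      by (intro covariant_scale[OF \<phi>] covariant_mmult covariant_madj C)
    have tr: "mtrace N (mmult N (?C x) ?B) = complex_of_real (\<phi> x * fro N (mmult N B (C x)))" for x
    proof -
      have "mtrace N (mmult N (?C x) ?B) = complex_of_real (\<phi> x) * mtrace N (mmult N (mmult N (C x) (madj (C x))) ?B)"
        by (simp add: mtrace_def mmult_def sum_distrib_left mult_ac)
      also have "mtrace N (mmult N (mmult N (C x) (madj (C x))) ?B)
          = mtrace N (mmult N B (mmult N (mmult N (C x) (madj (C x))) (madj B)))"
        by (subst (2) mtrace_commute) (simp add: mmult_assoc)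
      also have "\<dots> = complex_of_real (fro N (mmult N B (C x)))"
        by (simp add: fro_eq_mtrace madj_mmult mmult_assoc)
      finally show ?thesis by simp
    qed
    have tr2: "mtrace N (?C x) = complex_of_real (\<phi> x * fro N (C x))" for x
      by (simp add: fro_eq_mtrace) (simp add: mtrace_def sum_distrib_left)
    have tr3: "mtrace N ?B = complex_of_real (fro N B)"
      by (subst mtrace_commute) (simp add: fro_eq_mtrace)
    have "complex_of_real (\<integral>x. \<phi> x * fro N (mmult N B (C x)) \<partial>\<mu>)
        = complex_of_real ((\<integral>x. \<phi> x * fro N (C x) \<partial>\<mu>) * fro N B / real N)"
      using mean_mtrace_mmult[OF cov, of ?B] unfolding tr tr2 tr3 integral_complex_of_real
      by simp
    then show ?thesis
      unfolding of_real_eq_iff .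
  qed
  show "(\<integral>x. \<phi> x * fro N (mmult N B (C x)) \<partial>\<mu>) = (\<integral>x. \<phi> x * fro N (C x) \<partial>\<mu>) * fro N B / real N"
    by (rule *[OF C])
  have "fro N (mmult N (C x) B) = fro N (mmult N (madj B) (madj (C x)))" for x
    using fro_madj[of N "mmult N (C x) B"] by (simp add: madj_mmult)
  then show "(\<integral>x. \<phi> x * fro N (mmult N (C x) B) \<partial>\<mu>) = (\<integral>x. \<phi> x * fro N (C x) \<partial>\<mu>) * fro N B / real N"
    using *[OF covariant_madj[OF C], of "madj B"] by simp
qed

lemma obs_mmult_right:
  assumes C: "covariant C" and ij: "i < N" "j < N"
  shows "obs (\<lambda>x. mmult N (C x) B i j)
    (\<lambda>p q x. (if i = p then mmult N (C x) B q j else 0) - C x i p * B q j)"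
proof -
  have "obs (\<lambda>x. \<Sum>r<N. B r j * C x i r)
     (\<lambda>p q x. \<Sum>r<N. B r j * ((if i = p then C x q r else 0) - (if q = r then C x i p else 0)))"
    using ij by (intro obs_sum obs_cmult covariant_obs C) auto
  then have "obs (\<lambda>x. \<Sum>r<N. B r j * C x i r)
    (\<lambda>p q x. (if i = p then mmult N (C x) B q j else 0) - C x i p * B q j)"
    by (rule obs_cong) (auto simp: right_diff_distrib sum_subtractf mmult_def mult.commute
      if_distrib[of "\<lambda>x. _ * x"] cong: if_cong)
  then show ?thesis
    by (simp add: mmult_def mult.commute)
qed

lemma obs_mmult_left:
  assumes C: "covariant C" and ij: "i < N" "j < N"
  shows "obs (\<lambda>x. mmult N B (C x) i j)
    (\<lambda>p q x. B i p * C x q j - (if q = j then mmult N B (C x) i p else 0))"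
proof -
  have "obs (\<lambda>x. \<Sum>r<N. B i r * C x r j)
     (\<lambda>p q x. \<Sum>r<N. B i r * ((if r = p then C x q j else 0) - (if q = j then C x r p else 0)))"
    using ij by (intro obs_sum obs_cmult covariant_obs C) auto
  then have "obs (\<lambda>x. \<Sum>r<N. B i r * C x r j)
    (\<lambda>p q x. B i p * C x q j - (if q = j then mmult N B (C x) i p else 0))"
    by (rule obs_cong) (auto simp: right_diff_distrib sum_subtractf mmult_def
      if_distrib[of "\<lambda>x. _ * x"] cong: if_cong)
  then show ?thesis
    by (simp add: mmult_def)
qed

text \<open>Cyclicity moves the commutator to the other pair: Tr ([E_pq, C] B) = Tr (E_pq
  [C, B]).\<close>

lemma obs_mtrace_mmult:
  assumes C: "covariant C"
  shows "obs (\<lambda>x. mtrace N (mmult N (C x) B)) (\<lambda>p q x. comm N (C x) B q p)"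
proof -
  have "obs (\<lambda>x. \<Sum>i<N. mmult N (C x) B i i)
     (\<lambda>p q x. \<Sum>i<N. (if i = p then mmult N (C x) B q i else 0) - C x i p * B q i)"
    by (intro obs_sum obs_mmult_right C) auto
  then show ?thesis
    unfolding mtrace_def
  proof (rule obs_cong)
    fix p q and x :: "'k entries" assume "p < N" "q < N"
    then show "(\<Sum>i<N. (if i = p then mmult N (C x) B q i else 0) - C x i p * B q i) = comm N (C x) B q p"
      unfolding sum_subtractf comm_def by (simp add: mmult_def[of N B] mult.commute)
  qed
qed

lemma obs_comm:
  assumes C: "covariant C" and ij: "i < N" "j < N"
  shows "obs (\<lambda>x. comm N (C x) B i j)
    (\<lambda>p q x. ((if i = p then mmult N (C x) B q j else 0) - C x i p * B q j)
       - (B i p * C x q j - (if q = j then mmult N B (C x) i p else 0)))"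
  unfolding comm_def by (intro obs_diff obs_mmult_left obs_mmult_right C ij)

text \<open>The summand is the derivative in \<open>obs_comm\<close> at i = p and j = q; the
  tautological conditions are kept so that the two match literally. The correction Tr C Tr B
  disappears once one of the matrices is traceless, whence the eigenvalue 2N.\<close>

lemma laplacian_mtrace_mmult:
  "(\<Sum>p<N. \<Sum>q<N. ((if p = p then mmult N C B q q else 0) - C p p * B q q)
       - (B p p * C q q - (if q = q then mmult N B C p p else 0)))
     = 2 * of_nat N * mtrace N (mmult N C B) - 2 * mtrace N C * mtrace N B"
proof -
  have "(\<Sum>p<N. \<Sum>q<N. ((if p = p then mmult N C B q q else 0) - C p p * B q q)
       - (B p p * C q q - (if q = q then mmult N B C p p else 0)))
     = of_nat N * mtrace N (mmult N C B) - mtrace N C * mtrace N B - mtrace N B * mtrace N C + of_nat N * mtrace N (mmult N B C)"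
    by (simp add: sum.distrib sum_subtractf mtrace_def sum_product sum_distrib_left[of "complex_of_nat N"])
  then show ?thesis
    by (simp add: mtrace_commute[of N B C])
qed

text \<open>Integration by parts for \<open>\<phi>\<close> times W_pq times the conjugate of X,
  where W = [C, B] is the gradient of X. Differentiating W gives the Laplacian 2N X, differentiating
  the conjugate of X gives minus the conjugate of W_pq, and the invariant weight behaves like a
  constant.\<close>

lemma second_moment_mtrace_eq:
  fixes B :: cmat
  assumes C: "covariant C" and tr: "\<And>x. mtrace N (C x) = 0" and \<phi>: "invariant \<phi>"
  defines "X \<equiv> \<lambda>x. mtrace N (mmult N (C x) B)"
  shows "(\<integral>x. \<phi> x * (2 * of_nat N * (X x * cnj (X x)) - of_real (fro N (comm N (C x) B))) \<partial>\<mu>) = 0"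
proof -
  let ?W = "\<lambda>x. comm N (C x) B"
  let ?DW = "\<lambda>i j p q x. ((if i = p then mmult N (C x) B q j else 0) - C x i p * B q j)
       - (B i p * C x q j - (if q = j then mmult N B (C x) i p else 0))"
  have "obs (\<lambda>x. \<phi> x * (?W x i j * cnj (X x)))
     (\<lambda>p q x. 0 * (?W x i j * cnj (X x)) + \<phi> x * (?DW i j p q x * cnj (X x) + ?W x i j * (- cnj (?W x p q))))"
    if "i < N" "j < N" for i j
    using that \<phi> unfolding X_def invariant_def
    by (intro obs_mult obs_cnj obs_comm obs_mtrace_mmult C) auto
  from integral_sum_derivation_zero[of "\<lambda>i j x. \<phi> x * (?W x i j * cnj (X x))"
      "\<lambda>i j p q x. 0 * (?W x i j * cnj (X x)) + \<phi> x * (?DW i j p q x * cnj (X x) + ?W x i j * (- cnj (?W x p q)))", OF this]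
  have "(\<integral>x. (\<Sum>p<N. \<Sum>q<N. \<phi> x * (?DW p q p q x * cnj (X x) + ?W x p q * (- cnj (?W x p q)))) \<partial>\<mu>) = 0"
    by simp
  also have "(\<lambda>x. \<Sum>p<N. \<Sum>q<N. \<phi> x * (?DW p q p q x * cnj (X x) + ?W x p q * (- cnj (?W x p q))))
     = (\<lambda>x. \<phi> x * (2 * of_nat N * (X x * cnj (X x)) - of_real (fro N (?W x))))"
  proof
    fix x
    have "(\<Sum>p<N. \<Sum>q<N. \<phi> x * (?DW p q p q x * cnj (X x) + ?W x p q * (- cnj (?W x p q))))
       = \<phi> x * ((\<Sum>p<N. \<Sum>q<N. ?DW p q p q x) * cnj (X x) - (\<Sum>p<N. \<Sum>q<N. ?W x p q * cnj (?W x p q)))"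
      by (simp only: sum_distrib_left[symmetric] sum_distrib_right[symmetric] sum.distrib mult_minus_right sum_negf)
        simp
    also have "(\<Sum>p<N. \<Sum>q<N. ?DW p q p q x) = 2 * of_nat N * X x"
      unfolding laplacian_mtrace_mmult X_def tr by simp
    also have "(\<Sum>p<N. \<Sum>q<N. ?W x p q * cnj (?W x p q)) = of_real (fro N (?W x))"
      by (simp add: fro_def complex_norm_square del: of_real_power)
    finally show "(\<Sum>p<N. \<Sum>q<N. \<phi> x * (?DW p q p q x * cnj (X x) + ?W x p q * (- cnj (?W x p q))))
       = \<phi> x * (2 * of_nat N * (X x * cnj (X x)) - of_real (fro N (?W x)))"
      by (simp add: mult_ac)
  qed
  finally show ?thesis .
qed

lemma fro_comm_le: "fro N (comm N A B) \<le> 2 * fro N (mmult N A B) + 2 * fro N (mmult N B A)"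
  unfolding comm_def by (rule fro_diff_le)

text \<open>\<open>second_moment_mtrace_eq\<close> equates 2N E \<open>\<phi>\<close> |X|^2 with the
  weighted mean of |[C, B]|^2. Both halves of the commutator are evaluated by
  \<open>mean_fro_mmult\<close>, which gives 4/N in total, and division by 2N leaves 2/N^2.\<close>

lemma second_moment_mtrace_le:
  fixes B :: cmat
  assumes N: "0 < N" and C: "covariant C" and tr: "\<And>x. mtrace N (C x) = 0"
    and \<phi>: "invariant (\<lambda>x. complex_of_real (\<phi> x))" and \<phi>0: "\<And>x. 0 \<le> \<phi> x"
  shows "(\<integral>x. \<phi> x * (cmod (mtrace N (mmult N (C x) B)))\<^sup>2 \<partial>\<mu>)
     \<le> 2 / (real N)\<^sup>2 * (\<integral>x. \<phi> x * fro N (C x) \<partial>\<mu>) * fro N B"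
proof -
  let ?X = "\<lambda>x. mtrace N (mmult N (C x) B)"
  note mg = covariant_mgood[OF C]
  have r\<phi>: "rgood \<phi>"
    using invariant_good[OF \<phi>] by (simp add: rgood_def)
  have r1: "rgood (\<lambda>x. \<phi> x * (cmod (?X x))\<^sup>2)"
    by (intro rgood_mult rgood_norm r\<phi> good_mtrace mgood_mmult mg mgood_const)
  have r2: "rgood (\<lambda>x. \<phi> x * fro N (mmult N (C x) B))" "rgood (\<lambda>x. \<phi> x * fro N (mmult N B (C x)))"
     "rgood (\<lambda>x. \<phi> x * fro N (comm N (C x) B))"
    by (intro rgood_mult rgood_fro r\<phi> mgood_mmult mgood_comm mg mgood_const)+
  note int = rgood_integrable[OF r1 N] r2[THEN rgood_integrable, OF N]
  have "complex_of_real (\<integral>x. 2 * real N * (\<phi> x * (cmod (?X x))\<^sup>2) - \<phi> x * fro N (comm N (C x) B) \<partial>\<mu>) = 0"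
    unfolding integral_complex_of_real[symmetric] second_moment_mtrace_eq[OF C tr \<phi>, of B, symmetric]
    by (intro Bochner_Integration.integral_cong refl) (simp add: complex_norm_square algebra_simps del: of_real_power)
  then have "(\<integral>x. 2 * real N * (\<phi> x * (cmod (?X x))\<^sup>2) - \<phi> x * fro N (comm N (C x) B) \<partial>\<mu>) = 0"
    unfolding of_real_eq_0_iff .
  then have "2 * real N * (\<integral>x. \<phi> x * (cmod (?X x))\<^sup>2 \<partial>\<mu>) = (\<integral>x. \<phi> x * fro N (comm N (C x) B) \<partial>\<mu>)"
    using int by (simp add: Bochner_Integration.integral_diff)
  also have "\<dots> \<le> (\<integral>x. 2 * (\<phi> x * fro N (mmult N (C x) B)) + 2 * (\<phi> x * fro N (mmult N B (C x))) \<partial>\<mu>)"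
  proof (rule integral_mono)
    fix x
    show "\<phi> x * fro N (comm N (C x) B) \<le> 2 * (\<phi> x * fro N (mmult N (C x) B)) + 2 * (\<phi> x * fro N (mmult N B (C x)))"
      using mult_left_mono[OF fro_comm_le[of "C x" B] \<phi>0[of x]] by (simp add: algebra_simps)
  qed (use int in auto)
  also have "\<dots> = 4 * ((\<integral>x. \<phi> x * fro N (C x) \<partial>\<mu>) * fro N B / real N)"
    using int by (simp add: mean_fro_mmult[OF C \<phi>])
  finally show ?thesis
    using N by (simp add: field_simps power2_eq_square)
qed

text \<open>E_pq is inserted on the left (plus) and on the right (minus) of each covariant letter of
  A Y A' Z. Each resulting word is cut at the insertion: what precedes ends in column p, what
  follows starts in row q.\<close>

lemma obs_mmult_word1:
  assumes A: "covariant A" and A': "covariant A'" and ij: "i < N" "j < N"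
  shows "obs (\<lambda>x. mmult N (mmult N (A x) Y) (mmult N (A' x) Z) i j)
    (\<lambda>p q x. (if i = p then mmult N (mmult N (A x) Y) (mmult N (A' x) Z) q j else 0)
       - A x i p * mmult N Y (mmult N (A' x) Z) q j
       + mmult N (A x) Y i p * mmult N (A' x) Z q j
       - mmult N (mmult N (A x) Y) (A' x) i p * Z q j)"
proof -
  have "obs (\<lambda>x. \<Sum>r<N. mmult N (A x) Y i r * mmult N (A' x) Z r j)
     (\<lambda>p q x. \<Sum>r<N. ((if i = p then mmult N (A x) Y q r else 0) - A x i p * Y q r) * mmult N (A' x) Z r j
       + mmult N (A x) Y i r * ((if r = p then mmult N (A' x) Z q j else 0) - A' x r p * Z q j))"
    using ij by (intro obs_sum obs_mult obs_mmult_right A A') auto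
  then have "obs (\<lambda>x. \<Sum>r<N. mmult N (A x) Y i r * mmult N (A' x) Z r j)
     (\<lambda>p q x. (if i = p then mmult N (mmult N (A x) Y) (mmult N (A' x) Z) q j else 0)
       - A x i p * mmult N Y (mmult N (A' x) Z) q j
       + mmult N (A x) Y i p * mmult N (A' x) Z q j
       - mmult N (mmult N (A x) Y) (A' x) i p * Z q j)"
  proof (rule obs_cong)
    fix p q and x :: "'k entries" assume p: "p < N" and q: "q < N"
    have "(\<Sum>r<N. ((if i = p then mmult N (A x) Y q r else 0) - A x i p * Y q r) * mmult N (A' x) Z r j
       + mmult N (A x) Y i r * ((if r = p then mmult N (A' x) Z q j else 0) - A' x r p * Z q j))
      = (\<Sum>r<N. if i = p then mmult N (A x) Y q r * mmult N (A' x) Z r j else 0)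
        - (\<Sum>r<N. A x i p * (Y q r * mmult N (A' x) Z r j))
        + ((\<Sum>r<N. if r = p then mmult N (A x) Y i r * mmult N (A' x) Z q j else 0)
        - (\<Sum>r<N. (mmult N (A x) Y i r * A' x r p) * Z q j))"
      unfolding sum.distrib[symmetric] sum_subtractf[symmetric]
      by (intro sum.cong refl) (simp add: algebra_simps)
    also have "\<dots> = (if i = p then mmult N (mmult N (A x) Y) (mmult N (A' x) Z) q j else 0)
       - A x i p * mmult N Y (mmult N (A' x) Z) q j
       + (mmult N (A x) Y i p * mmult N (A' x) Z q j
       - mmult N (mmult N (A x) Y) (A' x) i p * Z q j)"
      unfolding sum_distrib_left[symmetric] sum_distrib_right[symmetric] sum_eq_mmult
      using p by (cases "i = p") (simp_all add: sum_eq_mmult)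
    finally show "(\<Sum>r<N. ((if i = p then mmult N (A x) Y q r else 0) - A x i p * Y q r) * mmult N (A' x) Z r j
       + mmult N (A x) Y i r * ((if r = p then mmult N (A' x) Z q j else 0) - A' x r p * Z q j))
      = (if i = p then mmult N (mmult N (A x) Y) (mmult N (A' x) Z) q j else 0)
       - A x i p * mmult N Y (mmult N (A' x) Z) q j
       + mmult N (A x) Y i p * mmult N (A' x) Z q j
       - mmult N (mmult N (A x) Y) (A' x) i p * Z q j"
      by simp
  qed
  then show ?thesis
    unfolding sum_eq_mmult .
qed

lemma obs_mmult_word2:
  assumes A: "covariant A" and A': "covariant A'" and ij: "i < N" "j < N"
  shows "obs (\<lambda>x. mmult N (mmult N Y (A x)) (mmult N Z (A' x)) i j)
    (\<lambda>p q x. Y i p * mmult N (A x) (mmult N Z (A' x)) q j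
       - mmult N Y (A x) i p * mmult N Z (A' x) q j
       + mmult N (mmult N Y (A x)) Z i p * A' x q j
       - (if q = j then mmult N (mmult N Y (A x)) (mmult N Z (A' x)) i p else 0))"
proof -
  have "obs (\<lambda>x. \<Sum>r<N. mmult N Y (A x) i r * mmult N Z (A' x) r j)
     (\<lambda>p q x. \<Sum>r<N. (Y i p * A x q r - (if q = r then mmult N Y (A x) i p else 0)) * mmult N Z (A' x) r j
       + mmult N Y (A x) i r * (Z r p * A' x q j - (if q = j then mmult N Z (A' x) r p else 0)))"
    using ij by (intro obs_sum obs_mult obs_mmult_left A A') auto
  then have "obs (\<lambda>x. \<Sum>r<N. mmult N Y (A x) i r * mmult N Z (A' x) r j)
     (\<lambda>p q x. Y i p * mmult N (A x) (mmult N Z (A' x)) q j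
       - mmult N Y (A x) i p * mmult N Z (A' x) q j
       + mmult N (mmult N Y (A x)) Z i p * A' x q j
       - (if q = j then mmult N (mmult N Y (A x)) (mmult N Z (A' x)) i p else 0))"
  proof (rule obs_cong)
    fix p q and x :: "'k entries" assume p: "p < N" and q: "q < N"
    have "(\<Sum>r<N. (Y i p * A x q r - (if q = r then mmult N Y (A x) i p else 0)) * mmult N Z (A' x) r j
       + mmult N Y (A x) i r * (Z r p * A' x q j - (if q = j then mmult N Z (A' x) r p else 0)))
      = (\<Sum>r<N. Y i p * (A x q r * mmult N Z (A' x) r j))
        - (\<Sum>r<N. if q = r then mmult N Y (A x) i p * mmult N Z (A' x) r j else 0)
        + ((\<Sum>r<N. (mmult N Y (A x) i r * Z r p) * A' x q j)
        - (\<Sum>r<N. if q = j then mmult N Y (A x) i r * mmult N Z (A' x) r p else 0))"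
      unfolding sum.distrib[symmetric] sum_subtractf[symmetric]
      by (intro sum.cong refl) (simp add: algebra_simps)
    also have "\<dots> = Y i p * mmult N (A x) (mmult N Z (A' x)) q j
       - mmult N Y (A x) i p * mmult N Z (A' x) q j
       + (mmult N (mmult N Y (A x)) Z i p * A' x q j
       - (if q = j then mmult N (mmult N Y (A x)) (mmult N Z (A' x)) i p else 0))"
      unfolding sum_distrib_left[symmetric] sum_distrib_right[symmetric] sum_eq_mmult
      using q by (cases "q = j") (simp_all add: sum_eq_mmult)
    finally show "(\<Sum>r<N. (Y i p * A x q r - (if q = r then mmult N Y (A x) i p else 0)) * mmult N Z (A' x) r j
       + mmult N Y (A x) i r * (Z r p * A' x q j - (if q = j then mmult N Z (A' x) r p else 0)))
      = Y i p * mmult N (A x) (mmult N Z (A' x)) q j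
       - mmult N Y (A x) i p * mmult N Z (A' x) q j
       + mmult N (mmult N Y (A x)) Z i p * A' x q j
       - (if q = j then mmult N (mmult N Y (A x)) (mmult N Z (A' x)) i p else 0)"
      by simp
  qed
  then show ?thesis
    unfolding sum_eq_mmult .
qed

text \<open>The trace T of the word is only approximately an eigenfunction: its Laplacian is 4N T +
  2Q with Q a sum of products of two simple traces. Integration by parts yields 4N E |T|^2 = E |V|^2
  - 2 Re E (Q cnj T), with V the gradient of T. The term in V produces the summand with
  \<open>a\<close>, the term in Q the summand with \<open>b\<close>.\<close>

lemma mtrace_word_bound:
  fixes M M' :: cmat
  assumes N: "0 < N" and A: "covariant A" and A': "covariant A'"
    and trA: "\<And>x. mtrace N (A x) = 0" and trA': "\<And>x. mtrace N (A' x) = 0"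
    and trM: "mtrace N M = 0" and trM': "mtrace N M' = 0"
    and m: "fro N M \<le> m" "fro N M' \<le> m"
    and a: "(\<integral>x. fro N (mmult N (madj (A x)) (A x)) \<partial>\<mu>) \<le> a"
           "(\<integral>x. fro N (mmult N (madj (A' x)) (A' x)) \<partial>\<mu>) \<le> a"
    and b: "(\<integral>x. fro N (A' x) * fro N (A x) \<partial>\<mu>) \<le> b"
  shows "(\<integral>x. (cmod (mtrace N (mmult N (mmult N (A x) M) (mmult N (A' x) M'))))\<^sup>2 \<partial>\<mu>)
     \<le> 8 * a * m\<^sup>2 / (real N)\<^sup>2 + 2 * b * m\<^sup>2 / (real N) ^ 4"
proof -
  define T where "T x = mtrace N (mmult N (mmult N (A x) M) (mmult N (A' x) M'))" for x
  define w1 where "w1 x = mmult N (mmult N (A x) M) (mmult N (A' x) M')" for x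
  define w2 where "w2 x = mmult N (mmult N M (A' x)) (mmult N M' (A x))" for x
  define w3 where "w3 x = mmult N (mmult N (A' x) M') (mmult N (A x) M)" for x
  define w4 where "w4 x = mmult N (mmult N M' (A x)) (mmult N M (A' x))" for x
  \<comment> \<open>The gradient of T: the cyclic word is opened at each of the four places where
    E_pq can be inserted, with alternating signs.\<close>
  define V where "V x = (\<lambda>i j. w1 x i j - w2 x i j + w3 x i j - w4 x i j)" for x
  define D1 where "D1 A M A' M' i j p q x = (if i = p then mmult N (mmult N (A x) M) (mmult N (A' x) M') q j else 0)
       - A x i p * mmult N M (mmult N (A' x) M') q j
       + mmult N (A x) M i p * mmult N (A' x) M' q j
       - mmult N (mmult N (A x) M) (A' x) i p * M' q j"
     for A A' :: "'k entries \<Rightarrow> cmat" and M M' :: cmat and i j p q x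
  define D2 where "D2 Y A Z A' i j p q x = Y i p * mmult N (A x) (mmult N Z (A' x)) q j
       - mmult N Y (A x) i p * mmult N Z (A' x) q j
       + mmult N (mmult N Y (A x)) Z i p * A' x q j
       - (if q = j then mmult N (mmult N Y (A x)) (mmult N Z (A' x)) i p else 0)"
     for A A' :: "'k entries \<Rightarrow> cmat" and Y Z :: cmat and i j p q x
  define DV where "DV i j p q x = D1 A M A' M' i j p q x - D2 M A' M' A i j p q x
      + D1 A' M' A M i j p q x - D2 M' A M A' i j p q x" for i j p q x
  note mg = covariant_mgood[OF A] covariant_mgood[OF A']
  have obsV: "obs (\<lambda>x. V x i j) (DV i j)" if "i < N" "j < N" for i j
    unfolding V_def DV_def w1_def w2_def w3_def w4_def D1_def D2_def using that
    by (intro obs_diff obs_add obs_mmult_word1 obs_mmult_word2 A A') auto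
  have obsT: "obs T (\<lambda>p q x. V x q p)"
  proof -
    have "obs (\<lambda>x. \<Sum>i<N. mmult N (mmult N (A x) M) (mmult N (A' x) M') i i)
       (\<lambda>p q x. \<Sum>i<N. D1 A M A' M' i i p q x)"
      unfolding D1_def by (intro obs_sum obs_mmult_word1 A A') auto
    then show ?thesis
      unfolding T_def mtrace_def
    proof (rule obs_cong)
      fix p q and x :: "'k entries" assume p: "p < N" and q: "q < N"
      have "(\<Sum>i<N. D1 A M A' M' i i p q x) = mmult N (mmult N (A x) M) (mmult N (A' x) M') q p
         - (\<Sum>i<N. mmult N M (mmult N (A' x) M') q i * A x i p)
         + (\<Sum>i<N. mmult N (A' x) M' q i * mmult N (A x) M i p)
         - (\<Sum>i<N. M' q i * mmult N (mmult N (A x) M) (A' x) i p)"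
        unfolding D1_def using p by (simp add: sum_subtractf sum.distrib mult.commute)
      then show "(\<Sum>i<N. D1 A M A' M' i i p q x) = V x q p"
        unfolding sum_eq_mmult V_def w1_def w2_def w3_def w4_def by (simp add: mmult_assoc)
    qed
  qed
  \<comment> \<open>The products of traces left in the Laplacian once those containing the trace of
    A, A', M or M' have vanished.\<close>
  define Q where "Q x = mtrace N (mmult N (A x) M) * mtrace N (mmult N (A' x) M')
      + mtrace N (mmult N (A' x) M) * mtrace N (mmult N (A x) M')" for x
  have sumD1: "(\<Sum>p<N. \<Sum>q<N. D1 A M A' M' p q p q x)
     = of_nat N * mtrace N (mmult N (mmult N (A x) M) (mmult N (A' x) M'))
       - mtrace N (A x) * mtrace N (mmult N M (mmult N (A' x) M'))
       + mtrace N (mmult N (A x) M) * mtrace N (mmult N (A' x) M')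
       - mtrace N (mmult N (mmult N (A x) M) (A' x)) * mtrace N M'" for A M A' M' x
    unfolding D1_def by (simp add: sum.distrib sum_subtractf mtrace_def sum_product sum_distrib_left[of "complex_of_nat N"])
  have sumD2: "(\<Sum>p<N. \<Sum>q<N. D2 Y A Z A' p q p q x)
     = mtrace N Y * mtrace N (mmult N (A x) (mmult N Z (A' x)))
       - mtrace N (mmult N Y (A x)) * mtrace N (mmult N Z (A' x))
       + mtrace N (mmult N (mmult N Y (A x)) Z) * mtrace N (A' x)
       - of_nat N * mtrace N (mmult N (mmult N Y (A x)) (mmult N Z (A' x)))" for A Y A' Z x
    unfolding D2_def by (simp add: sum.distrib sum_subtractf mtrace_def sum_product sum_distrib_left[of "complex_of_nat N"])
  have sumDV: "(\<Sum>p<N. \<Sum>q<N. DV p q p q x) = 4 * of_nat N * T x + 2 * Q x" for x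
  proof -
    have t2: "mtrace N (w2 x) = T x"
    proof -
      have "mtrace N (w2 x) = mtrace N (mmult N (mmult N (A' x) (mmult N M' (A x))) M)"
        unfolding w2_def mmult_assoc by (subst mtrace_commute) (simp only: mmult_assoc)
      also have "\<dots> = mtrace N (mmult N (mmult N (A' x) M') (mmult N (A x) M))"
        by (simp only: mmult_assoc)
      also have "\<dots> = T x"
        unfolding T_def by (rule mtrace_commute)
      finally show ?thesis .
    qed
    have t3: "mtrace N (w3 x) = T x"
      unfolding w3_def T_def by (rule mtrace_commute)
    have t4: "mtrace N (w4 x) = T x"
      unfolding w4_def T_def by (simp add: mmult_assoc) (subst mtrace_commute, simp add: mmult_assoc)
    have "(\<Sum>p<N. \<Sum>q<N. DV p q p q x) = (\<Sum>p<N. \<Sum>q<N. D1 A M A' M' p q p q x) - (\<Sum>p<N. \<Sum>q<N. D2 M A' M' A p q p q x)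
      + (\<Sum>p<N. \<Sum>q<N. D1 A' M' A M p q p q x) - (\<Sum>p<N. \<Sum>q<N. D2 M' A M A' p q p q x)"
      unfolding DV_def by (simp only: sum.distrib sum_subtractf)
    also have "\<dots> = 4 * of_nat N * T x + 2 * Q x"
      unfolding sumD1 sumD2 trA trA' trM trM' Q_def
      using t2 t3 t4 unfolding w2_def w3_def w4_def
      by (simp add: T_def mtrace_commute[of N M] mtrace_commute[of N M'])
    finally show ?thesis .
  qed
  have "obs (\<lambda>x. V x i j * cnj (T x)) (\<lambda>p q x. DV i j p q x * cnj (T x) + V x i j * (- cnj (V x p q)))"
    if "i < N" "j < N" for i j
    by (intro obs_mult obs_cnj obsV obsT that)
  from integral_sum_derivation_zero[of "\<lambda>i j x. V x i j * cnj (T x)"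
      "\<lambda>i j p q x. DV i j p q x * cnj (T x) + V x i j * (- cnj (V x p q))", OF this]
  have "(\<integral>x. (\<Sum>p<N. \<Sum>q<N. DV p q p q x * cnj (T x) + V x p q * (- cnj (V x p q))) \<partial>\<mu>) = 0"
    by simp
  also have "(\<lambda>x. \<Sum>p<N. \<Sum>q<N. DV p q p q x * cnj (T x) + V x p q * (- cnj (V x p q)))
     = (\<lambda>x. 4 * of_nat N * (T x * cnj (T x)) + 2 * (Q x * cnj (T x)) - of_real (fro N (V x)))"
  proof
    fix x
    have "(\<Sum>p<N. \<Sum>q<N. DV p q p q x * cnj (T x) + V x p q * (- cnj (V x p q)))
       = (\<Sum>p<N. \<Sum>q<N. DV p q p q x) * cnj (T x) - (\<Sum>p<N. \<Sum>q<N. V x p q * cnj (V x p q))"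
      by (simp add: sum.distrib sum_subtractf sum_negf sum_distrib_right)
    also have "(\<Sum>p<N. \<Sum>q<N. V x p q * cnj (V x p q)) = of_real (fro N (V x))"
      by (simp add: fro_def complex_norm_square del: of_real_power)
    finally show "(\<Sum>p<N. \<Sum>q<N. DV p q p q x * cnj (T x) + V x p q * (- cnj (V x p q)))
       = 4 * of_nat N * (T x * cnj (T x)) + 2 * (Q x * cnj (T x)) - of_real (fro N (V x))"
      unfolding sumDV by (simp add: algebra_simps)
  qed
  finally have main: "(\<integral>x. 4 * of_nat N * (T x * cnj (T x)) + 2 * (Q x * cnj (T x)) - of_real (fro N (V x)) \<partial>\<mu>) = 0" .
  have gw: "mgood w1" "mgood w2" "mgood w3" "mgood w4"
    unfolding w1_def w2_def w3_def w4_def by (intro mgood_mmult mg mgood_const)+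
  have gV: "mgood V"
    unfolding V_def by (intro mgood_diff mgood_add gw)
  have gT: "good T" and gQ: "good Q"
    unfolding T_def Q_def by (intro good_add good_mult good_mtrace mgood_mmult mg mgood_const)+
  have intT: "integrable \<mu> (\<lambda>x. (cmod (T x))\<^sup>2)" and intQ: "integrable \<mu> (\<lambda>x. (cmod (Q x))\<^sup>2)"
    and intV: "integrable \<mu> (\<lambda>x. fro N (V x))" and intw: "integrable \<mu> (\<lambda>x. fro N (w1 x))"
      "integrable \<mu> (\<lambda>x. fro N (w2 x))" "integrable \<mu> (\<lambda>x. fro N (w3 x))" "integrable \<mu> (\<lambda>x. fro N (w4 x))"
    by (intro rgood_integrable[OF _ N] rgood_norm gT gQ rgood_fro gV gw)+
  have intQT: "integrable \<mu> (\<lambda>x. Re (Q x * cnj (T x)))"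
    by (intro integrable_Re good_integrable[OF _ N] good_mult gQ good_cnj gT)
  have "integrable \<mu> (\<lambda>x. 4 * of_nat N * (T x * cnj (T x)) + 2 * (Q x * cnj (T x)) - of_real (fro N (V x)))"
    by (intro good_integrable[OF _ N] good_diff good_add good_cmult good_mult gQ good_cnj gT
        rgood_fro[OF gV, unfolded rgood_def])
  then have "0 = (\<integral>x. Re (4 * of_nat N * (T x * cnj (T x)) + 2 * (Q x * cnj (T x)) - of_real (fro N (V x))) \<partial>\<mu>)"
    using main by (simp only: integral_Re) simp
  also have "\<dots> = (\<integral>x. 4 * real N * (cmod (T x))\<^sup>2 + 2 * Re (Q x * cnj (T x)) - fro N (V x) \<partial>\<mu>)"
    unfolding cmod_power2 by (intro Bochner_Integration.integral_cong refl) (simp add: power2_eq_square algebra_simps)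
  \<comment> \<open>Half of 4N |T|^2 is given up to absorb the cross term by Young's inequality; the
    factor 4 is the loss in splitting the squared norm of a sum of four matrices.\<close>
  also have "\<dots> \<ge> (\<integral>x. 2 * real N * (cmod (T x))\<^sup>2 - (cmod (Q x))\<^sup>2 / (2 * real N)
      - 4 * (fro N (w1 x) + fro N (w2 x) + fro N (w3 x) + fro N (w4 x)) \<partial>\<mu>)"
  proof (rule integral_mono)
    fix x
    have "- (2 * Re (Q x * cnj (T x))) \<le> 2 * cmod (Q x) * cmod (T x)"
      using complex_Re_le_cmod[of "- (Q x * cnj (T x))"] by (simp add: norm_mult)
    also have "\<dots> \<le> 2 * real N * (cmod (T x))\<^sup>2 + (cmod (Q x))\<^sup>2 / (2 * real N)"
    proof -
      have "0 \<le> (2 * real N * cmod (T x) - cmod (Q x))\<^sup>2 / (2 * real N)"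
        by simp
      also have "\<dots> = 2 * real N * (cmod (T x))\<^sup>2 + (cmod (Q x))\<^sup>2 / (2 * real N) - 2 * cmod (Q x) * cmod (T x)"
        using N by (simp add: field_simps power2_eq_square)
      finally show ?thesis by simp
    qed
    finally have 1: "- (2 * Re (Q x * cnj (T x))) \<le> 2 * real N * (cmod (T x))\<^sup>2 + (cmod (Q x))\<^sup>2 / (2 * real N)" .
    have "fro N (V x) = fro N (\<lambda>i j. (w1 x i j - w2 x i j) - (w4 x i j - w3 x i j))"
      by (rule fro_cong) (simp add: V_def)
    then have "fro N (V x) \<le> 2 * (2 * fro N (w1 x) + 2 * fro N (w2 x)) + 2 * (2 * fro N (w4 x) + 2 * fro N (w3 x))"
      using fro_diff_le[of N "\<lambda>i j. w1 x i j - w2 x i j" "\<lambda>i j. w4 x i j - w3 x i j"]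
        fro_diff_le[of N "w1 x" "w2 x"] fro_diff_le[of N "w4 x" "w3 x"] by simp
    with 1 show "2 * real N * (cmod (T x))\<^sup>2 - (cmod (Q x))\<^sup>2 / (2 * real N)
        - 4 * (fro N (w1 x) + fro N (w2 x) + fro N (w3 x) + fro N (w4 x))
      \<le> 4 * real N * (cmod (T x))\<^sup>2 + 2 * Re (Q x * cnj (T x)) - fro N (V x)"
      by (simp add: algebra_simps)
  qed (intro Bochner_Integration.integrable_add Bochner_Integration.integrable_diff integrable_mult_right
      integrable_divide intT intQ intw intV intQT)+
  finally have *: "2 * real N * (\<integral>x. (cmod (T x))\<^sup>2 \<partial>\<mu>) \<le> (\<integral>x. (cmod (Q x))\<^sup>2 \<partial>\<mu>) / (2 * real N)
     + 4 * ((\<integral>x. fro N (w1 x) \<partial>\<mu>) + (\<integral>x. fro N (w2 x) \<partial>\<mu>) + (\<integral>x. fro N (w3 x) \<partial>\<mu>) + (\<integral>x. fro N (w4 x) \<partial>\<mu>))"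
    using intT intQ intw by simp

  have m0: "0 \<le> m" using m(1) fro_nonneg order_trans by blast
  \<comment> \<open>\<open>fro_sandwich_le\<close> separates the two random factors. Each of the two
    resulting products contains a single covariant factor, \<open>madj A\<close> times
    \<open>A\<close> or \<open>A'\<close> times \<open>madj A'\<close>, so
    \<open>mean_fro_mmult\<close> applies and supplies the 1/N.\<close>
  have frosw: "(\<integral>x. fro N (mmult N (A x) (mmult N M (A' x))) \<partial>\<mu>) \<le> a * m / real N"
    if A: "covariant A" and A': "covariant A'" and m: "fro N M \<le> m"
      and a: "(\<integral>x. fro N (mmult N (madj (A x)) (A x)) \<partial>\<mu>) \<le> a" "(\<integral>x. fro N (mmult N (madj (A' x)) (A' x)) \<partial>\<mu>) \<le> a"
    for A A' M
  proof -
    note mg = covariant_mgood[OF A] covariant_mgood[OF A']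
    have cov: "covariant (\<lambda>x. mmult N (madj (A x)) (A x))" "covariant (\<lambda>x. mmult N (A' x) (madj (A' x)))"
      by (intro covariant_mmult covariant_madj A A')+
    have int: "integrable \<mu> (\<lambda>x. fro N (mmult N (A x) (mmult N M (A' x))))"
      "integrable \<mu> (\<lambda>x. fro N (mmult N (mmult N (madj (A x)) (A x)) M))"
      "integrable \<mu> (\<lambda>x. fro N (mmult N M (mmult N (A' x) (madj (A' x)))))"
      by (intro rgood_integrable[OF _ N] rgood_fro mgood_mmult mgood_madj mg mgood_const)+
    have one: "invariant (\<lambda>x. complex_of_real 1)" by (rule invariant_const)
    have "(\<integral>x. fro N (mmult N (A x) (mmult N M (A' x))) \<partial>\<mu>)
      \<le> (\<integral>x. (fro N (mmult N (mmult N (madj (A x)) (A x)) M) + fro N (mmult N M (mmult N (A' x) (madj (A' x))))) / 2 \<partial>\<mu>)"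
      by (intro integral_mono fro_sandwich_le) (use int in auto)
    also have "\<dots> = ((\<integral>x. fro N (mmult N (madj (A x)) (A x)) \<partial>\<mu>) * fro N M / real N
        + (\<integral>x. fro N (mmult N (madj (A' x)) (A' x)) \<partial>\<mu>) * fro N M / real N) / 2"
      using int mean_fro_mmult(1)[OF cov(1) one, of M] mean_fro_mmult(2)[OF cov(2) one, of M] by (simp add: fro_madj_commute)
    also have "\<dots> \<le> (a * m / real N + a * m / real N) / 2"
    proof -
      have "0 \<le> (\<integral>x. fro N (mmult N (madj (A x)) (A x)) \<partial>\<mu>)"
        by (simp add: integral_nonneg)
      then have "0 \<le> a" using a(1) by linarith
      then show ?thesis
        using N by (intro divide_right_mono add_mono mult_mono a m) auto
    qed
    finally show ?thesis by simp
  qed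
  \<comment> \<open>One deterministic factor is split off by submultiplicativity, at the price
    \<open>m\<close>; only the sandwich that remains benefits from averaging.\<close>
  have wbound: "(\<integral>x. fro N (w x) \<partial>\<mu>) \<le> (a * m / real N) * m"
    if w: "\<And>x. fro N (w x) \<le> fro N (mmult N (A x) (mmult N M (A' x))) * fro N M'" and intw: "integrable \<mu> (\<lambda>x. fro N (w x))"
      and A: "covariant A" and A': "covariant A'" and m: "fro N M \<le> m" "fro N M' \<le> m"
      and a: "(\<integral>x. fro N (mmult N (madj (A x)) (A x)) \<partial>\<mu>) \<le> a" "(\<integral>x. fro N (mmult N (madj (A' x)) (A' x)) \<partial>\<mu>) \<le> a"
    for w A A' M M'
  proof -
    note mg = covariant_mgood[OF A] covariant_mgood[OF A']
    have int: "integrable \<mu> (\<lambda>x. fro N (mmult N (A x) (mmult N M (A' x))))"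
      by (intro rgood_integrable[OF _ N] rgood_fro mgood_mmult mgood_madj mg mgood_const)
    have "(\<integral>x. fro N (w x) \<partial>\<mu>) \<le> (\<integral>x. fro N (mmult N (A x) (mmult N M (A' x))) * fro N M' \<partial>\<mu>)"
      by (intro integral_mono w intw) (use int in auto)
    also have "\<dots> = (\<integral>x. fro N (mmult N (A x) (mmult N M (A' x))) \<partial>\<mu>) * fro N M'"
      using int by simp
    also have "\<dots> \<le> (a * m / real N) * m"
    proof (rule mult_mono[OF frosw[OF A A' m(1) a] m(2)])
      have "0 \<le> (\<integral>x. fro N (mmult N (madj (A x)) (A x)) \<partial>\<mu>)"
        by (simp add: integral_nonneg)
      then have "0 \<le> a" using a(1) by linarith
      then show "0 \<le> a * m / real N" using m0 by simp
    qed simp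
    finally show ?thesis .
  qed
  have W: "(\<integral>x. fro N (w1 x) \<partial>\<mu>) \<le> (a * m / real N) * m" "(\<integral>x. fro N (w2 x) \<partial>\<mu>) \<le> (a * m / real N) * m"
     "(\<integral>x. fro N (w3 x) \<partial>\<mu>) \<le> (a * m / real N) * m" "(\<integral>x. fro N (w4 x) \<partial>\<mu>) \<le> (a * m / real N) * m"
  proof -
    show "(\<integral>x. fro N (w1 x) \<partial>\<mu>) \<le> (a * m / real N) * m"
      by (rule wbound[OF _ intw(1) A A' m(1) m(2) a(1) a(2)], unfold w1_def mmult_assoc[symmetric], rule fro_mmult_le)
    show "(\<integral>x. fro N (w3 x) \<partial>\<mu>) \<le> (a * m / real N) * m"
      by (rule wbound[OF _ intw(3) A' A m(2) m(1) a(2) a(1)], unfold w3_def mmult_assoc[symmetric], rule fro_mmult_le)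
    show "(\<integral>x. fro N (w2 x) \<partial>\<mu>) \<le> (a * m / real N) * m"
      by (rule wbound[OF _ intw(2) A' A m(2) m(1) a(2) a(1)], unfold w2_def mmult_assoc,
          subst mult.commute, rule fro_mmult_le)
    show "(\<integral>x. fro N (w4 x) \<partial>\<mu>) \<le> (a * m / real N) * m"
      by (rule wbound[OF _ intw(4) A A' m(1) m(2) a(1) a(2)], unfold w4_def mmult_assoc,
          subst mult.commute, rule fro_mmult_le)
  qed
  have Qb: "(\<integral>x. (cmod (Q x))\<^sup>2 \<partial>\<mu>) \<le> 8 * b * m\<^sup>2 / (real N)\<^sup>2"
  proof -
    \<comment> \<open>In each product of Q the trace containing A' is bounded pointwise by
      Cauchy-Schwarz, its square by \<open>?\<phi> x * m\<close>, and the trace containing A is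
      averaged with \<open>?\<phi>\<close> as invariant weight.\<close>
    let ?\<phi> = "\<lambda>x. fro N (A' x)"
    have inv: "invariant (\<lambda>x. complex_of_real (?\<phi> x))"
      unfolding fro_eq_mtrace by (intro invariant_mtrace covariant_mmult covariant_madj A')
    have tb: "(\<integral>x. ?\<phi> x * (cmod (mtrace N (mmult N (A x) M)))\<^sup>2 \<partial>\<mu>) \<le> 2 / (real N)\<^sup>2 * b * m" if "fro N M \<le> m" for M
    proof -
      have "(\<integral>x. ?\<phi> x * (cmod (mtrace N (mmult N (A x) M)))\<^sup>2 \<partial>\<mu>)
         \<le> 2 / (real N)\<^sup>2 * (\<integral>x. ?\<phi> x * fro N (A x) \<partial>\<mu>) * fro N M"
        by (rule second_moment_mtrace_le[OF N A trA inv]) simp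
      also have "\<dots> \<le> 2 / (real N)\<^sup>2 * b * m"
      proof -
        have "0 \<le> (\<integral>x. ?\<phi> x * fro N (A x) \<partial>\<mu>)"
          by (simp add: integral_nonneg)
        then have "0 \<le> b" using b by linarith
        then show ?thesis
          by (intro mult_mono b that) auto
      qed
      finally show ?thesis .
    qed
    have int: "integrable \<mu> (\<lambda>x. ?\<phi> x * (cmod (mtrace N (mmult N (A x) M)))\<^sup>2)" for M
      by (intro rgood_integrable[OF _ N] rgood_mult rgood_fro rgood_norm good_mtrace mgood_mmult mg mgood_const)
    have "(\<integral>x. (cmod (Q x))\<^sup>2 \<partial>\<mu>) \<le> (\<integral>x. 2 * m * (?\<phi> x * (cmod (mtrace N (mmult N (A x) M)))\<^sup>2)
        + 2 * m * (?\<phi> x * (cmod (mtrace N (mmult N (A x) M')))\<^sup>2) \<partial>\<mu>)"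
    proof (rule integral_mono)
      fix x
      let ?a = "mtrace N (mmult N (A x) M)" and ?b = "mtrace N (mmult N (A' x) M')"
      let ?c = "mtrace N (mmult N (A' x) M)" and ?d = "mtrace N (mmult N (A x) M')"
      have "(cmod (Q x))\<^sup>2 \<le> (cmod (?a * ?b) + cmod (?c * ?d))\<^sup>2"
        unfolding Q_def by (intro power_mono norm_triangle_ineq) simp
      also have "\<dots> \<le> 2 * (cmod (?a * ?b))\<^sup>2 + 2 * (cmod (?c * ?d))\<^sup>2"
        using sum_squares_bound[of "cmod (?a * ?b)" "cmod (?c * ?d)"] by (simp add: power2_sum)
      also have "\<dots> = 2 * ((cmod ?b)\<^sup>2 * (cmod ?a)\<^sup>2) + 2 * ((cmod ?c)\<^sup>2 * (cmod ?d)\<^sup>2)"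
        by (simp add: norm_mult power_mult_distrib)
      also have "\<dots> \<le> 2 * ((?\<phi> x * m) * (cmod ?a)\<^sup>2) + 2 * ((?\<phi> x * m) * (cmod ?d)\<^sup>2)"
      proof -
        have "(cmod ?b)\<^sup>2 \<le> ?\<phi> x * m" "(cmod ?c)\<^sup>2 \<le> ?\<phi> x * m"
          using mtrace_mmult_le[of N "A' x" M'] mtrace_mmult_le[of N "A' x" M]
            mult_left_mono[OF m(1) fro_nonneg[of N "A' x"]] mult_left_mono[OF m(2) fro_nonneg[of N "A' x"]] by linarith+
        then show ?thesis
          by (intro add_mono mult_left_mono mult_right_mono) auto
      qed
      finally show "(cmod (Q x))\<^sup>2 \<le> 2 * m * (?\<phi> x * (cmod ?a)\<^sup>2) + 2 * m * (?\<phi> x * (cmod ?d)\<^sup>2)"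
        by (simp add: mult_ac)
    qed (use int intQ in auto)
    also have "\<dots> = 2 * m * (\<integral>x. ?\<phi> x * (cmod (mtrace N (mmult N (A x) M)))\<^sup>2 \<partial>\<mu>)
       + 2 * m * (\<integral>x. ?\<phi> x * (cmod (mtrace N (mmult N (A x) M')))\<^sup>2 \<partial>\<mu>)"
      using int by simp
    also have "\<dots> \<le> 2 * m * (2 / (real N)\<^sup>2 * b * m) + 2 * m * (2 / (real N)\<^sup>2 * b * m)"
      using m0 by (intro add_mono mult_left_mono tb m) auto
    finally show ?thesis
      by (simp add: power2_eq_square mult_ac)
  qed
  have "2 * real N * (\<integral>x. (cmod (T x))\<^sup>2 \<partial>\<mu>) \<le> 8 * b * m\<^sup>2 / (real N)\<^sup>2 / (2 * real N) + 4 * (4 * (a * m / real N * m))"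
    using N by (intro order_trans[OF *] add_mono divide_right_mono Qb mult_left_mono) (use W in linarith)+
  also have "\<dots> = 2 * real N * (8 * a * m\<^sup>2 / (real N)\<^sup>2 + 2 * b * m\<^sup>2 / (real N) ^ 4)"
    using N by (simp add: field_simps power2_eq_square power4_eq_xxxx)
  finally show ?thesis
    using N unfolding T_def[symmetric] by (subst (asm) mult_le_cancel_left_pos) auto
qed

end

subsection \<open>Approximate Gaussian integration by parts\<close>

text \<open>\<open>cis (t * u)\<close> is Lipschitz in \<open>t\<close> with constant |u|, so the
  absolute value of \<open>y\<close> dominates all difference quotients.\<close>

lemma has_vector_derivative_integral_cis:
  fixes y :: "'x \<Rightarrow> real"
  assumes M: "prob_space M" and y: "integrable M y"
  shows "((\<lambda>t. \<integral>x. cis (t * y x) \<partial>M) has_vector_derivative (\<integral>x. \<i> * of_real (y x) * cis (t * y x) \<partial>M)) (at t)"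
proof -
  interpret prob_space M by fact
  have [measurable]: "y \<in> borel_measurable M" using y by auto
  have der: "((\<lambda>t. cis (t * u)) has_vector_derivative \<i> * of_real u * cis (t * u)) (at t)" for t u
    by (auto intro!: derivative_eq_intros simp: has_vector_derivative_def scaleR_conv_of_real algebra_simps)
  have lip: "cmod (cis (s * u) - cis (t * u)) \<le> \<bar>u\<bar> * \<bar>s - t\<bar>" for s t u
  proof -
    have "norm (cis (s * u) - cis (t * u)) \<le> \<bar>u\<bar> * norm (s - t)"
    proof (rule differentiable_bound[of UNIV _ "\<lambda>s h. h *\<^sub>R (\<i> * of_real u * cis (s * u))"])
      show "onorm (\<lambda>h. h *\<^sub>R (\<i> * of_real u * cis (s * u))) \<le> \<bar>u\<bar>" for s
        by (intro onorm_le) (simp add: norm_mult mult.commute)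
      show "((\<lambda>s. cis (s * u)) has_derivative (\<lambda>h. h *\<^sub>R (\<i> * of_real u * cis (s * u)))) (at s within UNIV)" for s
        using der[of u s] by (simp add: has_vector_derivative_def)
    qed auto
    then show ?thesis by simp
  qed
  have int: "integrable M (\<lambda>x. cis (t * y x))" for t
    by (rule integrable_const_bound[of _ 1]) auto
  let ?D = "\<integral>x. \<i> * of_real (y x) * cis (t * y x) \<partial>M"
  have "((\<lambda>s. ((\<integral>x. cis (s * y x) \<partial>M) - (\<integral>x. cis (t * y x) \<partial>M)) /\<^sub>R (s - t)) \<longlongrightarrow> ?D) (at t)"
    unfolding tendsto_at_iff_sequentially o_def
  proof (intro allI impI)
    fix s :: "nat \<Rightarrow> real" assume s: "\<forall>i. s i \<in> UNIV - {t}" "s \<longlonglongrightarrow> t"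
    have "(\<lambda>n. \<integral>x. (cis (s n * y x) - cis (t * y x)) /\<^sub>R (s n - t) \<partial>M) \<longlonglongrightarrow> ?D"
    proof (rule integral_dominated_convergence[where w = "\<lambda>x. \<bar>y x\<bar>"])
      show "AE x in M. (\<lambda>n. (cis (s n * y x) - cis (t * y x)) /\<^sub>R (s n - t)) \<longlonglongrightarrow> \<i> * of_real (y x) * cis (t * y x)"
      proof (rule AE_I2)
        fix x
        have "((\<lambda>s. norm ((cis (s * y x) - cis (t * y x)) - (s - t) *\<^sub>R (\<i> * of_real (y x) * cis (t * y x))) / norm (s - t)) \<longlongrightarrow> 0) (at t)"
          using der[of "y x" t] unfolding has_vector_derivative_def has_derivative_iff_norm by simp
        then have "(\<lambda>n. norm ((cis (s n * y x) - cis (t * y x)) - (s n - t) *\<^sub>R (\<i> * of_real (y x) * cis (t * y x))) / norm (s n - t)) \<longlonglongrightarrow> 0"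
          using s unfolding tendsto_at_iff_sequentially o_def by blast
        moreover have "norm ((cis (s n * y x) - cis (t * y x)) - (s n - t) *\<^sub>R (\<i> * of_real (y x) * cis (t * y x))) / norm (s n - t)
           = norm ((cis (s n * y x) - cis (t * y x)) /\<^sub>R (s n - t) - \<i> * of_real (y x) * cis (t * y x))" for n
        proof -
          have "s n - t \<noteq> 0" using s(1) by auto
          then have "(cis (s n * y x) - cis (t * y x)) /\<^sub>R (s n - t) - \<i> * of_real (y x) * cis (t * y x)
            = ((cis (s n * y x) - cis (t * y x)) - (s n - t) *\<^sub>R (\<i> * of_real (y x) * cis (t * y x))) /\<^sub>R (s n - t)"
            by (simp add: scaleR_diff_right)
          then show ?thesis
            by (simp only: norm_scaleR) (simp add: divide_inverse mult.commute)
        qed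
        ultimately have "(\<lambda>n. norm ((cis (s n * y x) - cis (t * y x)) /\<^sub>R (s n - t) - \<i> * of_real (y x) * cis (t * y x))) \<longlonglongrightarrow> 0"
          by (simp only:)
        then show "(\<lambda>n. (cis (s n * y x) - cis (t * y x)) /\<^sub>R (s n - t)) \<longlonglongrightarrow> \<i> * of_real (y x) * cis (t * y x)"
          using LIM_zero_cancel tendsto_norm_zero_iff by blast
      qed
      show "AE x in M. norm ((cis (s n * y x) - cis (t * y x)) /\<^sub>R (s n - t)) \<le> \<bar>y x\<bar>" for n
      proof (rule AE_I2)
        fix x
        have "0 < \<bar>s n - t\<bar>" using s(1) by auto
        then show "norm ((cis (s n * y x) - cis (t * y x)) /\<^sub>R (s n - t)) \<le> \<bar>y x\<bar>"
          using lip[of "s n" "y x" t] unfolding norm_scaleR real_norm_def abs_inverse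
          by (simp add: field_simps)
      qed
    qed (use y in auto)
    then show "(\<lambda>n. ((\<integral>x. cis (s n * y x) \<partial>M) - (\<integral>x. cis (t * y x) \<partial>M)) /\<^sub>R (s n - t)) \<longlonglongrightarrow> ?D"
      by (simp add: int Bochner_Integration.integral_diff)
  qed
  then have lim: "((\<lambda>s. norm (((\<integral>x. cis (s * y x) \<partial>M) - (\<integral>x. cis (t * y x) \<partial>M)) /\<^sub>R (s - t) - ?D)) \<longlongrightarrow> 0) (at t)"
    by (intro tendsto_norm_zero LIM_zero)
  show ?thesis
    unfolding has_vector_derivative_def has_derivative_iff_norm
  proof (intro conjI)
    show "bounded_linear (\<lambda>h. h *\<^sub>R ?D)"
      by (rule bounded_linear_scaleR_left)
    have eq: "norm ((\<integral>x. cis (s * y x) \<partial>M) - (\<integral>x. cis (t * y x) \<partial>M) - (s - t) *\<^sub>R ?D) / norm (s - t)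
      = norm (((\<integral>x. cis (s * y x) \<partial>M) - (\<integral>x. cis (t * y x) \<partial>M)) /\<^sub>R (s - t) - ?D)" if "s \<noteq> t" for s
    proof -
      have "((\<integral>x. cis (s * y x) \<partial>M) - (\<integral>x. cis (t * y x) \<partial>M)) /\<^sub>R (s - t) - ?D
        = ((\<integral>x. cis (s * y x) \<partial>M) - (\<integral>x. cis (t * y x) \<partial>M) - (s - t) *\<^sub>R ?D) /\<^sub>R (s - t)"
        using that by (simp add: scaleR_diff_right)
      then show ?thesis
        by (simp only: norm_scaleR) (simp add: divide_inverse mult.commute)
    qed
    have ev: "\<forall>\<^sub>F s in at t. norm (((\<integral>x. cis (s * y x) \<partial>M) - (\<integral>x. cis (t * y x) \<partial>M)) /\<^sub>R (s - t) - ?D)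
        = norm ((\<integral>x. cis (s * y x) \<partial>M) - (\<integral>x. cis (t * y x) \<partial>M) - (s - t) *\<^sub>R ?D) / norm (s - t)"
      unfolding eventually_at_filter using eq by (intro always_eventually) auto
    show "((\<lambda>s. norm ((\<integral>x. cis (s * y x) \<partial>M) - (\<integral>x. cis (t * y x) \<partial>M) - (s - t) *\<^sub>R ?D) / norm (s - t)) \<longlongrightarrow> 0) (at t)"
      by (rule Lim_transform_eventually[OF lim ev])
  qed
qed

text \<open>Stein's method in Fourier form: an approximate Gaussian integration by parts
  makes the characteristic function an approximate solution of \<open>\<phi>' = - v t \<phi>\<close>.\<close>

lemma stein_char_bound:
  fixes y \<Gamma> :: "'x \<Rightarrow> real"
  assumes M: "prob_space M" and y: "integrable M y" and \<Gamma>: "integrable M \<Gamma>" and v: "0 \<le> v"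
    and stein: "\<And>t. (\<integral>x. of_real (y x) * cis (t * y x) \<partial>M) = \<i> * of_real t * (\<integral>x. of_real (\<Gamma> x) * cis (t * y x) \<partial>M)"
  shows "cmod ((\<integral>x. cis (y x) \<partial>M) - of_real (exp (- v / 2))) \<le> (\<integral>x. \<bar>\<Gamma> x - v\<bar> \<partial>M)"
proof -
  interpret prob_space M by fact
  have [measurable]: "y \<in> borel_measurable M" "\<Gamma> \<in> borel_measurable M" using y \<Gamma> by auto
  let ?\<phi> = "\<lambda>t. \<integral>x. cis (t * y x) \<partial>M"
  let ?\<delta> = "\<integral>x. \<bar>\<Gamma> x - v\<bar> \<partial>M"
  \<comment> \<open>Integrating factor: the product of \<open>e\<close> with the characteristic
    function has derivative - t e(t) E ((\<open>\<Gamma>\<close> - v) cis (t y)), so it is constant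
    in the exactly Gaussian case.\<close>
  define e where "e t = exp (v * t\<^sup>2 / 2)" for t :: real
  have int: "integrable M (\<lambda>x. cis (t * y x))" for t
    by (rule integrable_const_bound[of _ 1]) auto
  have int\<Gamma>: "integrable M (\<lambda>x. of_real (\<Gamma> x) * cis (t * y x))" for t
    by (rule Bochner_Integration.integrable_bound[OF \<Gamma>]) (auto simp: norm_mult)
  have \<phi>: "(?\<phi> has_vector_derivative - of_real t * (\<integral>x. of_real (\<Gamma> x) * cis (t * y x) \<partial>M)) (at t)" for t
  proof -
    have "(\<integral>x. \<i> * of_real (y x) * cis (t * y x) \<partial>M) = \<i> * (\<integral>x. of_real (y x) * cis (t * y x) \<partial>M)"
      by (simp only: mult.assoc integral_mult_right_zero)
    also have "\<dots> = - of_real t * (\<integral>x. of_real (\<Gamma> x) * cis (t * y x) \<partial>M)"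
      unfolding stein by (simp add: mult.assoc[symmetric])
    finally show ?thesis
      using has_vector_derivative_integral_cis[OF M y, of t] by (simp only:)
  qed
  have e: "(e has_real_derivative v * t * e t) (at t)" for t
    unfolding e_def by (auto intro!: derivative_eq_intros)
  have "((\<lambda>t. of_real (e t) * ?\<phi> t) has_vector_derivative
      of_real (e t) * (- of_real t * (\<integral>x. of_real (\<Gamma> x) * cis (t * y x) \<partial>M)) + of_real (v * t * e t) * ?\<phi> t) (at t)" for t
    using e by (intro has_vector_derivative_mult \<phi> has_vector_derivative_of_real)
      (simp add: has_real_derivative_iff_has_vector_derivative)
  moreover have "of_real (e t) * (- of_real t * (\<integral>x. of_real (\<Gamma> x) * cis (t * y x) \<partial>M)) + of_real (v * t * e t) * ?\<phi> t
      = - of_real (t * e t) * (\<integral>x. of_real (\<Gamma> x - v) * cis (t * y x) \<partial>M)" for t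
  proof -
    have eq: "(\<integral>x. of_real (\<Gamma> x - v) * cis (t * y x) \<partial>M) = (\<integral>x. of_real (\<Gamma> x) * cis (t * y x) \<partial>M) - of_real v * ?\<phi> t"
      using int[of t] int\<Gamma>[of t] by (simp add: left_diff_distrib Bochner_Integration.integral_diff)
    show ?thesis unfolding eq by (simp add: algebra_simps)
  qed
  ultimately have \<psi>: "((\<lambda>t. of_real (e t) * ?\<phi> t) has_vector_derivative
      - of_real (t * e t) * (\<integral>x. of_real (\<Gamma> x - v) * cis (t * y x) \<partial>M)) (at t)" for t
    by simp
  have \<delta>: "cmod (\<integral>x. of_real (\<Gamma> x - v) * cis (t * y x) \<partial>M) \<le> ?\<delta>" for t
    by (rule order_trans[OF integral_norm_bound]) (simp add: norm_mult flip: of_real_diff)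
  have \<delta>0: "0 \<le> ?\<delta>" by simp
  \<comment> \<open>On the unit interval t e(t) is at most e(1). Dividing by e(1) at the end
    therefore leaves the bound with constant 1.\<close>
  have "norm (of_real (e 1) * ?\<phi> 1 - of_real (e 0) * ?\<phi> 0) \<le> (e 1 * ?\<delta>) * norm (1 - 0 :: real)"
  proof (rule differentiable_bound[of "{0..1}" _ "\<lambda>t h. h *\<^sub>R (- of_real (t * e t) * (\<integral>x. of_real (\<Gamma> x - v) * cis (t * y x) \<partial>M))"])
    fix t :: real assume t: "t \<in> {0..1}"
    show "((\<lambda>t. of_real (e t) * ?\<phi> t) has_derivative (\<lambda>h. h *\<^sub>R (- of_real (t * e t) * (\<integral>x. of_real (\<Gamma> x - v) * cis (t * y x) \<partial>M)))) (at t within {0..1})"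
      using \<psi>[of t] unfolding has_vector_derivative_def by (rule has_derivative_at_withinI)
    have "t\<^sup>2 \<le> 1" using t by (simp add: power_le_one_iff abs_square_le_1)
    then have "e t \<le> e 1"
      unfolding e_def using v mult_left_mono[of "t\<^sup>2" 1 v] by simp
    then have "t * e t \<le> 1 * e 1"
      using t by (intro mult_mono) (auto simp: e_def)
    then have "(t * e t) * cmod (\<integral>x. of_real (\<Gamma> x - v) * cis (t * y x) \<partial>M) \<le> e 1 * ?\<delta>"
      using t \<delta>[of t] by (intro mult_mono) (auto simp: e_def)
    moreover have "cmod (- of_real (t * e t) * (\<integral>x. of_real (\<Gamma> x - v) * cis (t * y x) \<partial>M))
       = (t * e t) * cmod (\<integral>x. of_real (\<Gamma> x - v) * cis (t * y x) \<partial>M)"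
      using t by (simp add: norm_mult e_def)
    ultimately show "onorm (\<lambda>h. h *\<^sub>R (- of_real (t * e t) * (\<integral>x. of_real (\<Gamma> x - v) * cis (t * y x) \<partial>M))) \<le> e 1 * ?\<delta>"
      by (intro onorm_le) (simp add: mult.commute mult_left_mono)
  qed auto
  then have "cmod (of_real (e 1) * ?\<phi> 1 - 1) \<le> e 1 * ?\<delta>"
    by (simp add: e_def prob_space)
  moreover have "of_real (e 1) * ?\<phi> 1 - 1 = of_real (e 1) * (?\<phi> 1 - of_real (exp (- v / 2)))"
    by (simp add: e_def algebra_simps flip: of_real_mult exp_add)
  ultimately have "e 1 * cmod (?\<phi> 1 - of_real (exp (- v / 2))) \<le> e 1 * ?\<delta>"
    by (simp add: norm_mult e_def)
  then show ?thesis
    by (simp add: e_def)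
qed

lemma fro_mmult_le_squares:
  "fro N (mmult N A B) \<le> (fro N (mmult N (madj A) A) + fro N (mmult N (madj B) B)) / 2"
proof -
  have "mmult N A (mmult N mid B) = mmult N A B"
    unfolding mmult_def[of N A] by (auto simp: mmult_mid_left fun_eq_iff)
  then show ?thesis
    using fro_sandwich_le[of N A mid B] by (simp add: fro_mmult_mid fro_madj_commute)
qed

lemma fro_square_le: "(fro N A)\<^sup>2 \<le> real N * fro N (mmult N (madj A) A)"
proof -
  have "(fro N A)\<^sup>2 = (cmod (mtrace N (mmult N A (madj A))))\<^sup>2"
    by (simp flip: fro_eq_mtrace)
  also have "\<dots> \<le> real N * fro N (mmult N A (madj A))"
    by (rule mtrace_le_fro)
  finally show ?thesis by (simp add: fro_madj_commute)
qed

subsection \<open>Concentration of traces of commutators\<close>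

definition center :: "nat \<Rightarrow> cmat \<Rightarrow> cmat" where
  "center N A = (\<lambda>i j. A i j - mtrace N A / of_nat N * mid i j)"

lemma mtrace_mid: "mtrace N mid = of_nat N"
  by (simp add: mtrace_def mid_def)

lemma mtrace_center: "mtrace N (center N A) = 0"
proof (cases "N = 0")
  case False
  have "mtrace N (center N A) = mtrace N A - mtrace N A / of_nat N * mtrace N mid"
    by (simp add: center_def mtrace_def sum_subtractf sum_distrib_left)
  then show ?thesis
    using False by (simp add: mtrace_mid)
qed (simp add: mtrace_def)

lemma mtrace_center_mmult:
  "mtrace N (mmult N (center N A) B) = mtrace N (mmult N A B) - mtrace N A / of_nat N * mtrace N B"
proof -
  define c where "c = mtrace N A / of_nat N"
  have "mtrace N (mmult N (center N A) B) = mtrace N (mmult N A B) - mtrace N A / of_nat N * mtrace N (mmult N mid B)"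
    unfolding center_def c_def[symmetric]
    by (simp add: mtrace_def mmult_def sum_subtractf sum_distrib_left left_diff_distrib mult.assoc del: sum_mid_left)
  moreover have "mtrace N (mmult N mid B) = mtrace N B"
    by (simp add: mtrace_def mmult_mid_left)
  ultimately show ?thesis by simp
qed

text \<open>Pythagoras: centering is the orthogonal projection onto the complement of the identity
  matrix.\<close>

lemma fro_center_le: "fro N (center N A) \<le> fro N A"
proof (cases "N = 0")
  case False
  define c where "c = mtrace N A / of_nat N"
  have split: "A i j = center N A i j + c * mid i j" for i j
    by (simp add: center_def c_def)
  have "fro N A = (\<Sum>i<N. \<Sum>j<N. (cmod (center N A i j))\<^sup>2 + (cmod c)\<^sup>2 * (cmod (mid i j))\<^sup>2
      + 2 * Re (center N A i j * cnj (c * mid i j)))"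
    unfolding fro_def
  proof (intro sum.cong refl)
    fix i j
    have "(cmod (a + b))\<^sup>2 = (cmod a)\<^sup>2 + (cmod b)\<^sup>2 + 2 * Re (a * cnj b)" for a b :: complex
      unfolding cmod_power2 by (simp add: power2_eq_square algebra_simps)
    from this[of "center N A i j" "c * mid i j"]
    show "(cmod (A i j))\<^sup>2 = (cmod (center N A i j))\<^sup>2 + (cmod c)\<^sup>2 * (cmod (mid i j))\<^sup>2
      + 2 * Re (center N A i j * cnj (c * mid i j))"
      unfolding split[symmetric] by (simp only: norm_mult power_mult_distrib)
  qed
  also have "\<dots> = fro N (center N A) + (cmod c)\<^sup>2 * (\<Sum>i<N. \<Sum>j<N. (cmod (mid i j))\<^sup>2)
      + 2 * Re (\<Sum>i<N. \<Sum>j<N. center N A i j * cnj (c * mid i j))"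
    by (simp only: sum.distrib fro_def Re_sum sum_distrib_left)
  also have "(\<Sum>i<N. \<Sum>j<N. center N A i j * cnj (c * mid i j)) = cnj c * mtrace N (center N A)"
    by (simp add: mid_def mtrace_def sum_distrib_left if_distrib[of "\<lambda>x. _ * x"] if_distrib[of cnj] mult_ac cong: if_cong)
  also have "\<dots> = 0"
    by (simp add: mtrace_center)
  finally show ?thesis
    by (simp add: sum_nonneg)
qed (simp add: fro_def)

text \<open>The expansion is sorted by type. In the two positive words random and deterministic
  letters alternate, and these are small by \<open>mtrace_word_bound\<close>; in the two negative
  words the random letters are adjacent, and these concentrate around a product of traces.\<close>

lemma mtrace_comm_comm:
  "mtrace N (mmult N (comm N A M) (comm N A' M'))
    = mtrace N (mmult N (mmult N A M) (mmult N A' M')) + mtrace N (mmult N (mmult N A M') (mmult N A' M))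
      - mtrace N (mmult N (mmult N A' A) (mmult N M M')) - mtrace N (mmult N (mmult N A A') (mmult N M' M))"
proof -
  have "mtrace N (mmult N (comm N A M) (comm N A' M'))
      = mtrace N (mmult N (mmult N A M) (mmult N A' M')) - mtrace N (mmult N (mmult N A M) (mmult N M' A'))
        - mtrace N (mmult N (mmult N M A) (mmult N A' M')) + mtrace N (mmult N (mmult N M A) (mmult N M' A'))"
    unfolding comm_def mtrace_def mmult_def[of N "\<lambda>i j. mmult N A M i j - mmult N M A i j"]
      mmult_def[of N "mmult N A M"] mmult_def[of N "mmult N M A"]
    by (simp add: algebra_simps sum_subtractf sum.distrib)
  also have "mtrace N (mmult N (mmult N A M) (mmult N M' A')) = mtrace N (mmult N (mmult N A' A) (mmult N M M'))"
    using mtrace_commute[of N "mmult N A (mmult N M M')" A'] by (simp add: mmult_assoc)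
  also have "mtrace N (mmult N (mmult N M A) (mmult N A' M')) = mtrace N (mmult N (mmult N A A') (mmult N M' M))"
    using mtrace_commute[of N M "mmult N A (mmult N A' M')"] by (simp add: mmult_assoc)
  also have "mtrace N (mmult N (mmult N M A) (mmult N M' A')) = mtrace N (mmult N (mmult N A M') (mmult N A' M))"
    using mtrace_commute[of N M "mmult N A (mmult N M' A')"] by (simp add: mmult_assoc)
  finally show ?thesis by simp
qed

context unitary_invariant
begin

lemma square_root_moment:
  assumes N: "0 < N" and F: "good F" and b: "(\<integral>x. (cmod (F x))\<^sup>2 \<partial>\<mu>) \<le> b"
  shows "(\<integral>x. cmod (F x) \<partial>\<mu>) \<le> sqrt b"
proof -
  have i1: "integrable \<mu> (\<lambda>x. cmod (F x))"
    using good_integrable[OF F N] by simp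
  have i2: "integrable \<mu> (\<lambda>x. (cmod (F x))\<^sup>2)"
    by (rule rgood_integrable[OF rgood_norm[OF F] N])
  have "(\<integral>x. cmod (F x) \<partial>\<mu>)\<^sup>2 \<le> (\<integral>x. (cmod (F x))\<^sup>2 \<partial>\<mu>)"
  proof -
    let ?m = "\<integral>x. cmod (F x) \<partial>\<mu>"
    have "0 \<le> (\<integral>x. (cmod (F x) - ?m)\<^sup>2 \<partial>\<mu>)"
      by simp
    also have "(\<integral>x. (cmod (F x) - ?m)\<^sup>2 \<partial>\<mu>) = (\<integral>x. (cmod (F x))\<^sup>2 - 2 * ?m * cmod (F x) + ?m\<^sup>2 \<partial>\<mu>)"
      by (simp add: power2_diff algebra_simps)
    also have "\<dots> = (\<integral>x. (cmod (F x))\<^sup>2 \<partial>\<mu>) - ?m\<^sup>2"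
      using i1 i2 by (simp add: prob_space power2_eq_square)
    finally show ?thesis by simp
  qed
  with b have "(\<integral>x. cmod (F x) \<partial>\<mu>)\<^sup>2 \<le> b" by linarith
  then show ?thesis
    by (rule real_le_rsqrt)
qed

lemma fro_mmult_mean_le:
  assumes N: "0 < N" and A: "mgood A" and A': "mgood A'"
    and a: "(\<integral>x. fro N (mmult N (madj (A x)) (A x)) \<partial>\<mu>) \<le> a"
           "(\<integral>x. fro N (mmult N (madj (A' x)) (A' x)) \<partial>\<mu>) \<le> a"
  shows "(\<integral>x. fro N (mmult N (A x) (A' x)) \<partial>\<mu>) \<le> a"
proof -
  have int: "integrable \<mu> (\<lambda>x. fro N (mmult N (A x) (A' x)))"
     "integrable \<mu> (\<lambda>x. fro N (mmult N (madj (A x)) (A x)))"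
     "integrable \<mu> (\<lambda>x. fro N (mmult N (madj (A' x)) (A' x)))"
    by (intro rgood_integrable[OF _ N] rgood_fro mgood_mmult mgood_madj A A')+
  have "(\<integral>x. fro N (mmult N (A x) (A' x)) \<partial>\<mu>)
      \<le> (\<integral>x. (fro N (mmult N (madj (A x)) (A x)) + fro N (mmult N (madj (A' x)) (A' x))) / 2 \<partial>\<mu>)"
    by (intro integral_mono fro_mmult_le_squares) (use int in auto)
  also have "\<dots> \<le> a"
    using int a by simp
  finally show ?thesis .
qed

lemma covariant_center:
  assumes "covariant C" shows "covariant (\<lambda>x. center N (C x))"
proof -
  have "invariant (\<lambda>x. (1 / of_nat N) * mtrace N (C x))"
    by (intro invariant_mult invariant_const invariant_mtrace assms)
  then show ?thesis
    unfolding center_def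
    using covariant_diff[OF assms covariant_scale[OF _ covariant_mid], of "\<lambda>x. (1 / of_nat N) * mtrace N (C x)"]
    by simp
qed

text \<open>The alternating words have second moment of order N and vanish after division by N. In
  the other two the random products are centered: the centered parts are again of order N in second
  moment, while each scalar part contributes - Tr (A A') Tr (M M') / N, which accounts for the
  compensating factor 2.\<close>

lemma comm_trace_L1:
  fixes M M' :: cmat
  assumes N: "0 < N" and A: "covariant A" and A': "covariant A'"
    and trA: "\<And>x. mtrace N (A x) = 0" and trA': "\<And>x. mtrace N (A' x) = 0"
    and trM: "mtrace N M = 0" and trM': "mtrace N M' = 0"
    and g: "fro N M \<le> g * real N" "fro N M' \<le> g * real N"
    and a: "(\<integral>x. fro N (mmult N (madj (A x)) (A x)) \<partial>\<mu>) \<le> a * real N"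
           "(\<integral>x. fro N (mmult N (madj (A' x)) (A' x)) \<partial>\<mu>) \<le> a * real N"
  shows "(\<integral>x. cmod (mtrace N (mmult N (comm N (A x) M) (comm N (A' x) M')) / of_nat N
      + 2 * (mtrace N (mmult N (A x) (A' x)) / of_nat N) * (mtrace N (mmult N M M') / of_nat N)) \<partial>\<mu>)
    \<le> 4 * sqrt (10 * a * g\<^sup>2 * real N) / real N"
proof -
  \<comment> \<open>10 = 8 + 2, the constants of \<open>mtrace_word_bound\<close> after inserting
    \<open>a * real N\<close>, \<open>a * (real N)\<^sup>2\<close> and \<open>g * real N\<close> and
    using 1 <= N; it also covers the constant 2 of the centered parts.\<close>
  let ?b = "10 * a * g\<^sup>2 * real N"
  note mg = covariant_mgood[OF A] covariant_mgood[OF A']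
  have N1: "1 \<le> real N" using N by simp
  have a0: "0 \<le> a"
  proof -
    have "0 \<le> a * real N"
      by (rule order_trans[OF _ a(1)]) (simp add: integral_nonneg)
    then show ?thesis using N by (simp add: zero_le_mult_iff)
  qed
  have g0: "0 \<le> g"
  proof -
    have "0 \<le> g * real N"
      by (rule order_trans[OF _ g(1)]) simp
    then show ?thesis using N by (simp add: zero_le_mult_iff)
  qed
  have bb: "(\<integral>x. fro N (A' x) * fro N (A x) \<partial>\<mu>) \<le> a * (real N)\<^sup>2"
  proof -
    have int: "integrable \<mu> (\<lambda>x. fro N (A' x) * fro N (A x))"
      "integrable \<mu> (\<lambda>x. fro N (mmult N (madj (A x)) (A x)))"
      "integrable \<mu> (\<lambda>x. fro N (mmult N (madj (A' x)) (A' x)))"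
      by (intro rgood_integrable[OF _ N] rgood_mult rgood_fro mgood_mmult mgood_madj mg)+
    have "(\<integral>x. fro N (A' x) * fro N (A x) \<partial>\<mu>) \<le> (\<integral>x. real N *
        (fro N (mmult N (madj (A x)) (A x)) + fro N (mmult N (madj (A' x)) (A' x))) / 2 \<partial>\<mu>)"
    proof (rule integral_mono)
      fix x
      have "fro N (A' x) * fro N (A x) \<le> ((fro N (A' x))\<^sup>2 + (fro N (A x))\<^sup>2) / 2"
        using sum_squares_bound[of "fro N (A' x)" "fro N (A x)"] by simp
      also have "\<dots> \<le> real N * (fro N (mmult N (madj (A x)) (A x)) + fro N (mmult N (madj (A' x)) (A' x))) / 2"
        using fro_square_le[of N "A x"] fro_square_le[of N "A' x"] by (simp add: distrib_left)
      finally show "fro N (A' x) * fro N (A x)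
        \<le> real N * (fro N (mmult N (madj (A x)) (A x)) + fro N (mmult N (madj (A' x)) (A' x))) / 2" .
    qed (use int in auto)
    also have "\<dots> = real N * ((\<integral>x. fro N (mmult N (madj (A x)) (A x)) \<partial>\<mu>)
        + (\<integral>x. fro N (mmult N (madj (A' x)) (A' x)) \<partial>\<mu>)) / 2"
      using int by simp
    also have "\<dots> \<le> real N * (a * real N + a * real N) / 2"
      using a by (intro divide_right_mono mult_left_mono add_mono) auto
    finally show ?thesis by (simp add: power2_eq_square mult_ac)
  qed
  define T where "T M M' x = mtrace N (mmult N (mmult N (A x) M) (mmult N (A' x) M'))" for M M' x
  have Tb: "(\<integral>x. cmod (T M M' x) \<partial>\<mu>) \<le> sqrt ?b"
    if M: "fro N M \<le> g * real N" "mtrace N M = 0" and M': "fro N M' \<le> g * real N" "mtrace N M' = 0" for M M'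
  proof (rule square_root_moment[OF N])
    show "good (T M M')"
      unfolding T_def by (intro good_mtrace mgood_mmult mg mgood_const)
    have "(\<integral>x. (cmod (T M M' x))\<^sup>2 \<partial>\<mu>) \<le> 8 * (a * real N) * (g * real N)\<^sup>2 / (real N)\<^sup>2
        + 2 * (a * (real N)\<^sup>2) * (g * real N)\<^sup>2 / (real N) ^ 4"
      unfolding T_def by (rule mtrace_word_bound[OF N A A' trA trA' M(2) M'(2) M(1) M'(1) a bb])
    also have "\<dots> = 8 * a * g\<^sup>2 * real N + 2 * a * g\<^sup>2"
      using N by (simp add: power2_eq_square power4_eq_xxxx field_simps)
    also have "\<dots> \<le> 8 * a * g\<^sup>2 * real N + 2 * a * g\<^sup>2 * real N"
    proof -
      have "(2 * a * g\<^sup>2) * 1 \<le> (2 * a * g\<^sup>2) * real N"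
        by (rule mult_left_mono[OF N1]) (use a0 in simp)
      then show ?thesis by linarith
    qed
    finally show "(\<integral>x. (cmod (T M M' x))\<^sup>2 \<partial>\<mu>) \<le> ?b" by (simp add: algebra_simps)
  qed
  define X where "X A A' M M' x = mtrace N (mmult N (center N (mmult N (A x) (A' x))) (mmult N M M'))"
    for A A' :: "'k entries \<Rightarrow> cmat" and M M' x
  have Xg: "good (X A A' M M')" if A: "covariant A" and A': "covariant A'" for A A' M M'
    unfolding X_def
    by (intro good_mtrace mgood_mmult mgood_const covariant_mgood covariant_center covariant_mmult A A')
  have Xb: "(\<integral>x. cmod (X A A' M M' x) \<partial>\<mu>) \<le> sqrt ?b"
    if A: "covariant A" and A': "covariant A'" and M: "fro N M \<le> g * real N" and M': "fro N M' \<le> g * real N"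
      and a: "(\<integral>x. fro N (mmult N (madj (A x)) (A x)) \<partial>\<mu>) \<le> a * real N"
             "(\<integral>x. fro N (mmult N (madj (A' x)) (A' x)) \<partial>\<mu>) \<le> a * real N" for A A' M M'
  proof (rule square_root_moment[OF N Xg[OF A A']])
    have cov: "covariant (\<lambda>x. center N (mmult N (A x) (A' x)))"
      by (intro covariant_center covariant_mmult A A')
    have one: "invariant (\<lambda>x. complex_of_real 1)" by (rule invariant_const)
    have "(\<integral>x. 1 * (cmod (X A A' M M' x))\<^sup>2 \<partial>\<mu>)
      \<le> 2 / (real N)\<^sup>2 * (\<integral>x. 1 * fro N (center N (mmult N (A x) (A' x))) \<partial>\<mu>) * fro N (mmult N M M')"
      unfolding X_def by (rule second_moment_mtrace_le[OF N cov mtrace_center one]) simp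
    also have "\<dots> \<le> 2 / (real N)\<^sup>2 * (a * real N) * ((g * real N) * (g * real N))"
    proof (intro mult_mono)
      have "(\<integral>x. 1 * fro N (center N (mmult N (A x) (A' x))) \<partial>\<mu>) \<le> (\<integral>x. fro N (mmult N (A x) (A' x)) \<partial>\<mu>)"
        unfolding mult_1
        by (intro integral_mono fro_center_le rgood_integrable[OF _ N] rgood_fro covariant_mgood[OF cov]
            mgood_mmult covariant_mgood[OF A] covariant_mgood[OF A'])
      also have "\<dots> \<le> a * real N"
        by (rule fro_mmult_mean_le[OF N covariant_mgood[OF A] covariant_mgood[OF A'] a])
      finally show "(\<integral>x. 1 * fro N (center N (mmult N (A x) (A' x))) \<partial>\<mu>) \<le> a * real N" .
      show "fro N (mmult N M M') \<le> (g * real N) * (g * real N)"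
        by (rule order_trans[OF fro_mmult_le]) (use M M' g0 in \<open>auto intro!: mult_mono\<close>)
    qed (use a0 g0 in auto)
    also have "\<dots> = 2 * a * g\<^sup>2 * real N"
      using N by (simp add: power2_eq_square field_simps)
    also have "\<dots> \<le> ?b"
      using a0 by (intro mult_right_mono) auto
    finally show "(\<integral>x. (cmod (X A A' M M' x))\<^sup>2 \<partial>\<mu>) \<le> ?b" by simp
  qed
  have eq: "mtrace N (mmult N (comm N (A x) M) (comm N (A' x) M')) / of_nat N
      + 2 * (mtrace N (mmult N (A x) (A' x)) / of_nat N) * (mtrace N (mmult N M M') / of_nat N)
    = (T M M' x + T M' M x - X A' A M M' x - X A A' M' M x) / of_nat N" for x
    unfolding mtrace_comm_comm T_def X_def mtrace_center_mmult mtrace_commute[of N "A' x" "A x"]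
      mtrace_commute[of N M' M] by (simp add: add_divide_distrib diff_divide_distrib)
  have gT: "good (T M M')" for M M'
    unfolding T_def by (intro good_mtrace mgood_mmult mg mgood_const)
  have int: "integrable \<mu> (\<lambda>x. cmod (T M M' x))" "integrable \<mu> (\<lambda>x. cmod (T M' M x))"
    "integrable \<mu> (\<lambda>x. cmod (X A' A M M' x))" "integrable \<mu> (\<lambda>x. cmod (X A A' M' M x))"
    by (intro integrable_norm good_integrable[OF _ N] gT Xg A A')+
  have "(\<integral>x. cmod ((T M M' x + T M' M x - X A' A M M' x - X A A' M' M x) / of_nat N) \<partial>\<mu>)
     \<le> (\<integral>x. (cmod (T M M' x) + cmod (T M' M x) + cmod (X A' A M M' x) + cmod (X A A' M' M x)) / real N \<partial>\<mu>)"
  proof (rule integral_mono)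
    show "integrable \<mu> (\<lambda>x. cmod ((T M M' x + T M' M x - X A' A M M' x - X A A' M' M x) / of_nat N))"
      unfolding divide_inverse mult.commute[of _ "inverse _"]
      by (intro integrable_norm good_integrable[OF _ N] good_cmult good_diff good_add gT Xg A A')
    fix x
    have "cmod (T M M' x + T M' M x - X A' A M M' x - X A A' M' M x)
      \<le> cmod (T M M' x) + cmod (T M' M x) + cmod (X A' A M M' x) + cmod (X A A' M' M x)"
      by (intro order_trans[OF norm_triangle_ineq4] add_mono order_trans[OF norm_triangle_ineq] order_refl)
    then show "cmod ((T M M' x + T M' M x - X A' A M M' x - X A A' M' M x) / of_nat N)
      \<le> (cmod (T M M' x) + cmod (T M' M x) + cmod (X A' A M M' x) + cmod (X A A' M' M x)) / real N"
      by (simp add: norm_divide divide_right_mono)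
  qed (use int in auto)
  also have "\<dots> = ((\<integral>x. cmod (T M M' x) \<partial>\<mu>) + (\<integral>x. cmod (T M' M x) \<partial>\<mu>)
      + (\<integral>x. cmod (X A' A M M' x) \<partial>\<mu>) + (\<integral>x. cmod (X A A' M' M x) \<partial>\<mu>)) / real N"
    using int by simp
  also have "\<dots> \<le> (sqrt ?b + sqrt ?b + sqrt ?b + sqrt ?b) / real N"
    by (intro divide_right_mono add_mono Tb Xb trM trM' g A A' a) simp
  finally show ?thesis
    unfolding eq by simp
qed

end

section \<open>Carre du champ and Stein identity for real linear statistics\<close>

lemma madj_comm: "madj (comm N A B) = (\<lambda>i j. - comm N (madj A) (madj B) i j)"
  by (auto simp: comm_def madj_def mmult_def fun_eq_iff mult.commute)

text \<open>The left side is the squared norm of the anti-Hermitian part of \<open>W\<close>. Read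
  backwards, the identity shows that this combination of traces, whose limits are computable, is
  nonnegative.\<close>

lemma fro_skew_part:
  "fro N (\<lambda>i j. (W i j - cnj (W j i)) / 2) = Re (mtrace N (mmult N W (madj W)) - mtrace N (mmult N W W)) / 2"
proof -
  have "(cmod ((a - cnj b) / 2))\<^sup>2 = ((cmod a)\<^sup>2 + (cmod b)\<^sup>2 - 2 * Re (a * b)) / 4" for a b :: complex
  proof -
    have "(cmod ((a - cnj b) / 2))\<^sup>2 = (cmod (a - cnj b))\<^sup>2 / 4"
      by (simp add: norm_divide power_divide)
    also have "(cmod (a - cnj b))\<^sup>2 = (cmod a)\<^sup>2 + (cmod b)\<^sup>2 - 2 * Re (a * b)"
      unfolding cmod_power2 by (simp add: power2_eq_square algebra_simps)
    finally show ?thesis .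
  qed
  then have "fro N (\<lambda>i j. (W i j - cnj (W j i)) / 2)
     = (\<Sum>i<N. \<Sum>j<N. ((cmod (W i j))\<^sup>2 + (cmod (W j i))\<^sup>2 - 2 * Re (W i j * W j i)) / 4)"
    by (simp only: fro_def)
  also have "\<dots> = ((\<Sum>i<N. \<Sum>j<N. (cmod (W i j))\<^sup>2) + (\<Sum>i<N. \<Sum>j<N. (cmod (W j i))\<^sup>2)
      - 2 * (\<Sum>i<N. \<Sum>j<N. Re (W i j * W j i))) / 4"
    by (simp only: sum.distrib sum_subtractf sum_divide_distrib[symmetric] sum_distrib_left[symmetric])
  also have "(\<Sum>i<N. \<Sum>j<N. (cmod (W j i))\<^sup>2) = (\<Sum>i<N. \<Sum>j<N. (cmod (W i j))\<^sup>2)"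
    by (rule sum.swap)
  also have "(\<Sum>i<N. \<Sum>j<N. (cmod (W i j))\<^sup>2) = Re (mtrace N (mmult N W (madj W)))"
    unfolding fro_eq_mtrace[symmetric] by (simp add: fro_def)
  also have "(\<Sum>i<N. \<Sum>j<N. Re (W i j * W j i)) = Re (mtrace N (mmult N W W))"
    by (simp add: mtrace_def mmult_def)
  finally show ?thesis by simp
qed

lemma mtrace_mmult_sum:
  "mtrace N (mmult N (\<lambda>i j. \<Sum>s\<in>S. c s * C s i j) (\<lambda>i j. \<Sum>s\<in>S'. d s * D s i j))
     = (\<Sum>s\<in>S. \<Sum>s'\<in>S'. c s * d s' * mtrace N (mmult N (C s) (D s')))"
proof -
  have "mtrace N (mmult N (\<lambda>i j. \<Sum>s\<in>S. c s * C s i j) (\<lambda>i j. \<Sum>s\<in>S'. d s * D s i j))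
     = (\<Sum>i<N. \<Sum>r<N. \<Sum>s\<in>S. \<Sum>s'\<in>S'. c s * d s' * (C s i r * D s' r i))"
    by (simp add: mtrace_def mmult_def sum_product mult_ac)
  also have "\<dots> = (\<Sum>i<N. \<Sum>s\<in>S. \<Sum>r<N. \<Sum>s'\<in>S'. c s * d s' * (C s i r * D s' r i))"
    by (intro sum.cong refl sum.swap)
  also have "\<dots> = (\<Sum>s\<in>S. \<Sum>i<N. \<Sum>r<N. \<Sum>s'\<in>S'. c s * d s' * (C s i r * D s' r i))"
    by (rule sum.swap)
  also have "\<dots> = (\<Sum>s\<in>S. \<Sum>i<N. \<Sum>s'\<in>S'. \<Sum>r<N. c s * d s' * (C s i r * D s' r i))"
    by (intro sum.cong refl sum.swap)
  also have "\<dots> = (\<Sum>s\<in>S. \<Sum>s'\<in>S'. \<Sum>i<N. \<Sum>r<N. c s * d s' * (C s i r * D s' r i))"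
    by (intro sum.cong refl sum.swap)
  finally show ?thesis
    by (simp add: mtrace_def mmult_def sum_distrib_left)
qed

context unitary_invariant
begin

text \<open>Carre du champ of the linear statistic \<open>Re (\<Sum>\<^sub>s c\<^sub>s Tr (A\<^sub>s M\<^sub>s))\<close> for the Laplacian of the unitary group,
  normalised by the eigenvalue \<open>2N\<close>.\<close>

definition carre :: "'s set \<Rightarrow> ('s \<Rightarrow> complex) \<Rightarrow> ('s \<Rightarrow> cmat) \<Rightarrow> ('s \<Rightarrow> cmat) \<Rightarrow> real" where
  "carre S c A M = - Re (\<Sum>s\<in>S. \<Sum>s'\<in>S.
      c s * c s' * (mtrace N (mmult N (comm N (A s) (M s)) (comm N (A s') (M s'))) / of_nat N)
      + c s * cnj (c s') * (mtrace N (mmult N (comm N (A s) (M s)) (comm N (madj (A s')) (madj (M s')))) / of_nat N)) / 4"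

text \<open>By \<open>obs_cnj\<close> the gradient of a real part is the anti-Hermitian part of the
  complex gradient. Beyond the Stein identity this makes \<open>carre\<close> nonnegative, and
  positive semidefiniteness of the limiting covariance is drawn from there.\<close>

lemma carre_eq_fro:
  "carre S c A M = fro N (\<lambda>i j. ((\<Sum>s\<in>S. c s * comm N (A s) (M s) i j)
      - cnj (\<Sum>s\<in>S. c s * comm N (A s) (M s) j i)) / 2) / (2 * real N)"
proof -
  let ?C = "\<lambda>s. comm N (A s) (M s)" and ?D = "\<lambda>s. comm N (madj (A s)) (madj (M s))"
  let ?W = "\<lambda>i j. \<Sum>s\<in>S. c s * ?C s i j"
  have adj: "madj ?W = (\<lambda>i j. \<Sum>s\<in>S. - cnj (c s) * ?D s i j)"
  proof (intro ext)
    fix i j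
    have "cnj (?C s j i) = - ?D s i j" for s
      using fun_cong[OF fun_cong[OF madj_comm[of N "A s" "M s"], of i], of j] by (simp add: madj_def)
    then show "madj ?W i j = (\<Sum>s\<in>S. - cnj (c s) * ?D s i j)"
      by (simp add: madj_def)
  qed
  have "fro N (\<lambda>i j. (?W i j - cnj (?W j i)) / 2) = Re (mtrace N (mmult N ?W (madj ?W)) - mtrace N (mmult N ?W ?W)) / 2"
    by (rule fro_skew_part)
  also have "mtrace N (mmult N ?W (madj ?W)) - mtrace N (mmult N ?W ?W)
     = - (\<Sum>s\<in>S. \<Sum>s'\<in>S. c s * c s' * mtrace N (mmult N (?C s) (?C s')) + c s * cnj (c s') * mtrace N (mmult N (?C s) (?D s')))"
    unfolding adj mtrace_mmult_sum by (simp add: sum.distrib sum_negf)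
  finally have "fro N (\<lambda>i j. (?W i j - cnj (?W j i)) / 2) / (2 * real N)
     = - Re ((\<Sum>s\<in>S. \<Sum>s'\<in>S. c s * c s' * mtrace N (mmult N (?C s) (?C s')) + c s * cnj (c s') * mtrace N (mmult N (?C s) (?D s'))) / of_nat N) / 4"
    by (simp only: Re_divide_of_nat) simp
  also have "(\<Sum>s\<in>S. \<Sum>s'\<in>S. c s * c s' * mtrace N (mmult N (?C s) (?C s')) + c s * cnj (c s') * mtrace N (mmult N (?C s) (?D s'))) / of_nat N
     = (\<Sum>s\<in>S. \<Sum>s'\<in>S. c s * c s' * (mtrace N (mmult N (?C s) (?C s')) / of_nat N) + c s * cnj (c s') * (mtrace N (mmult N (?C s) (?D s')) / of_nat N))"
    by (simp add: sum_divide_distrib add_divide_distrib)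
  finally show ?thesis
    by (simp only: carre_def)
qed

text \<open>Integration by parts for K_pq e^(itY), where K is the gradient of Y = Re Z. The
  Laplacian of Y is 2N Y because the deterministic matrices are traceless, and the exponential
  contributes it K_pq K_qp = - it |K_pq|^2 since K is anti-Hermitian.\<close>

lemma stein_linear_statistic:
  fixes A :: "'s \<Rightarrow> 'k entries \<Rightarrow> cmat" and M :: "'s \<Rightarrow> cmat"
    and c :: "'s \<Rightarrow> complex"
  assumes N: "0 < N" and A: "\<And>s. s \<in> S \<Longrightarrow> covariant (A s)" and trM: "\<And>s. s \<in> S \<Longrightarrow> mtrace N (M s) = 0"
  defines "Z \<equiv> \<lambda>x. \<Sum>s\<in>S. c s * mtrace N (mmult N (A s x) (M s))"
  shows "(\<integral>x. of_real (Re (Z x)) * cis (t * Re (Z x)) \<partial>\<mu>)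
     = \<i> * of_real t * (\<integral>x. of_real (carre S c (\<lambda>s. A s x) M) * cis (t * Re (Z x)) \<partial>\<mu>)"
    and "rgood (\<lambda>x. carre S c (\<lambda>s. A s x) M)"
    and "rgood (\<lambda>x. Re (Z x))"
proof -
  define W where "W x = (\<lambda>i j. \<Sum>s\<in>S. c s * comm N (A s x) (M s) i j)" for x
  define K where "K x = (\<lambda>i j. (W x i j - cnj (W x j i)) / 2)" for x
  define Y where "Y x = (Z x + cnj (Z x)) / 2" for x
  have YRe: "Y x = of_real (Re (Z x))" for x
    by (simp add: Y_def complex_add_cnj)
  define DW where "DW i j p q x = (\<Sum>s\<in>S. c s * (((if i = p then mmult N (A s x) (M s) q j else 0) - A s x i p * M s q j)
       - (M s i p * A s x q j - (if q = j then mmult N (M s) (A s x) i p else 0))))" for i j p q x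
  have obsW: "obs (\<lambda>x. W x i j) (DW i j)" if "i < N" "j < N" for i j
    unfolding W_def DW_def by (intro obs_sum obs_cmult obs_comm A that)
  have obsZ: "obs Z (\<lambda>p q x. W x q p)"
    unfolding Z_def W_def by (intro obs_sum obs_cmult obs_mtrace_mmult A)
  have obsY: "obs Y (\<lambda>p q x. K x q p)"
  proof -
    have "obs (\<lambda>x. (1/2) * (Z x + cnj (Z x))) (\<lambda>p q x. (1/2) * (W x q p + - cnj (W x p q)))"
      by (intro obs_cmult obs_add obs_cnj obsZ)
    then show ?thesis
      unfolding Y_def K_def by simp
  qed
  have obsK: "obs (\<lambda>x. K x i j) (\<lambda>p q x. (DW i j p q x + cnj (DW j i q p x)) / 2)" if "i < N" "j < N" for i j
  proof -
    have "obs (\<lambda>x. (1/2) * (W x i j - cnj (W x j i))) (\<lambda>p q x. (1/2) * (DW i j p q x - - cnj (DW j i q p x)))"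
      using that by (intro obs_cmult obs_diff obs_cnj obsW) auto
    then show ?thesis
      unfolding K_def by simp
  qed
  have sumDW: "(\<Sum>p<N. \<Sum>q<N. DW p q p q x) = 2 * of_nat N * Z x" for x
  proof -
    have "(\<Sum>p<N. \<Sum>q<N. DW p q p q x) = (\<Sum>p<N. \<Sum>s\<in>S. \<Sum>q<N. c s * (((if p = p then mmult N (A s x) (M s) q q else 0) - A s x p p * M s q q)
       - (M s p p * A s x q q - (if q = q then mmult N (M s) (A s x) p p else 0))))"
      unfolding DW_def by (intro sum.cong refl sum.swap)
    also have "\<dots> = (\<Sum>s\<in>S. \<Sum>p<N. \<Sum>q<N. c s * (((if p = p then mmult N (A s x) (M s) q q else 0) - A s x p p * M s q q)
       - (M s p p * A s x q q - (if q = q then mmult N (M s) (A s x) p p else 0))))"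
      by (rule sum.swap)
    also have "\<dots> = (\<Sum>s\<in>S. c s * (2 * of_nat N * mtrace N (mmult N (A s x) (M s)) - 2 * mtrace N (A s x) * mtrace N (M s)))"
      unfolding sum_distrib_left[symmetric] laplacian_mtrace_mmult ..
    also have "\<dots> = (\<Sum>s\<in>S. 2 * of_nat N * (c s * mtrace N (mmult N (A s x) (M s))))"
      by (intro sum.cong refl) (simp add: trM)
    finally show ?thesis
      by (simp add: Z_def sum_distrib_left)
  qed
  have sumDK: "(\<Sum>p<N. \<Sum>q<N. (DW p q p q x + cnj (DW q p q p x)) / 2) = 2 * of_nat N * Y x" for x
  proof -
    have "(\<Sum>p<N. \<Sum>q<N. DW q p q p x) = (\<Sum>p<N. \<Sum>q<N. DW p q p q x)"
      by (rule sum.swap)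
    then have "(\<Sum>p<N. \<Sum>q<N. cnj (DW q p q p x)) = cnj (2 * of_nat N * Z x)"
      using sumDW[of x] by (simp flip: cnj_sum)
    then show ?thesis
      using sumDW[of x] by (simp add: sum.distrib Y_def algebra_simps flip: sum_divide_distrib)
  qed
  let ?E = "\<lambda>x. exp (\<i> * of_real t * Y x)"
  have ImY: "Im (Y x) = 0" for x
    by (simp add: YRe)
  have Ecis: "?E x = cis (t * Re (Z x))" for x
    by (simp add: YRe cis_conv_exp mult.assoc)
  have skew: "K x q p = - cnj (K x p q)" for x p q
    by (simp add: K_def diff_divide_distrib)
  have "obs (\<lambda>x. K x i j * ?E x) (\<lambda>p q x. (DW i j p q x + cnj (DW j i q p x)) / 2 * ?E x + K x i j * (\<i> * of_real t * K x q p * ?E x))"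
    if "i < N" "j < N" for i j
    by (intro obs_mult obs_exp obsK obsY that ImY)
  from integral_sum_derivation_zero[of "\<lambda>i j x. K x i j * ?E x"
    "\<lambda>i j p q x. (DW i j p q x + cnj (DW j i q p x)) / 2 * ?E x + K x i j * (\<i> * of_real t * K x q p * ?E x)", OF this]
  have "(\<integral>x. (\<Sum>p<N. \<Sum>q<N. (DW p q p q x + cnj (DW q p q p x)) / 2 * ?E x + K x p q * (\<i> * of_real t * K x q p * ?E x)) \<partial>\<mu>) = 0"
    by simp
  also have "(\<lambda>x. \<Sum>p<N. \<Sum>q<N. (DW p q p q x + cnj (DW q p q p x)) / 2 * ?E x + K x p q * (\<i> * of_real t * K x q p * ?E x))
     = (\<lambda>x. 2 * of_nat N * (of_real (Re (Z x)) * cis (t * Re (Z x)) - \<i> * of_real t * (of_real (carre S c (\<lambda>s. A s x) M) * cis (t * Re (Z x)))))"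
  proof
    fix x
    have "(\<Sum>p<N. \<Sum>q<N. K x p q * (\<i> * of_real t * K x q p * ?E x)) = - (\<i> * of_real t * ?E x) * (\<Sum>p<N. \<Sum>q<N. K x p q * cnj (K x p q))"
      unfolding sum_distrib_left
    proof (intro sum.cong refl)
      fix p q
      show "K x p q * (\<i> * of_real t * K x q p * ?E x) = - (\<i> * of_real t * ?E x) * (K x p q * cnj (K x p q))"
        unfolding skew[of x q p] by (simp only: mult_minus_left mult_minus_right mult_ac)
    qed
    also have "(\<Sum>p<N. \<Sum>q<N. K x p q * cnj (K x p q)) = of_real (fro N (K x))"
      by (simp add: fro_def complex_norm_square del: of_real_power)
    also have "fro N (K x) = 2 * real N * carre S c (\<lambda>s. A s x) M"
      using N unfolding carre_eq_fro K_def W_def by simp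
    finally have 1: "(\<Sum>p<N. \<Sum>q<N. K x p q * (\<i> * of_real t * K x q p * ?E x))
       = - (\<i> * of_real t * ?E x) * of_real (2 * real N * carre S c (\<lambda>s. A s x) M)" .
    have "(\<Sum>p<N. \<Sum>q<N. (DW p q p q x + cnj (DW q p q p x)) / 2 * ?E x) = 2 * of_nat N * Y x * ?E x"
      unfolding sum_distrib_right[symmetric] sumDK ..
    with 1 show "(\<Sum>p<N. \<Sum>q<N. (DW p q p q x + cnj (DW q p q p x)) / 2 * ?E x + K x p q * (\<i> * of_real t * K x q p * ?E x))
       = 2 * of_nat N * (of_real (Re (Z x)) * cis (t * Re (Z x)) - \<i> * of_real t * (of_real (carre S c (\<lambda>s. A s x) M) * cis (t * Re (Z x))))"
      unfolding sum.distrib Ecis[symmetric] YRe[symmetric] by (simp add: algebra_simps)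
  qed
  finally have zero: "(\<integral>x. 2 * of_nat N * (of_real (Re (Z x)) * cis (t * Re (Z x)) - \<i> * of_real t * (of_real (carre S c (\<lambda>s. A s x) M) * cis (t * Re (Z x)))) \<partial>\<mu>) = 0" .
  have gK: "mgood K"
    unfolding mgood_def by (auto intro: obs_good obsK)
  show gc: "rgood (\<lambda>x. carre S c (\<lambda>s. A s x) M)"
    using rgood_mult[OF rgood_const[of "1 / (2 * real N)"] rgood_fro[OF gK]]
    unfolding carre_eq_fro K_def W_def by simp
  show gY: "rgood (\<lambda>x. Re (Z x))"
    using obs_good[OF obsY] unfolding YRe rgood_def by simp
  have gE: "good (\<lambda>x. cis (t * Re (Z x)))"
    using obs_good[OF obs_exp[OF obsY ImY, of t]] unfolding Ecis .
  have int: "integrable \<mu> (\<lambda>x. of_real (Re (Z x)) * cis (t * Re (Z x)))"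
    "integrable \<mu> (\<lambda>x. of_real (carre S c (\<lambda>s. A s x) M) * cis (t * Re (Z x)))"
    using gc gY gE unfolding rgood_def by (auto intro!: good_integrable[OF _ N] good_mult)
  have "2 * of_nat N * ((\<integral>x. of_real (Re (Z x)) * cis (t * Re (Z x)) \<partial>\<mu>)
     - \<i> * of_real t * (\<integral>x. of_real (carre S c (\<lambda>s. A s x) M) * cis (t * Re (Z x)) \<partial>\<mu>)) = 0"
    using zero int by simp
  then show "(\<integral>x. of_real (Re (Z x)) * cis (t * Re (Z x)) \<partial>\<mu>)
     = \<i> * of_real t * (\<integral>x. of_real (carre S c (\<lambda>s. A s x) M) * cis (t * Re (Z x)) \<partial>\<mu>)"
    using N by simp
qed

text \<open>\<open>v\<close> is what \<open>carre\<close> becomes when the normalised traces of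
  commutators are replaced by their limits -2 \<open>\<kappa>\<close> and -2
  \<open>\<kappa>'\<close>, and \<open>\<epsilon>\<close> bounds the mean error of this replacement.
  Since \<open>carre\<close> is nonnegative, \<open>v\<close> cannot lie below
  \<open>- \<epsilon>\<close>; this prepares the sign condition under which
  \<open>stein_char_bound\<close> applies.\<close>

lemma char_linear_statistic:
  fixes A :: "'s \<Rightarrow> 'k entries \<Rightarrow> cmat" and M :: "'s \<Rightarrow> cmat"
    and c :: "'s \<Rightarrow> complex" and \<kappa> \<kappa>' :: "'s \<Rightarrow> 's \<Rightarrow> complex"
  assumes N: "0 < N" and A: "\<And>s. s \<in> S \<Longrightarrow> covariant (A s)" and trM: "\<And>s. s \<in> S \<Longrightarrow> mtrace N (M s) = 0"
  defines "v \<equiv> Re (\<Sum>s\<in>S. \<Sum>s'\<in>S. c s * c s' * \<kappa> s s' + c s * cnj (c s') * \<kappa>' s s') / 2"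
  defines "\<epsilon> \<equiv> (\<Sum>s\<in>S. \<Sum>s'\<in>S. cmod (c s * c s') *
        ((\<integral>x. cmod (mtrace N (mmult N (comm N (A s x) (M s)) (comm N (A s' x) (M s'))) / of_nat N + 2 * \<kappa> s s') \<partial>\<mu>)
        + (\<integral>x. cmod (mtrace N (mmult N (comm N (A s x) (M s)) (comm N (madj (A s' x)) (madj (M s')))) / of_nat N + 2 * \<kappa>' s s') \<partial>\<mu>))) / 4"
  shows "- \<epsilon> \<le> v"
    and "0 \<le> v \<Longrightarrow> cmod ((\<integral>x. cis (Re (\<Sum>s\<in>S. c s * mtrace N (mmult N (A s x) (M s)))) \<partial>\<mu>) - of_real (exp (- v / 2))) \<le> \<epsilon>"
proof -
  let ?\<Gamma> = "\<lambda>x. carre S c (\<lambda>s. A s x) M"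
  let ?Z = "\<lambda>x. \<Sum>s\<in>S. c s * mtrace N (mmult N (A s x) (M s))"
  define f where "f s s' x = mtrace N (mmult N (comm N (A s x) (M s)) (comm N (A s' x) (M s'))) / of_nat N + 2 * \<kappa> s s'" for s s' x
  define g where "g s s' x = mtrace N (mmult N (comm N (A s x) (M s)) (comm N (madj (A s' x)) (madj (M s')))) / of_nat N + 2 * \<kappa>' s s'" for s s' x
  note stein = stein_linear_statistic[where S = S and c = c, OF N A trM]
  have int: "integrable \<mu> ?\<Gamma>" "integrable \<mu> (\<lambda>x. Re (?Z x))"
    using rgood_integrable[OF stein(2) N] rgood_integrable[OF stein(3) N] by auto
  have ifg: "integrable \<mu> (\<lambda>x. cmod (f s s' x))" "integrable \<mu> (\<lambda>x. cmod (g s s' x))" if "s \<in> S" "s' \<in> S" for s s'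
    unfolding f_def g_def divide_inverse mult.commute[of _ "inverse _"] using that
    by (intro integrable_norm good_integrable[OF _ N] good_add good_cmult good_const good_mtrace mgood_mmult
        mgood_comm mgood_const mgood_madj covariant_mgood A; simp)+
  have pw: "\<bar>?\<Gamma> x - v\<bar> \<le> (\<Sum>s\<in>S. \<Sum>s'\<in>S. cmod (c s * c s') * (cmod (f s s' x) + cmod (g s s' x))) / 4" for x
  proof -
    have "?\<Gamma> x - v = - Re (\<Sum>s\<in>S. \<Sum>s'\<in>S. c s * c s' * f s s' x + c s * cnj (c s') * g s s' x) / 4"
    proof -
      have "(\<Sum>s\<in>S. \<Sum>s'\<in>S. c s * c s' * f s s' x + c s * cnj (c s') * g s s' x)
        = (\<Sum>s\<in>S. \<Sum>s'\<in>S. c s * c s' * (mtrace N (mmult N (comm N (A s x) (M s)) (comm N (A s' x) (M s'))) / of_nat N)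
             + c s * cnj (c s') * (mtrace N (mmult N (comm N (A s x) (M s)) (comm N (madj (A s' x)) (madj (M s')))) / of_nat N))
          + (\<Sum>s\<in>S. \<Sum>s'\<in>S. 2 * (c s * c s' * \<kappa> s s' + c s * cnj (c s') * \<kappa>' s s'))"
        unfolding sum.distrib[symmetric] f_def g_def by (intro sum.cong refl) (simp add: algebra_simps)
      also have "(\<Sum>s\<in>S. \<Sum>s'\<in>S. 2 * (c s * c s' * \<kappa> s s' + c s * cnj (c s') * \<kappa>' s s'))
        = 2 * (\<Sum>s\<in>S. \<Sum>s'\<in>S. c s * c s' * \<kappa> s s' + c s * cnj (c s') * \<kappa>' s s')"
        by (simp only: sum_distrib_left)
      finally show ?thesis
        unfolding carre_def v_def by simp
    qed
    then have "\<bar>?\<Gamma> x - v\<bar> = \<bar>Re (\<Sum>s\<in>S. \<Sum>s'\<in>S. c s * c s' * f s s' x + c s * cnj (c s') * g s s' x)\<bar> / 4"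
      by simp
    also have "\<dots> \<le> cmod (\<Sum>s\<in>S. \<Sum>s'\<in>S. c s * c s' * f s s' x + c s * cnj (c s') * g s s' x) / 4"
      by (intro divide_right_mono abs_Re_le_cmod) simp
    also have "\<dots> \<le> (\<Sum>s\<in>S. \<Sum>s'\<in>S. cmod (c s * c s') * (cmod (f s s' x) + cmod (g s s' x))) / 4"
    proof (intro divide_right_mono order_trans[OF norm_sum] sum_mono)
      fix s s'
      show "cmod (c s * c s' * f s s' x + c s * cnj (c s') * g s s' x) \<le> cmod (c s * c s') * (cmod (f s s' x) + cmod (g s s' x))"
        by (rule order_trans[OF norm_triangle_ineq]) (simp add: norm_mult distrib_left)
    qed simp
    finally show ?thesis .
  qed
  have isum: "integrable \<mu> (\<lambda>x. (\<Sum>s\<in>S. \<Sum>s'\<in>S. cmod (c s * c s') * (cmod (f s s' x) + cmod (g s s' x))) / 4)"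
    using ifg by (intro integrable_divide Bochner_Integration.integrable_sum integrable_mult_right Bochner_Integration.integrable_add) auto
  have \<epsilon>: "(\<integral>x. (\<Sum>s\<in>S. \<Sum>s'\<in>S. cmod (c s * c s') * (cmod (f s s' x) + cmod (g s s' x))) / 4 \<partial>\<mu>) = \<epsilon>"
  proof -
    have in2: "integrable \<mu> (\<lambda>x. cmod (c s * c s') * (cmod (f s s' x) + cmod (g s s' x)))" if "s \<in> S" "s' \<in> S" for s s'
      using ifg[OF that] by auto
    have "(\<integral>x. (\<Sum>s\<in>S. \<Sum>s'\<in>S. cmod (c s * c s') * (cmod (f s s' x) + cmod (g s s' x))) / 4 \<partial>\<mu>)
      = (\<integral>x. (\<Sum>s\<in>S. \<Sum>s'\<in>S. cmod (c s * c s') * (cmod (f s s' x) + cmod (g s s' x))) \<partial>\<mu>) / 4"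
      by (rule integral_divide_zero)
    also have "(\<integral>x. (\<Sum>s\<in>S. \<Sum>s'\<in>S. cmod (c s * c s') * (cmod (f s s' x) + cmod (g s s' x))) \<partial>\<mu>)
      = (\<Sum>s\<in>S. \<integral>x. (\<Sum>s'\<in>S. cmod (c s * c s') * (cmod (f s s' x) + cmod (g s s' x))) \<partial>\<mu>)"
      by (intro Bochner_Integration.integral_sum Bochner_Integration.integrable_sum in2)
    also have "\<dots> = (\<Sum>s\<in>S. \<Sum>s'\<in>S. \<integral>x. cmod (c s * c s') * (cmod (f s s' x) + cmod (g s s' x)) \<partial>\<mu>)"
      by (intro sum.cong refl Bochner_Integration.integral_sum in2)
    also have "\<dots> = (\<Sum>s\<in>S. \<Sum>s'\<in>S. cmod (c s * c s') * ((\<integral>x. cmod (f s s' x) \<partial>\<mu>) + (\<integral>x. cmod (g s s' x) \<partial>\<mu>)))"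
      using ifg by (intro sum.cong refl) simp
    finally show ?thesis
      by (simp only: \<epsilon>_def f_def g_def)
  qed
  have L1: "(\<integral>x. \<bar>?\<Gamma> x - v\<bar> \<partial>\<mu>) \<le> \<epsilon>"
    unfolding \<epsilon>[symmetric] by (intro integral_mono pw isum) (use int in auto)
  have "(\<integral>x. - (?\<Gamma> x - v) \<partial>\<mu>) \<le> (\<integral>x. \<bar>?\<Gamma> x - v\<bar> \<partial>\<mu>)"
    by (intro integral_mono) (use int in auto)
  moreover have "(\<integral>x. - (?\<Gamma> x - v) \<partial>\<mu>) = v - (\<integral>x. ?\<Gamma> x \<partial>\<mu>)"
    using int by (simp add: prob_space)
  moreover have "0 \<le> ?\<Gamma> x" for x
    unfolding carre_eq_fro by simp
  then have "0 \<le> (\<integral>x. ?\<Gamma> x \<partial>\<mu>)"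
    by (simp add: integral_nonneg)
  moreover have "- (\<integral>x. \<bar>?\<Gamma> x - v\<bar> \<partial>\<mu>) \<le> (\<integral>x. ?\<Gamma> x - v \<partial>\<mu>)"
    using integral_abs_bound[of \<mu> "\<lambda>x. ?\<Gamma> x - v"] by linarith
  moreover have "(\<integral>x. ?\<Gamma> x - v \<partial>\<mu>) \<le> (\<integral>x. \<bar>?\<Gamma> x - v\<bar> \<partial>\<mu>)"
    by (intro integral_mono) (use int in auto)
  ultimately show "- \<epsilon> \<le> v"
    using L1 int by (simp add: prob_space)
  show "cmod ((\<integral>x. cis (Re (?Z x)) \<partial>\<mu>) - of_real (exp (- v / 2))) \<le> \<epsilon>" if v: "0 \<le> v"
    by (rule order_trans[OF stein_char_bound[OF prob int(2) int(1) v stein(1)] L1])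
qed

end

subsection \<open>Asymptotics\<close>

lemma comm_limit:
  fixes \<mu> :: "nat \<Rightarrow> 'k entries measure"
    and A A' :: "nat \<Rightarrow> 'k entries \<Rightarrow> cmat" and M M' :: "nat \<Rightarrow> cmat"
  assumes U: "\<And>N. unitary_invariant N (\<mu> N)"
    and A: "\<And>N. unitary_invariant.covariant N (\<mu> N) (A N)" "\<And>N. unitary_invariant.covariant N (\<mu> N) (A' N)"
    and trA: "\<And>N x. mtrace N (A N x) = 0" "\<And>N x. mtrace N (A' N x) = 0"
    and trM: "\<And>N. mtrace N (M N) = 0" "\<And>N. mtrace N (M' N) = 0"
    and g: "\<And>N. fro N (M N) \<le> g * real N" "\<And>N. fro N (M' N) \<le> g * real N"
    and a: "\<And>N. (\<integral>x. fro N (mmult N (madj (A N x)) (A N x)) \<partial>\<mu> N) \<le> a * real N"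
      "\<And>N. (\<integral>x. fro N (mmult N (madj (A' N x)) (A' N x)) \<partial>\<mu> N) \<le> a * real N"
    and t: "(\<lambda>N. \<integral>x. cmod (mtrace N (mmult N (A N x) (A' N x)) / of_nat N - t) \<partial>\<mu> N) \<longlonglongrightarrow> 0"
    and e: "(\<lambda>N. mtrace N (mmult N (M N) (M' N)) / of_nat N) \<longlonglongrightarrow> e"
  shows "(\<lambda>N. \<integral>x. cmod (mtrace N (mmult N (comm N (A N x) (M N)) (comm N (A' N x) (M' N))) / of_nat N
      + 2 * (t * e)) \<partial>\<mu> N) \<longlonglongrightarrow> 0"
proof -
  define m where "m N = mtrace N (mmult N (M N) (M' N)) / of_nat N" for N
  define X where "X N x = mtrace N (mmult N (A N x) (A' N x)) / of_nat N" for N x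
  define T where "T N x = mtrace N (mmult N (comm N (A N x) (M N)) (comm N (A' N x) (M' N))) / of_nat N" for N x
  \<comment> \<open>The first term is the fluctuation from \<open>comm_trace_L1\<close>, of order
    N^(-1/2); the second is the cost of replacing the product of \<open>X N\<close> and
    \<open>m N\<close> by t e.\<close>
  define b where "b N = 4 * sqrt (10 * a * g\<^sup>2 * real N) / real N
     + 2 * (cmod (m N) * (\<integral>x. cmod (X N x - t) \<partial>\<mu> N) + cmod t * cmod (m N - e))" for N
  have me: "m \<longlonglongrightarrow> e" using e by (simp add: m_def[abs_def])
  have "(\<lambda>N. 4 * sqrt (10 * a * g\<^sup>2) * inverse (sqrt (real N))) \<longlonglongrightarrow> 0"
    by (intro tendsto_mult_right_zero tendsto_inverse_0_at_top filterlim_compose[OF sqrt_at_top filterlim_real_sequentially])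
  moreover have "4 * sqrt (10 * a * g\<^sup>2) * inverse (sqrt (real N)) = 4 * sqrt (10 * a * g\<^sup>2 * real N) / real N" for N
  proof (cases "N = 0")
    case False
    then have "real N = sqrt (real N) * sqrt (real N)" by simp
    then show ?thesis
      using False by (simp add: real_sqrt_mult field_simps)
  qed simp
  ultimately have "(\<lambda>N. 4 * sqrt (10 * a * g\<^sup>2 * real N) / real N) \<longlonglongrightarrow> 0"
    by (simp only:)
  then have "b \<longlonglongrightarrow> 0 + 2 * (cmod e * 0 + cmod t * cmod (e - e))"
    unfolding b_def using t by (intro tendsto_intros me) (simp_all add: X_def)
  then have b0: "b \<longlonglongrightarrow> 0" by simp
  have "(\<lambda>N. \<integral>x. cmod (T N x + 2 * (t * e)) \<partial>\<mu> N) \<longlonglongrightarrow> 0"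
  proof (rule tendsto_sandwich[OF _ _ tendsto_const b0])
    show "\<forall>\<^sub>F N in sequentially. (\<integral>x. cmod (T N x + 2 * (t * e)) \<partial>\<mu> N) \<le> b N"
    proof (rule eventually_sequentiallyI[of 1])
      fix N :: nat assume "1 \<le> N"
      then have N: "0 < N" by simp
      interpret unitary_invariant N "\<mu> N" by (rule U)
      note mg = covariant_mgood[OF A(1)[of N]] covariant_mgood[OF A(2)[of N]]
      have gT: "good (T N)" and gX: "good (X N)"
        unfolding T_def X_def divide_inverse mult.commute[of _ "inverse _"]
        by (intro good_cmult good_mtrace mgood_mmult mgood_comm mg mgood_const)+
      have L1: "(\<integral>x. cmod (T N x + 2 * X N x * m N) \<partial>\<mu> N) \<le> 4 * sqrt (10 * a * g\<^sup>2 * real N) / real N"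
        unfolding T_def X_def m_def by (rule comm_trace_L1[OF N A trA trM g a])
      have int: "integrable (\<mu> N) (\<lambda>x. cmod (T N x + 2 * X N x * m N))" "integrable (\<mu> N) (\<lambda>x. cmod (X N x - t))"
        "integrable (\<mu> N) (\<lambda>x. cmod (T N x + 2 * (t * e)))"
        by (intro integrable_norm good_integrable[OF _ N] good_add good_diff good_mult good_const gT gX)+
      have "(\<integral>x. cmod (T N x + 2 * (t * e)) \<partial>\<mu> N)
        \<le> (\<integral>x. cmod (T N x + 2 * X N x * m N) + 2 * (cmod (m N) * cmod (X N x - t) + cmod t * cmod (m N - e)) \<partial>\<mu> N)"
      proof (rule integral_mono)
        fix x
        have "T N x + 2 * (t * e) = (T N x + 2 * X N x * m N) + (- 2) * ((m N * (X N x - t)) + t * (m N - e))"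
          by (simp add: algebra_simps)
        then have "cmod (T N x + 2 * (t * e))
          \<le> cmod (T N x + 2 * X N x * m N) + cmod ((- 2) * ((m N * (X N x - t)) + t * (m N - e)))"
          by (metis norm_triangle_ineq)
        also have "cmod ((- 2) * ((m N * (X N x - t)) + t * (m N - e))) \<le> 2 * (cmod (m N) * cmod (X N x - t) + cmod t * cmod (m N - e))"
          unfolding norm_mult by (intro mult_mono order_trans[OF norm_triangle_ineq]) (auto simp: norm_mult)
        finally show "cmod (T N x + 2 * (t * e))
          \<le> cmod (T N x + 2 * X N x * m N) + 2 * (cmod (m N) * cmod (X N x - t) + cmod t * cmod (m N - e))"
          by simp
      qed (use int in auto)
      also have "\<dots> = (\<integral>x. cmod (T N x + 2 * X N x * m N) \<partial>\<mu> N) + 2 * (cmod (m N) * (\<integral>x. cmod (X N x - t) \<partial>\<mu> N) + cmod t * cmod (m N - e))"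
        using int by (simp add: prob_space)
      also have "\<dots> \<le> b N"
        unfolding b_def using L1 by simp
      finally show "(\<integral>x. cmod (T N x + 2 * (t * e)) \<partial>\<mu> N) \<le> b N" .
    qed
  qed (simp add: integral_nonneg)
  then show ?thesis
    by (simp only: T_def)
qed

definition slice :: "'k \<Rightarrow> 'k entries \<Rightarrow> cmat" where
  "slice k x = (\<lambda>i j. x (k, i, j))"

lemma madj_center: "madj (center N A) = center N (madj A)"
  by (auto simp: center_def madj_def mtrace_def mid_def fun_eq_iff)

lemma convergent_fro_bound:
  assumes "(\<lambda>N. mtrace N (mmult N (M N) (madj (M N))) / of_nat N) \<longlonglongrightarrow> b"
  shows "\<exists>g. \<forall>N. fro N (M N) \<le> g * real N"
proof -
  have "Bseq (\<lambda>N. mtrace N (mmult N (M N) (madj (M N))) / of_nat N)"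
    using assms by (intro convergent_imp_Bseq) (auto simp: convergent_def)
  then obtain g where g: "\<And>N. cmod (mtrace N (mmult N (M N) (madj (M N))) / of_nat N) \<le> g"
    by (auto simp: Bseq_def)
  have "fro N (M N) \<le> g * real N" for N
  proof (cases "N = 0")
    case False
    then show ?thesis
      using g[of N] by (simp add: norm_divide field_simps flip: fro_eq_mtrace)
  qed (simp add: fro_def)
  then show ?thesis by blast
qed

text \<open>The sign of \<open>v\<close> comes first, by letting N grow in
  \<open>- \<epsilon> N \<le> v\<close>. Only then does the Stein estimate become available, and it
  forces the characteristic function to the Gaussian value because \<open>\<epsilon>\<close> tends
  to 0.\<close>

lemma linear_statistic_asymptotics:
  fixes \<mu> :: "nat \<Rightarrow> 'k entries measure" and Mt :: "nat \<Rightarrow> 'l \<Rightarrow> cmat"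
    and S :: "'s set" and k :: "'s \<Rightarrow> 'k" and l :: "'s \<Rightarrow> 'l" and c :: "'s \<Rightarrow> complex"
  assumes U: "\<And>N. unitary_invariant N (\<mu> N)"
    and a: "\<And>k. \<exists>a. \<forall>N. (\<integral>x. fro N (mmult N (madj (center N (slice k x))) (center N (slice k x))) \<partial>\<mu> N) \<le> a * real N"
    and c1: "\<And>k k'. (\<lambda>N. \<integral>x. cmod (mtrace N (mmult N (center N (slice k x)) (center N (slice k' x))) / of_nat N - tau k k') \<partial>\<mu> N) \<longlonglongrightarrow> 0"
    and c2: "\<And>k k'. (\<lambda>N. \<integral>x. cmod (mtrace N (mmult N (center N (slice k x)) (madj (center N (slice k' x)))) / of_nat N - taubar k k') \<partial>\<mu> N) \<longlonglongrightarrow> 0"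
    and d1: "\<And>l l'. (\<lambda>N. mtrace N (mmult N (Mt N l) (Mt N l')) / of_nat N) \<longlonglongrightarrow> eta l l'"
    and d2: "\<And>l l'. (\<lambda>N. mtrace N (mmult N (Mt N l) (madj (Mt N l'))) / of_nat N) \<longlonglongrightarrow> beta l l'"
    and trace0: "\<And>N l. mtrace N (Mt N l) = 0"
  defines "v \<equiv> Re (\<Sum>s\<in>S. \<Sum>s'\<in>S. c s * c s' * (tau (k s) (k s') * eta (l s) (l s'))
      + c s * cnj (c s') * (taubar (k s) (k s') * beta (l s) (l s'))) / 2"
  shows "0 \<le> v"
    and "(\<lambda>N. \<integral>x. cis (Re (\<Sum>s\<in>S. c s * mtrace N (mmult N (center N (slice (k s) x)) (Mt N (l s))))) \<partial>\<mu> N)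
       \<longlonglongrightarrow> of_real (exp (- v / 2))"
proof -
  let ?A = "\<lambda>N s x. center N (slice (k s) x)" and ?M = "\<lambda>N s. Mt N (l s)"
  have cov: "unitary_invariant.covariant N (\<mu> N) (\<lambda>x. center N (slice k x))" for N k
  proof -
    interpret unitary_invariant N "\<mu> N" by (rule U)
    show ?thesis
      unfolding slice_def by (intro covariant_center covariant_entry)
  qed
  have cov': "unitary_invariant.covariant N (\<mu> N) (\<lambda>x. madj (center N (slice k x)))" for N k
    using unitary_invariant.covariant_madj[OF U cov] .
  define f where "f N s s' = (\<integral>x. cmod (mtrace N (mmult N (comm N (?A N s x) (?M N s)) (comm N (?A N s' x) (?M N s'))) / of_nat N
      + 2 * (tau (k s) (k s') * eta (l s) (l s'))) \<partial>\<mu> N)" for N s s'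
  define g where "g N s s' = (\<integral>x. cmod (mtrace N (mmult N (comm N (?A N s x) (?M N s)) (comm N (madj (?A N s' x)) (madj (?M N s')))) / of_nat N
      + 2 * (taubar (k s) (k s') * beta (l s) (l s'))) \<partial>\<mu> N)" for N s s'
  have lim: "(\<lambda>N. f N s s') \<longlonglongrightarrow> 0" "(\<lambda>N. g N s s') \<longlonglongrightarrow> 0" for s s'
  proof -
    obtain a1 a2 where a12: "\<And>N. (\<integral>x. fro N (mmult N (madj (?A N s x)) (?A N s x)) \<partial>\<mu> N) \<le> a1 * real N"
       "\<And>N. (\<integral>x. fro N (mmult N (madj (?A N s' x)) (?A N s' x)) \<partial>\<mu> N) \<le> a2 * real N"
      using a[of "k s"] a[of "k s'"] by blast
    have amax: "y \<le> max a1 a2 * real N" if "y \<le> a1 * real N \<or> y \<le> a2 * real N" for y N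
      using that mult_right_mono[of a1 "max a1 a2" "real N"] mult_right_mono[of a2 "max a1 a2" "real N"] by auto
    obtain g1 g2 where g12: "\<And>N. fro N (?M N s) \<le> g1 * real N" "\<And>N. fro N (?M N s') \<le> g2 * real N"
      using convergent_fro_bound[OF d2[of "l s" "l s"]] convergent_fro_bound[OF d2[of "l s'" "l s'"]] by blast
    have gmax: "y \<le> max g1 g2 * real N" if "y \<le> g1 * real N \<or> y \<le> g2 * real N" for y N
      using that mult_right_mono[of g1 "max g1 g2" "real N"] mult_right_mono[of g2 "max g1 g2" "real N"] by auto
    show "(\<lambda>N. f N s s') \<longlonglongrightarrow> 0"
      unfolding f_def
      by (rule comm_limit[OF U cov cov mtrace_center mtrace_center trace0 trace0 _ _ _ _ c1 d1, where g = "max g1 g2" and a = "max a1 a2"])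
        (use a12 g12 amax gmax in blast)+
    show "(\<lambda>N. g N s s') \<longlonglongrightarrow> 0"
      unfolding g_def
    \<comment> \<open>The mixed term is the same limit with the second random and deterministic
      matrices replaced by their adjoints, so that \<open>taubar\<close> and \<open>beta\<close>
      take the place of \<open>tau\<close> and \<open>eta\<close>.\<close>
    proof (rule comm_limit[OF U cov cov' mtrace_center _ trace0 _ _ _ _ _ c2 d2, where g = "max g1 g2" and a = "max a1 a2"])
      show "mtrace N (madj (?A N s' x)) = 0" for N x
        by (simp add: mtrace_madj mtrace_center)
      show "mtrace N (madj (?M N s')) = 0" for N
        by (simp add: mtrace_madj trace0)
      show "fro N (madj (?M N s')) \<le> max g1 g2 * real N" for N
        using g12 gmax by simp
      show "(\<integral>x. fro N (mmult N (madj (madj (?A N s' x))) (madj (?A N s' x))) \<partial>\<mu> N) \<le> max a1 a2 * real N" for N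
        using a12 amax by (simp add: fro_madj_commute)
    qed (use a12 g12 amax gmax in blast)+
  qed
  define \<epsilon> where "\<epsilon> N = (\<Sum>s\<in>S. \<Sum>s'\<in>S. cmod (c s * c s') * (f N s s' + g N s s')) / 4" for N
  have "\<epsilon> \<longlonglongrightarrow> (\<Sum>s\<in>S. \<Sum>s'\<in>S. cmod (c s * c s') * (0 + 0)) / 4"
    unfolding \<epsilon>_def by (intro tendsto_intros lim) simp
  then have \<epsilon>0: "\<epsilon> \<longlonglongrightarrow> 0" by simp
  have lower: "- \<epsilon> N \<le> v" if "0 < N" for N
    using unitary_invariant.char_linear_statistic(1)[where A = "?A N" and M = "?M N" and S = S and c = c
        and \<kappa> = "\<lambda>s s'. tau (k s) (k s') * eta (l s) (l s')"
        and \<kappa>' = "\<lambda>s s'. taubar (k s) (k s') * beta (l s) (l s')", OF U that cov trace0]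
    unfolding \<epsilon>_def f_def g_def v_def by blast
  have "(\<lambda>N. - \<epsilon> N) \<longlonglongrightarrow> - 0"
    by (intro tendsto_minus \<epsilon>0)
  then have "- 0 \<le> v"
    by (rule LIMSEQ_le_const2) (use lower in \<open>auto intro!: exI[of _ 1]\<close>)
  then show v: "0 \<le> v" by simp
  have bound: "cmod ((\<integral>x. cis (Re (\<Sum>s\<in>S. c s * mtrace N (mmult N (?A N s x) (?M N s)))) \<partial>\<mu> N) - of_real (exp (- v / 2))) \<le> \<epsilon> N"
    if "0 < N" for N
    using unitary_invariant.char_linear_statistic(2)[where A = "?A N" and M = "?M N" and S = S and c = c
        and \<kappa> = "\<lambda>s s'. tau (k s) (k s') * eta (l s) (l s')"
        and \<kappa>' = "\<lambda>s s'. taubar (k s) (k s') * beta (l s) (l s')", OF U that cov trace0] v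
    unfolding \<epsilon>_def f_def g_def v_def by blast
  have "(\<lambda>N. (\<integral>x. cis (Re (\<Sum>s\<in>S. c s * mtrace N (mmult N (?A N s x) (?M N s)))) \<partial>\<mu> N) - of_real (exp (- v / 2))) \<longlonglongrightarrow> 0"
    by (rule Lim_null_comparison[OF _ \<epsilon>0]) (use bound in \<open>auto intro!: eventually_sequentiallyI[of 1]\<close>)
  then show "(\<lambda>N. \<integral>x. cis (Re (\<Sum>s\<in>S. c s * mtrace N (mmult N (?A N s x) (?M N s)))) \<partial>\<mu> N)
       \<longlonglongrightarrow> of_real (exp (- v / 2))"
    by (rule LIM_zero_cancel)
qed

text \<open>This bound, uniform in N, plays the part of tightness in
  \<open>char_convergence_laws\<close>. The arithmetic-geometric inequality bounds the mean squared
  norm of the centered matrix by (1 + a) N / 2, and \<open>second_moment_mtrace_le\<close>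
  contributes the factor 2/N^2.\<close>

lemma linear_statistic_second_moment:
  fixes \<mu> :: "'k entries measure"
  assumes "unitary_invariant N \<mu>"
    and a: "(\<integral>x. fro N (mmult N (madj (center N (slice k x))) (center N (slice k x))) \<partial>\<mu>) \<le> a * real N"
    and g: "fro N M \<le> g * real N" and g0: "0 \<le> g" and a0: "0 \<le> a"
  shows "integrable \<mu> (\<lambda>x. (cmod (mtrace N (mmult N (center N (slice k x)) M)))\<^sup>2)"
    and "(\<integral>x. (cmod (mtrace N (mmult N (center N (slice k x)) M)))\<^sup>2 \<partial>\<mu>) \<le> (1 + a) * g"
proof -
  interpret unitary_invariant N \<mu> by fact
  let ?C = "\<lambda>x. center N (slice k x)"
  have cov: "covariant ?C"
    unfolding slice_def by (intro covariant_center covariant_entry)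
  note mg = covariant_mgood[OF cov]
  have "integrable \<mu> (\<lambda>x. (cmod (mtrace N (mmult N (?C x) M)))\<^sup>2)
     \<and> (\<integral>x. (cmod (mtrace N (mmult N (?C x) M)))\<^sup>2 \<partial>\<mu>) \<le> (1 + a) * g"
  proof (cases "N = 0")
    case True
    then show ?thesis using g0 a0 by (simp add: mtrace_def)
  next
    case False
    then have N: "0 < N" by simp
    have int: "integrable \<mu> (\<lambda>x. (cmod (mtrace N (mmult N (?C x) M)))\<^sup>2)" "integrable \<mu> (\<lambda>x. fro N (?C x))"
      "integrable \<mu> (\<lambda>x. fro N (mmult N (madj (?C x)) (?C x)))"
      by (intro rgood_integrable[OF _ N] rgood_norm rgood_fro good_mtrace mgood_mmult mgood_madj mg mgood_const)+
    have one: "invariant (\<lambda>x. complex_of_real 1)" by (rule invariant_const)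
    have "(\<integral>x. fro N (?C x) \<partial>\<mu>) \<le> (\<integral>x. (real N + fro N (mmult N (madj (?C x)) (?C x))) / 2 \<partial>\<mu>)"
    proof (rule integral_mono)
      fix x
      have "2 * real N * fro N (?C x) \<le> (real N)\<^sup>2 + (fro N (?C x))\<^sup>2"
        by (rule sum_squares_bound)
      also have "\<dots> \<le> real N * (real N + fro N (mmult N (madj (?C x)) (?C x)))"
        using fro_square_le[of N "?C x"] by (simp add: power2_eq_square distrib_left)
      finally have "real N * (2 * fro N (?C x)) \<le> real N * (real N + fro N (mmult N (madj (?C x)) (?C x)))"
        by (simp add: mult_ac)
      then show "fro N (?C x) \<le> (real N + fro N (mmult N (madj (?C x)) (?C x))) / 2"
        using N by simp
    qed (use int in auto)
    also have "\<dots> = (real N + (\<integral>x. fro N (mmult N (madj (?C x)) (?C x)) \<partial>\<mu>)) / 2"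
      using int by (simp add: prob_space)
    also have "\<dots> \<le> (1 + a) * real N / 2"
      using a by (simp add: algebra_simps)
    finally have fC: "(\<integral>x. fro N (?C x) \<partial>\<mu>) \<le> (1 + a) * real N / 2" .
    have "(\<integral>x. 1 * (cmod (mtrace N (mmult N (?C x) M)))\<^sup>2 \<partial>\<mu>) \<le> 2 / (real N)\<^sup>2 * (\<integral>x. 1 * fro N (?C x) \<partial>\<mu>) * fro N M"
      by (rule second_moment_mtrace_le[OF N cov mtrace_center one]) simp
    also have "\<dots> \<le> 2 / (real N)\<^sup>2 * ((1 + a) * real N / 2) * (g * real N)"
      using fC g a0 by (intro mult_mono) auto
    also have "\<dots> = (1 + a) * g"
      using N by (simp add: field_simps power2_eq_square)
    finally show ?thesis using int by simp
  qed
  then show "integrable \<mu> (\<lambda>x. (cmod (mtrace N (mmult N (?C x) M)))\<^sup>2)"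
    and "(\<integral>x. (cmod (mtrace N (mmult N (?C x) M)))\<^sup>2 \<partial>\<mu>) \<le> (1 + a) * g"
    by blast+
qed

subsection \<open>The law of a unitarily invariant family\<close>

definition embed :: "nat \<Rightarrow> ('k \<Rightarrow> 'a \<Rightarrow> cmat) \<Rightarrow> 'a \<Rightarrow> 'k entries" where
  "embed N A \<omega> = (\<lambda>(k, i, j). if i < N \<and> j < N then A k \<omega> i j else 0)"

lemma joint_law_eq_embed: "joint_law P N A = distr P (PiM UNIV (\<lambda>_. borel)) (embed N A)"
  unfolding joint_law_def embed_def[abs_def] ..

lemma embed_measurable:
  assumes "\<And>k i j. (\<lambda>\<omega>. A k \<omega> i j) \<in> borel_measurable P"
  shows "embed N A \<in> measurable P (PiM UNIV (\<lambda>_. borel))"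
proof (rule measurable_PiM_single')
  fix z :: "'a \<times> nat \<times> nat"
  obtain k i j where "z = (k, i, j)" by (cases z) auto
  then show "(\<lambda>\<omega>. embed N A \<omega> z) \<in> borel_measurable P"
    using assms by (cases "i < N \<and> j < N") (auto simp: embed_def)
qed auto

lemma conj_act_measurable:
  "conj_act N U \<in> measurable (PiM UNIV (\<lambda>_. borel)) (PiM UNIV (\<lambda>_. borel))"
proof (rule measurable_PiM_single')
  fix z :: "'a \<times> nat \<times> nat"
  obtain k i j where z: "z = (k, i, j)" by (cases z) auto
  have [measurable]: "(\<lambda>x. x z) \<in> borel_measurable (PiM UNIV (\<lambda>_. borel))" for z :: "'a \<times> nat \<times> nat"
    by (rule measurable_component_singleton) simp
  show "(\<lambda>x. conj_act N U x z) \<in> borel_measurable (PiM UNIV (\<lambda>_. borel))"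
    unfolding z conj_act_def by simp
qed auto

lemma conj_act_embed:
  "conj_act N U (embed N A \<omega>) = embed N (\<lambda>k \<omega>. mmult N (mmult N U (A k \<omega>)) (madj U)) \<omega>"
proof
  fix z :: "'a \<times> nat \<times> nat"
  obtain k i j where z: "z = (k, i, j)" by (cases z) auto
  have "(\<Sum>r<N. \<Sum>s<N. U i r * A k \<omega> r s * cnj (U j s)) = mmult N (mmult N U (A k \<omega>)) (madj U) i j"
    unfolding mmult_def madj_def sum_distrib_right by (rule sum.swap)
  then show "conj_act N U (embed N A \<omega>) z = embed N (\<lambda>k \<omega>. mmult N (mmult N U (A k \<omega>)) (madj U)) \<omega> z"
    by (simp add: z conj_act_def embed_def)
qed

lemma slice_embed: "i < N \<Longrightarrow> j < N \<Longrightarrow> slice k (embed N A \<omega>) i j = A k \<omega> i j"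
  by (simp add: slice_def embed_def)

lemma mtrace_cong: "(\<And>i j. i < N \<Longrightarrow> j < N \<Longrightarrow> A i j = B i j) \<Longrightarrow> mtrace N A = mtrace N B"
  by (simp add: mtrace_def)

lemma mmult_cong:
  "(\<And>i j. i < N \<Longrightarrow> j < N \<Longrightarrow> A i j = A' i j) \<Longrightarrow> (\<And>i j. i < N \<Longrightarrow> j < N \<Longrightarrow> B i j = B' i j) \<Longrightarrow>
   i < N \<Longrightarrow> j < N \<Longrightarrow> mmult N A B i j = mmult N A' B' i j"
  by (simp add: mmult_def)

lemma unitary_invariant_joint_law:
  fixes A :: "'k \<Rightarrow> 'a \<Rightarrow> cmat"
  assumes P: "prob_space P" and meas: "\<And>k i j. (\<lambda>\<omega>. A k \<omega> i j) \<in> borel_measurable P"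
    and inv: "\<And>U. unitary_mat N U \<Longrightarrow> joint_law P N A = joint_law P N (\<lambda>k \<omega>. mmult N (mmult N U (A k \<omega>)) (madj U))"
    and mom: "\<And>k i j n. i < N \<Longrightarrow> j < N \<Longrightarrow> integrable P (\<lambda>\<omega>. cmod (A k \<omega> i j) ^ n)"
  shows "unitary_invariant N (joint_law P N A)"
proof (rule unitary_invariant.intro)
  note em = embed_measurable[where A = A and N = N and P = P, OF meas]
  show "prob_space (joint_law P N A)"
    unfolding joint_law_eq_embed by (rule prob_space.prob_space_distr[OF P em])
  show "sets (joint_law P N A) = sets (PiM UNIV (\<lambda>_. borel))"
    by (simp add: joint_law_eq_embed)
  show "distr (joint_law P N A) (PiM UNIV (\<lambda>_. borel)) (rot N v \<theta>) = joint_law P N A" if "unit_vec N v" for v \<theta>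
  proof -
    have "distr (joint_law P N A) (PiM UNIV (\<lambda>_. borel)) (rot N v \<theta>)
      = distr P (PiM UNIV (\<lambda>_. borel)) (rot N v \<theta> \<circ> embed N A)"
      unfolding joint_law_eq_embed by (rule distr_distr[OF conj_act_measurable em])
    also have "\<dots> = joint_law P N (\<lambda>k \<omega>. mmult N (mmult N (phase v \<theta>) (A k \<omega>)) (madj (phase v \<theta>)))"
      unfolding joint_law_eq_embed o_def conj_act_embed ..
    also have "\<dots> = joint_law P N A"
      by (rule inv[symmetric, OF unitary_phase[OF that]])
    finally show ?thesis .
  qed
  show "all_moments (joint_law P N A) (\<lambda>x. cmod (x (k, i, j)))" if "i < N" "j < N" for k i j
    unfolding all_moments_def
  proof (intro conjI allI)
    have m [measurable]: "(\<lambda>x. x (k, i, j)) \<in> borel_measurable (PiM UNIV (\<lambda>_. borel))"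
      by (rule measurable_component_singleton) simp
    show "(\<lambda>x. cmod (x (k, i, j))) \<in> borel_measurable (joint_law P N A)"
      unfolding joint_law_eq_embed by simp
    show "integrable (joint_law P N A) (\<lambda>x. \<bar>cmod (x (k, i, j))\<bar> ^ n)" for n
      unfolding joint_law_eq_embed
      by (subst integrable_distr_eq[OF em]) (use mom[OF that] that in \<open>auto simp: embed_def\<close>)
  qed
qed

text \<open>The product of A - \<open>\<alpha>\<close> with its adjoint has four terms, and each has
  squared norm at most that of \<open>mmult N (madj A) A\<close>: indeed |\<open>\<alpha>\<close>|^2
  <= |A|^2 / N, and |A|^4 is controlled by \<open>fro_square_le\<close>. Splitting the sum of four
  costs another factor 4, hence 16.\<close>

lemma fro_center_square_le:
  "fro N (mmult N (madj (center N A)) (center N A)) \<le> 16 * fro N (mmult N (madj A) A)"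
proof (cases "N = 0")
  case False
  define \<alpha> where "\<alpha> = mtrace N A / of_nat N"
  let ?f = "fro N A" and ?F = "fro N (mmult N (madj A) A)"
  have \<alpha>: "(cmod \<alpha>)\<^sup>2 \<le> ?f / real N"
  proof -
    have "(cmod \<alpha>)\<^sup>2 = (cmod (mtrace N A))\<^sup>2 / (real N)\<^sup>2"
      by (simp add: \<alpha>_def norm_divide power_divide)
    also have "\<dots> \<le> real N * ?f / (real N)\<^sup>2"
      by (intro divide_right_mono mtrace_le_fro) simp
    finally show ?thesis using False by (simp add: power2_eq_square)
  qed
  have scale: "fro N (\<lambda>i j. b * B i j) = (cmod b)\<^sup>2 * fro N B" for b B
    by (simp add: fro_def norm_mult power_mult_distrib sum_distrib_left)
  have fmid: "fro N mid = real N"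
    by (simp add: fro_def mid_def if_distrib[of "\<lambda>x. (cmod x)\<^sup>2"] cong: if_cong)
  have fF: "?f\<^sup>2 / real N \<le> ?F"
    using fro_square_le[of N A] False by (simp add: field_simps)
  have "fro N (mmult N (madj (center N A)) (center N A)) =
     fro N (\<lambda>i j. (mmult N (madj A) A i j - \<alpha> * madj A i j) - (cnj \<alpha> * A i j - (cnj \<alpha> * \<alpha>) * mid i j))"
  proof (rule fro_cong)
    fix i j assume ij: "i < N" "j < N"
    have "mmult N (madj (center N A)) (center N A) i j
      = (\<Sum>r<N. madj A i r * A r j - \<alpha> * (madj A i r * mid r j) - cnj \<alpha> * (mid i r * A r j) + cnj \<alpha> * \<alpha> * (mid i r * mid r j))"
      unfolding mmult_def center_def \<alpha>_def[symmetric] madj_def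
      by (intro sum.cong refl) (auto simp: algebra_simps mid_def)
    also have "\<dots> = mmult N (madj A) A i j - \<alpha> * madj A i j - cnj \<alpha> * A i j + cnj \<alpha> * \<alpha> * mid i j"
      unfolding sum.distrib sum_subtractf sum_distrib_left[symmetric] using ij by (simp add: mmult_def)
    finally show "mmult N (madj (center N A)) (center N A) i j
      = (mmult N (madj A) A i j - \<alpha> * madj A i j) - (cnj \<alpha> * A i j - (cnj \<alpha> * \<alpha>) * mid i j)"
      by simp
  qed
  also have "\<dots> \<le> 2 * fro N (\<lambda>i j. mmult N (madj A) A i j - \<alpha> * madj A i j) + 2 * fro N (\<lambda>i j. cnj \<alpha> * A i j - (cnj \<alpha> * \<alpha>) * mid i j)"
    by (rule fro_diff_le)
  also have "\<dots> \<le> 2 * (2 * ?F + 2 * ((cmod \<alpha>)\<^sup>2 * ?f)) + 2 * (2 * ((cmod \<alpha>)\<^sup>2 * ?f) + 2 * (((cmod \<alpha>)\<^sup>2)\<^sup>2 * real N))"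
  proof (intro add_mono mult_left_mono)
    show "fro N (\<lambda>i j. mmult N (madj A) A i j - \<alpha> * madj A i j) \<le> 2 * ?F + 2 * ((cmod \<alpha>)\<^sup>2 * ?f)"
      by (rule order_trans[OF fro_diff_le]) (simp add: scale)
    show "fro N (\<lambda>i j. cnj \<alpha> * A i j - (cnj \<alpha> * \<alpha>) * mid i j) \<le> 2 * ((cmod \<alpha>)\<^sup>2 * ?f) + 2 * (((cmod \<alpha>)\<^sup>2)\<^sup>2 * real N)"
      by (rule order_trans[OF fro_diff_le]) (simp add: scale fmid norm_mult power2_eq_square mult_ac)
  qed auto
  also have "\<dots> \<le> 2 * (2 * ?F + 2 * ?F) + 2 * (2 * ?F + 2 * ?F)"
  proof -
    have "(cmod \<alpha>)\<^sup>2 * ?f \<le> ?f / real N * ?f"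
      by (intro mult_right_mono \<alpha>) simp
    also have "\<dots> \<le> ?F"
      using fF by (simp add: power2_eq_square)
    finally have 1: "(cmod \<alpha>)\<^sup>2 * ?f \<le> ?F" .
    have "((cmod \<alpha>)\<^sup>2)\<^sup>2 * real N \<le> (?f / real N)\<^sup>2 * real N"
      by (intro mult_right_mono power_mono \<alpha>) auto
    also have "\<dots> = ?f\<^sup>2 / real N"
      using False by (simp add: power2_eq_square)
    finally have 2: "((cmod \<alpha>)\<^sup>2)\<^sup>2 * real N \<le> ?F" using fF by linarith
    show ?thesis by (intro add_mono mult_left_mono 1 2) auto
  qed
  finally show ?thesis by simp
qed (simp add: fro_def)

text \<open>A squared entry is at most the squared Frobenius norm, which is N times the normalised
  trace with p = 1. That trace is in every L^q, and for fixed N the powers of N are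
  harmless.\<close>

lemma entry_moments:
  fixes A :: "'a \<Rightarrow> cmat"
  assumes P: "prob_space P" and meas: "\<And>i j. (\<lambda>\<omega>. A \<omega> i j) \<in> borel_measurable P"
    and b: "\<And>q. (q::real) \<ge> 1 \<Longrightarrow> (\<integral>\<^sup>+\<omega>. ennreal (cmod (mtrace N (mpow N (mmult N (A \<omega>) (madj (A \<omega>))) 1) / of_nat N) powr q) \<partial>P) < \<infinity>"
    and ij: "i < N" "j < N"
  shows "integrable P (\<lambda>\<omega>. cmod (A \<omega> i j) ^ n)"
proof -
  interpret prob_space P by fact
  note [measurable] = meas
  define F where "F \<omega> = fro N (A \<omega>)" for \<omega>
  have [measurable]: "F \<in> borel_measurable P"
    unfolding F_def fro_def by measurable
  have N: "0 < N" using ij by simp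
  have tr: "mtrace N (mpow N (mmult N (A \<omega>) (madj (A \<omega>))) 1) = of_real (F \<omega>)" for \<omega>
  proof -
    have "mtrace N (mpow N (mmult N (A \<omega>) (madj (A \<omega>))) 1) = mtrace N (mmult N (A \<omega>) (madj (A \<omega>)))"
      by (simp add: mtrace_def mmult_mid_right)
    then show ?thesis by (simp add: fro_eq_mtrace F_def)
  qed
  have F0: "0 \<le> F \<omega>" for \<omega> by (simp add: F_def)
  \<comment> \<open>\<open>Suc n\<close> keeps the exponent at least 1, as the moment assumption
    requires, also when n = 0; the added 1 below covers entries of modulus at most 1.\<close>
  have "integrable P (\<lambda>\<omega>. (F \<omega> / real N) powr real (Suc n))"
  proof (rule integrableI_bounded)
    have "(\<integral>\<^sup>+\<omega>. ennreal (norm ((F \<omega> / real N) powr real (Suc n))) \<partial>P)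
       = (\<integral>\<^sup>+\<omega>. ennreal (cmod (mtrace N (mpow N (mmult N (A \<omega>) (madj (A \<omega>))) 1) / of_nat N) powr real (Suc n)) \<partial>P)"
      unfolding tr using F0 by (intro nn_integral_cong) (simp add: norm_divide)
    also have "\<dots> < \<infinity>"
      by (rule b) simp
    finally show "(\<integral>\<^sup>+\<omega>. ennreal (norm ((F \<omega> / real N) powr real (Suc n))) \<partial>P) < \<infinity>" .
  qed measurable
  then have "integrable P (\<lambda>\<omega>. 1 + real N ^ Suc n * (F \<omega> / real N) powr real (Suc n))"
    by simp
  then show ?thesis
  proof (rule Bochner_Integration.integrable_bound)
    have "cmod (A \<omega> i j) ^ n \<le> 1 + real N ^ Suc n * (F \<omega> / real N) powr real (Suc n)" for \<omega>
    proof -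
      let ?x = "cmod (A \<omega> i j)"
      have "(F \<omega> / real N) powr real (Suc n) = (F \<omega> / real N) ^ Suc n"
        using F0[of \<omega>] N by (cases "F \<omega> = 0") (simp_all add: powr_realpow del: of_nat_Suc)
      then have *: "real N ^ Suc n * (F \<omega> / real N) powr real (Suc n) = F \<omega> ^ Suc n"
        using N by (simp add: power_divide)
      have "?x\<^sup>2 \<le> (\<Sum>j<N. (cmod (A \<omega> i j))\<^sup>2)"
        using ij by (intro member_le_sum) auto
      also have "\<dots> \<le> F \<omega>"
        unfolding F_def fro_def using ij by (intro member_le_sum) (auto intro: sum_nonneg)
      finally have xF: "?x\<^sup>2 \<le> F \<omega>" .
      show ?thesis
      proof (cases "?x \<le> 1")
        case True
        then have "?x ^ n \<le> 1" by (intro power_le_one) auto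
        then show ?thesis unfolding * using F0[of \<omega>] by (simp add: add_increasing2)
      next
        case False
        then have "?x ^ n \<le> ?x ^ (2 * Suc n)" by (intro power_increasing) auto
        also have "\<dots> = (?x\<^sup>2) ^ Suc n" by (rule power_mult)
        also have "\<dots> \<le> F \<omega> ^ Suc n" by (intro power_mono xF) simp
        finally show ?thesis unfolding * by simp
      qed
    qed
    then show "AE \<omega> in P. norm (cmod (A \<omega> i j) ^ n) \<le> norm (1 + real N ^ Suc n * (F \<omega> / real N) powr real (Suc n))"
      by (intro AE_I2) (auto simp: abs_of_nonneg intro: order_trans[OF _ abs_ge_self])
  qed measurable
qed

subsection \<open>Convergence of characteristic functions in several variables\<close>

lemma compact_PiE_UNIV:
  fixes S :: "'i \<Rightarrow> 'a::topological_space set"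
  assumes "\<And>i. compact (S i)" shows "compact (PiE UNIV S)"
proof -
  have "compactin (product_topology (\<lambda>i. euclidean) UNIV) (PiE UNIV S)"
    by (subst compactin_PiE) (use assms in auto)
  then show ?thesis
    by (simp add: euclidean_product_topology flip: compactin_euclidean_iff)
qed

text \<open>
  The test functions \<open>p (sin (a x\<^sub>1), \<dots>, sin (a x\<^sub>m))\<close> with \<open>p\<close> continuous on the cube are dense enough:
  on a large box they reproduce every continuous function through the inverse \<open>arcsin\<close>,
  they have the same global bound, and the class of those \<open>p\<close> for which multiplication preserves
  the convergence of all Fourier coefficients is an algebra, so Stone-Weierstrass applies.
\<close>

lemma char_convergence_laws:
  fixes M :: "nat \<Rightarrow> ('i::countable \<Rightarrow> real) measure" and M' :: "('i \<Rightarrow> real) measure"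
    and f :: "('i \<Rightarrow> real) \<Rightarrow> real"
  assumes I: "finite I"
    and M: "\<And>n. prob_space (M n)" "\<And>n. sets (M n) = sets (PiM UNIV (\<lambda>_. borel))"
    and M': "prob_space M'" "sets M' = sets (PiM UNIV (\<lambda>_. borel))"
    and mom: "\<And>n i. i \<in> I \<Longrightarrow> integrable (M n) (\<lambda>x. (x i)\<^sup>2)" "\<And>n i. i \<in> I \<Longrightarrow> (\<integral>x. (x i)\<^sup>2 \<partial>M n) \<le> C"
    and mom': "\<And>i. i \<in> I \<Longrightarrow> integrable M' (\<lambda>x. (x i)\<^sup>2)" "\<And>i. i \<in> I \<Longrightarrow> (\<integral>x. (x i)\<^sup>2 \<partial>M') \<le> C"
    and char: "\<And>t. (\<lambda>n. \<integral>x. cis (\<Sum>i\<in>I. t i * x i) \<partial>M n) \<longlonglongrightarrow> (\<integral>x. cis (\<Sum>i\<in>I. t i * x i) \<partial>M')"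
    and f: "continuous_on UNIV f" "bounded (range f)"
  shows "(\<lambda>n. \<integral>x. f (\<lambda>i. if i \<in> I then x i else 0) \<partial>M n) \<longlonglongrightarrow> (\<integral>x. f (\<lambda>i. if i \<in> I then x i else 0) \<partial>M')"
proof -
  let ?B = "PiM UNIV (\<lambda>_. borel) :: ('i \<Rightarrow> real) measure"
  \<comment> \<open>Weights that preserve convergence of all characteristic integrals. Multiplying
    by \<open>cis (b * x j)\<close> only shifts the frequency \<open>t\<close>, so it stays in the
    class, and sines follow by Euler's formula.\<close>
  define conv where "conv w \<longleftrightarrow> w \<in> borel_measurable ?B \<and> (\<exists>K. \<forall>x. cmod (w x) \<le> K) \<and>
     (\<forall>t. (\<lambda>n. \<integral>x. w x * cis (\<Sum>i\<in>I. t i * x i) \<partial>M n) \<longlonglongrightarrow> (\<integral>x. w x * cis (\<Sum>i\<in>I. t i * x i) \<partial>M'))" for w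
  have meas: "g \<in> borel_measurable (M n)" "g \<in> borel_measurable M'" if "g \<in> borel_measurable ?B" for g :: "('i \<Rightarrow> real) \<Rightarrow> 'c::topological_space" and n
    using that by (simp_all add: measurable_cong_sets[OF M(2) refl] measurable_cong_sets[OF M'(2) refl])
  have coord [measurable]: "(\<lambda>x. x i) \<in> borel_measurable ?B" for i
    by (rule measurable_component_singleton) simp
  have cis_meas: "(\<lambda>x. cis (\<Sum>i\<in>I. t i * x i)) \<in> borel_measurable ?B" for t
    by (rule borel_measurable_continuous_on[where f = cis]) (auto intro: continuous_intros)
  have int: "integrable (M n) (\<lambda>x. w x * cis (\<Sum>i\<in>I. t i * x i))" "integrable M' (\<lambda>x. w x * cis (\<Sum>i\<in>I. t i * x i))"
    if "conv w" for w t n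
  proof -
    interpret Mn: prob_space "M n" by fact
    interpret M': prob_space M' by fact
    obtain K where K: "\<And>x. cmod (w x) \<le> K"
      using \<open>conv w\<close> by (auto simp: conv_def)
    have w: "w \<in> borel_measurable ?B" using \<open>conv w\<close> by (simp add: conv_def)
    have m: "(\<lambda>x. w x * cis (\<Sum>i\<in>I. t i * x i)) \<in> borel_measurable ?B"
      by (intro borel_measurable_times w cis_meas)
    show "integrable (M n) (\<lambda>x. w x * cis (\<Sum>i\<in>I. t i * x i))"
      by (rule Mn.integrable_const_bound[of _ K]) (auto simp: norm_mult K intro: meas[OF m])
    show "integrable M' (\<lambda>x. w x * cis (\<Sum>i\<in>I. t i * x i))"
      by (rule M'.integrable_const_bound[of _ K]) (auto simp: norm_mult K intro: meas[OF m])
  qed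
  have conv_add: "conv (\<lambda>x. v x + w x)" if vw: "conv v" "conv w" for v w
    unfolding conv_def
  proof (intro conjI allI)
    show "(\<lambda>x. v x + w x) \<in> borel_measurable ?B"
      using vw by (auto simp: conv_def)
    obtain K where "\<And>x. cmod (v x) \<le> K"
      using vw(1) unfolding conv_def by blast
    moreover obtain L where "\<And>x. cmod (w x) \<le> L"
      using vw(2) unfolding conv_def by blast
    ultimately show "\<exists>K. \<forall>x. cmod (v x + w x) \<le> K"
      by (intro exI[of _ "K + L"]) (auto intro: order_trans[OF norm_triangle_ineq] add_mono)
    show "(\<lambda>n. \<integral>x. (v x + w x) * cis (\<Sum>i\<in>I. t i * x i) \<partial>M n) \<longlonglongrightarrow> (\<integral>x. (v x + w x) * cis (\<Sum>i\<in>I. t i * x i) \<partial>M')" for t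
      unfolding distrib_right
        Bochner_Integration.integral_add[OF int(1)[OF vw(1)] int(1)[OF vw(2)]]
        Bochner_Integration.integral_add[OF int(2)[OF vw(1)] int(2)[OF vw(2)]]
      using vw by (intro tendsto_add) (simp_all add: conv_def)
  qed
  have conv_cmult: "conv (\<lambda>x. c * w x)" if cw: "conv w" for c w
    unfolding conv_def
  proof (intro conjI allI)
    show "(\<lambda>x. c * w x) \<in> borel_measurable ?B"
      using cw by (auto simp: conv_def)
    obtain K where "\<And>x. cmod (w x) \<le> K"
      using cw unfolding conv_def by blast
    then show "\<exists>K. \<forall>x. cmod (c * w x) \<le> K"
      by (intro exI[of _ "cmod c * K"]) (auto simp: norm_mult intro: mult_left_mono)
    show "(\<lambda>n. \<integral>x. (c * w x) * cis (\<Sum>i\<in>I. t i * x i) \<partial>M n) \<longlonglongrightarrow> (\<integral>x. (c * w x) * cis (\<Sum>i\<in>I. t i * x i) \<partial>M')" for t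
      using cw unfolding mult.assoc integral_mult_right_zero
      by (intro tendsto_mult_left) (simp add: conv_def)
  qed
  have conv_one: "conv (\<lambda>x. 1)"
    using char by (auto simp: conv_def)
  have conv_cis: "conv (\<lambda>x. w x * cis (b * x j))" if "conv w" "j \<in> I" for w b j
    unfolding conv_def
  proof (intro conjI allI)
    have "(\<lambda>x. cis (b * x j)) \<in> borel_measurable ?B"
      by (rule borel_measurable_continuous_on[where f = cis]) (auto intro: continuous_intros)
    then show "(\<lambda>x. w x * cis (b * x j)) \<in> borel_measurable ?B"
      using that by (auto simp: conv_def)
    show "\<exists>K. \<forall>x. cmod (w x * cis (b * x j)) \<le> K"
      using that by (auto simp: conv_def norm_mult)
    fix t
    have "(\<Sum>i\<in>I. (t(j := t j + b)) i * x i) = b * x j + (\<Sum>i\<in>I. t i * x i)" for x :: "'i \<Rightarrow> real"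
      using I that(2) by (simp add: sum.remove[of I j] algebra_simps)
    then have "w x * cis (b * x j) * cis (\<Sum>i\<in>I. t i * x i) = w x * cis (\<Sum>i\<in>I. (t(j := t j + b)) i * x i)" for x
      by (simp only: cis_mult[symmetric] mult.assoc)
    then show "(\<lambda>n. \<integral>x. w x * cis (b * x j) * cis (\<Sum>i\<in>I. t i * x i) \<partial>M n)
       \<longlonglongrightarrow> (\<integral>x. w x * cis (b * x j) * cis (\<Sum>i\<in>I. t i * x i) \<partial>M')"
      using that(1) unfolding conv_def by presburger
  qed
  have conv_sin: "conv (\<lambda>x. w x * of_real (sin (b * x j)))" if "conv w" "j \<in> I" for w b j
  proof -
    have sin: "complex_of_real (sin \<theta>) = (- \<i> / 2) * cis \<theta> + (\<i> / 2) * cis (- \<theta>)" for \<theta>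
      by (simp add: complex_eq_iff)
    have "conv (\<lambda>x. (- \<i> / 2) * (w x * cis (b * x j)) + (\<i> / 2) * (w x * cis ((- b) * x j)))"
      by (intro conv_add conv_cmult conv_cis that)
    also have "(\<lambda>x. (- \<i> / 2) * (w x * cis (b * x j)) + (\<i> / 2) * (w x * cis ((- b) * x j)))
      = (\<lambda>x. w x * of_real (sin (b * x j)))"
      unfolding sin by (simp add: fun_eq_iff algebra_simps)
    finally show ?thesis .
  qed
  obtain B where B: "\<And>x. \<bar>f x\<bar> \<le> B" and B0: "0 \<le> B"
    using f(2) unfolding bounded_iff by (metis abs_ge_zero order_trans rangeI real_norm_def)
  \<comment> \<open>Coordinates outside \<open>I\<close> are pinned at 0: this set is compact, and
    the coordinates in \<open>I\<close> suffice to separate its points.\<close>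
  define K where "K = PiE UNIV (\<lambda>i. if i \<in> I then {-1..1} else {0::real})"
  have K: "compact K"
    unfolding K_def by (rule compact_PiE_UNIV) auto
  have memK: "z \<in> K \<longleftrightarrow> (\<forall>i. z i \<in> (if i \<in> I then {-1..1} else {0}))" for z
    by (auto simp: K_def PiE_iff)
  let ?r = "\<lambda>x i. if i \<in> I then x i else (0::real)"
  have r_meas: "?r \<in> measurable ?B ?B"
    by (rule measurable_PiM_single') auto
  have f_meas: "f \<in> borel_measurable ?B"
    using borel_measurable_continuous_onI[OF f(1)] by (simp add: measurable_cong_sets[OF sets_PiM_equal_borel refl])
  have fr: "(\<lambda>x. f (?r x)) \<in> borel_measurable ?B"
    using measurable_compose[OF r_meas f_meas] .

  have approx: "\<exists>g. g \<in> borel_measurable ?B \<and> (\<forall>x. \<bar>g x\<bar> \<le> B + \<epsilon>) \<and>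
      (\<forall>x. \<bar>f (?r x) - g x\<bar> \<le> \<epsilon> + (2 * B + \<epsilon>) * (\<Sum>i\<in>I. (x i)\<^sup>2) / R\<^sup>2) \<and>
      (\<lambda>n. \<integral>x. g x \<partial>M n) \<longlonglongrightarrow> (\<integral>x. g x \<partial>M')" if \<epsilon>: "0 < \<epsilon>" and R: "0 < R" for \<epsilon> R
  proof -
    \<comment> \<open>Chosen so that |x_i| <= R means |a x_i| <= pi / 2, the range on which
      \<open>arcsin\<close> inverts \<open>sin\<close>.\<close>
    define a where "a = pi / (2 * R)"
    have a: "0 < a" using R by (simp add: a_def)
    define s where "s x = (\<lambda>i. if i \<in> I then sin (a * x i) else 0)" for x :: "'i \<Rightarrow> real"
    have sK: "s x \<in> K" for x
      by (auto simp: s_def memK)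
    define h where "h z = f (\<lambda>i. if i \<in> I then arcsin (z i) / a else 0)" for z
    \<comment> \<open>Membership means being a multiplier of \<open>conv\<close>, so closure under
      products is just composition; mere convergence of the integrals would not be stable under
      products.\<close>
    define A where "A = {p. continuous_on K p \<and> (\<forall>w. conv w \<longrightarrow> conv (\<lambda>x. w x * complex_of_real (p (s x))))}"
    interpret function_ring_on A K
    proof
      show "compact K" by (rule K)
      show "continuous_on K p" if "p \<in> A" for p using that by (simp add: A_def)
      show "(\<lambda>x. p x + q x) \<in> A" if "p \<in> A" "q \<in> A" for p q
        using that unfolding A_def by (auto intro!: continuous_on_add conv_add simp: distrib_left)
      show "(\<lambda>x. p x * q x) \<in> A" if "p \<in> A" "q \<in> A" for p q
        using that unfolding A_def by (auto intro!: continuous_on_mult simp: mult.assoc[symmetric])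
      show "(\<lambda>_. c) \<in> A" for c
        using conv_cmult[of _ "of_real c"] by (auto simp: A_def mult.commute)
      fix z z' assume z: "z \<in> K" "z' \<in> K" "z \<noteq> z'"
      then obtain i where "z i \<noteq> z' i" by auto
      moreover have "z i \<in> (if i \<in> I then {-1..1} else {0})" "z' i \<in> (if i \<in> I then {-1..1} else {0})"
        using z unfolding memK by blast+
      ultimately have i: "i \<in> I" "z i \<noteq> z' i"
        by (auto split: if_splits)
      have "(\<lambda>z. z i) \<in> A"
        unfolding A_def using i(1) conv_sin[OF _ i(1)]
        by (auto simp: s_def intro: continuous_on_subset[OF continuous_on_product_coordinates])
      then show "\<exists>p\<in>A. p z \<noteq> p z'"
        by (rule bexI[rotated]) (rule i(2))
    qed
    have "continuous_on K h"
      unfolding h_def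
    proof (rule continuous_on_compose2[OF f(1)])
      show "continuous_on K (\<lambda>z i. if i \<in> I then arcsin (z i) / a else 0)"
      proof (rule continuous_on_coordinatewise_then_product)
        fix i
        have "continuous_on K (\<lambda>z. z i)"
          by (rule continuous_on_subset[OF continuous_on_product_coordinates]) auto
        then have "continuous_on K (\<lambda>z. arcsin (z i) / a)" if "i \<in> I"
        proof (intro continuous_on_divide continuous_on_arcsin continuous_on_const)
          show "\<forall>z\<in>K. - 1 \<le> z i \<and> z i \<le> 1"
          proof
            fix z assume "z \<in> K"
            then have "z i \<in> (if i \<in> I then {-1..1} else {0})"
              unfolding memK by blast
            then show "- 1 \<le> z i \<and> z i \<le> 1"
              using that by simp
          qed
        qed (use a in auto)
        then show "continuous_on K (\<lambda>z. if i \<in> I then arcsin (z i) / a else 0)"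
          by (cases "i \<in> I") auto
      qed
    qed auto
    from Stone_Weierstrass_basic[OF this \<epsilon>] obtain p where p: "p \<in> A" and ph: "\<And>z. z \<in> K \<Longrightarrow> \<bar>h z - p z\<bar> < \<epsilon>"
      by blast
    let ?g = "\<lambda>x. p (s x)"
    have pA: "\<forall>w. conv w \<longrightarrow> conv (\<lambda>x. w x * complex_of_real (?g x))"
      using p by (simp add: A_def)
    have cg: "conv (\<lambda>x. complex_of_real (?g x))"
      using pA[rule_format, OF conv_one] by simp
    have gm: "?g \<in> borel_measurable ?B"
    proof -
      have "continuous_on UNIV Re"
        by (intro continuous_intros)
      from borel_measurable_continuous_on[OF this conjunct1[OF cg[unfolded conv_def]]]
      show ?thesis
        by (simp only: Re_complex_of_real)
    qed
    have hB: "\<bar>h z\<bar> \<le> B" for z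
      by (simp add: h_def B)
    have gb: "\<bar>?g x\<bar> \<le> B + \<epsilon>" for x
      using ph[OF sK[of x]] hB[of "s x"] by linarith
    have "\<bar>f (?r x) - ?g x\<bar> \<le> \<epsilon> + (2 * B + \<epsilon>) * (\<Sum>i\<in>I. (x i)\<^sup>2) / R\<^sup>2" for x
    proof (cases "\<forall>i\<in>I. \<bar>x i\<bar> \<le> R")
      case True
      have "arcsin (sin (a * x i)) / a = x i" if "i \<in> I" for i
      proof -
        have "\<bar>a * x i\<bar> \<le> a * R"
          using True that a by (simp add: abs_mult)
        also have "a * R = pi / 2"
          using R by (simp add: a_def)
        finally show ?thesis
          using a by (subst arcsin_sin) auto
      qed
      then have "h (s x) = f (?r x)"
        unfolding h_def s_def by (intro arg_cong[of _ _ f]) auto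
      then have "\<bar>f (?r x) - ?g x\<bar> < \<epsilon>"
        using ph[OF sK[of x]] by simp
      moreover have "0 \<le> (2 * B + \<epsilon>) * (\<Sum>i\<in>I. (x i)\<^sup>2) / R\<^sup>2"
        using B0 \<epsilon> by (intro divide_nonneg_nonneg mult_nonneg_nonneg sum_nonneg) auto
      ultimately show ?thesis by simp
    next
      \<comment> \<open>Outside the box the trivial bound 2B + \<open>\<epsilon>\<close> is
        multiplied by a sum of squares over R^2 that is at least 1, as in Chebyshev's
        inequality.\<close>
      case False
      then obtain j where j: "j \<in> I" "R < \<bar>x j\<bar>" by force
      have "R\<^sup>2 \<le> (x j)\<^sup>2"
        using j R by (metis abs_ge_zero less_eq_real_def power2_abs power_mono)
      also have "\<dots> \<le> (\<Sum>i\<in>I. (x i)\<^sup>2)"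
        using j I by (intro member_le_sum) auto
      finally have "1 \<le> (\<Sum>i\<in>I. (x i)\<^sup>2) / R\<^sup>2"
        using R by simp
      then have "(2 * B + \<epsilon>) * 1 \<le> (2 * B + \<epsilon>) * ((\<Sum>i\<in>I. (x i)\<^sup>2) / R\<^sup>2)"
        using B0 \<epsilon> by (intro mult_left_mono) auto
      moreover have "\<bar>f (?r x) - ?g x\<bar> \<le> B + (B + \<epsilon>)"
        using B[of "?r x"] gb[of x] by linarith
      ultimately show ?thesis
        using \<epsilon> by simp
    qed
    moreover have "(\<lambda>n. \<integral>x. ?g x \<partial>M n) \<longlonglongrightarrow> (\<integral>x. ?g x \<partial>M')"
    proof -
      note spec[OF conjunct2[OF conjunct2[OF cg[unfolded conv_def]]], of "\<lambda>_. 0"]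
      then have "(\<lambda>n. complex_of_real (\<integral>x. ?g x \<partial>M n)) \<longlonglongrightarrow> complex_of_real (\<integral>x. ?g x \<partial>M')"
        by simp
      then show ?thesis
        unfolding tendsto_of_real_iff .
    qed
    ultimately show ?thesis
      using gm gb by blast
  qed

  show ?thesis
  proof (rule LIMSEQ_I)
    fix \<delta> :: real assume \<delta>: "0 < \<delta>"
    define \<epsilon> where "\<epsilon> = min 1 (\<delta> / 8)"
    have \<epsilon>: "0 < \<epsilon>" "\<epsilon> \<le> 1" "\<epsilon> \<le> \<delta> / 8" using \<delta> by (auto simp: \<epsilon>_def)
    define S where "S = (2 * B + 1) * (real (card I) * \<bar>C\<bar>)"
    have S: "0 \<le> S" using B0 by (simp add: S_def)
    \<comment> \<open>With this radius the Chebyshev term is at most \<open>\<delta>\<close> / 8.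
      Together with \<open>\<epsilon>\<close> it costs at most \<open>\<delta>\<close> / 4 for each
      law, and the comparison of the two integrals of \<open>g\<close> costs another
      \<open>\<delta>\<close> / 4.\<close>
    define R where "R = sqrt (8 * (S + 1) / \<delta>)"
    have R: "0 < R" and R2: "R\<^sup>2 = 8 * (S + 1) / \<delta>"
      using S \<delta> by (simp_all add: R_def)
    have SR: "S / R\<^sup>2 \<le> \<delta> / 8"
      unfolding R2 using S \<delta> by (simp add: field_simps)
    obtain g where g: "g \<in> borel_measurable ?B" "\<And>x. \<bar>g x\<bar> \<le> B + \<epsilon>"
      "\<And>x. \<bar>f (?r x) - g x\<bar> \<le> \<epsilon> + (2 * B + \<epsilon>) * (\<Sum>i\<in>I. (x i)\<^sup>2) / R\<^sup>2"
      "(\<lambda>n. \<integral>x. g x \<partial>M n) \<longlonglongrightarrow> (\<integral>x. g x \<partial>M')"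
      using approx[OF \<epsilon>(1) R] by blast
    have close: "\<bar>(\<integral>x. f (?r x) \<partial>L) - (\<integral>x. g x \<partial>L)\<bar> \<le> \<delta> / 4"
      if L: "prob_space L" "sets L = sets ?B" and i: "\<And>i. i \<in> I \<Longrightarrow> integrable L (\<lambda>x. (x i)\<^sup>2)"
        "\<And>i. i \<in> I \<Longrightarrow> (\<integral>x. (x i)\<^sup>2 \<partial>L) \<le> C" for L
    proof -
      interpret prob_space L by fact
      have ig: "integrable L g"
        by (rule integrable_const_bound[of _ "B + \<epsilon>"]) (use g in \<open>auto simp: measurable_cong_sets[OF L(2) refl]\<close>)
      have ifi: "integrable L (\<lambda>x. f (?r x))"
        by (rule integrable_const_bound[of _ B]) (use B fr in \<open>auto simp: measurable_cong_sets[OF L(2) refl]\<close>)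
      have isq: "integrable L (\<lambda>x. \<Sum>i\<in>I. (x i)\<^sup>2)"
        by (intro Bochner_Integration.integrable_sum i)
      have "\<bar>(\<integral>x. f (?r x) \<partial>L) - (\<integral>x. g x \<partial>L)\<bar> = \<bar>\<integral>x. f (?r x) - g x \<partial>L\<bar>"
        using ig ifi by simp
      also have "\<dots> \<le> (\<integral>x. \<bar>f (?r x) - g x\<bar> \<partial>L)"
        by (rule integral_abs_bound)
      also have "\<dots> \<le> (\<integral>x. \<epsilon> + (2 * B + \<epsilon>) * (\<Sum>i\<in>I. (x i)\<^sup>2) / R\<^sup>2 \<partial>L)"
        by (intro integral_mono g(3)) (use ig ifi isq in auto)
      also have "\<dots> = \<epsilon> + (2 * B + \<epsilon>) * (\<integral>x. (\<Sum>i\<in>I. (x i)\<^sup>2) \<partial>L) / R\<^sup>2"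
        using isq by (simp add: prob_space)
      also have "(\<integral>x. (\<Sum>i\<in>I. (x i)\<^sup>2) \<partial>L) = (\<Sum>i\<in>I. \<integral>x. (x i)\<^sup>2 \<partial>L)"
        by (intro Bochner_Integration.integral_sum i)
      also have "\<epsilon> + (2 * B + \<epsilon>) * (\<Sum>i\<in>I. \<integral>x. (x i)\<^sup>2 \<partial>L) / R\<^sup>2 \<le> \<epsilon> + (2 * B + 1) * (real (card I) * \<bar>C\<bar>) / R\<^sup>2"
      proof -
        have "(\<Sum>i\<in>I. \<integral>x. (x i)\<^sup>2 \<partial>L) \<le> real (card I) * \<bar>C\<bar>"
          using i(2) by (intro sum_bounded_above) (auto intro: order_trans[OF _ abs_ge_self])
        then show ?thesis
          using B0 \<epsilon> by (intro add_left_mono divide_right_mono mult_mono sum_nonneg) (auto intro!: integral_nonneg)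
      qed
      also have "\<dots> \<le> \<delta> / 8 + \<delta> / 8"
        using \<epsilon>(3) SR unfolding S_def by (intro add_mono) auto
      finally show ?thesis by simp
    qed
    obtain n0 where n0: "\<And>n. n \<ge> n0 \<Longrightarrow> \<bar>(\<integral>x. g x \<partial>M n) - (\<integral>x. g x \<partial>M')\<bar> < \<delta> / 4"
      using LIMSEQ_D[OF g(4), of "\<delta> / 4"] \<delta> by auto
    show "\<exists>no. \<forall>n\<ge>no. norm ((\<integral>x. f (?r x) \<partial>M n) - (\<integral>x. f (?r x) \<partial>M')) < \<delta>"
    proof (intro exI[of _ n0] allI impI)
      fix n assume "n0 \<le> n"
      from n0[OF this] close[of "M n", OF M mom] close[of M', OF M' mom'] \<delta>
      show "norm ((\<integral>x. f (?r x) \<partial>M n) - (\<integral>x. f (?r x) \<partial>M')) < \<delta>"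
        unfolding real_norm_def by linarith
    qed
  qed
qed

subsection \<open>Gaussian processes\<close>

text \<open>Cholesky factorization by induction on the index set. A positive pivot
  \<open>K a a\<close> is eliminated by passing to the Schur complement; a zero pivot forces its
  whole column to vanish.\<close>

lemma psd_factor:
  fixes K :: "'j \<Rightarrow> 'j \<Rightarrow> real"
  assumes "finite I" and "\<And>i j. i \<in> I \<Longrightarrow> j \<in> I \<Longrightarrow> K i j = K j i"
    and "\<And>t. 0 \<le> (\<Sum>i\<in>I. \<Sum>j\<in>I. t i * t j * K i j)"
  shows "\<exists>L. \<forall>i\<in>I. \<forall>j\<in>I. K i j = (\<Sum>r\<in>I. L i r * L j r)"
  using assms
proof (induction I arbitrary: K rule: finite_induct)
  case empty
  then show ?case by simp
next
  case (insert a I K)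
  have sym: "K i a = K a i" if "i \<in> I" for i
    using insert.prems(1) that by simp
  have form: "(\<Sum>i\<in>insert a I. \<Sum>j\<in>insert a I. t i * t j * K i j)
     = (t a)\<^sup>2 * K a a + 2 * t a * (\<Sum>i\<in>I. t i * K i a) + (\<Sum>i\<in>I. \<Sum>j\<in>I. t i * t j * K i j)" for t
  proof -
    have "(\<Sum>j\<in>I. t a * t j * K a j) = t a * (\<Sum>i\<in>I. t i * K i a)"
      unfolding sum_distrib_left using sym by (intro sum.cong) auto
    moreover have "(\<Sum>i\<in>I. t i * t a * K i a) = t a * (\<Sum>i\<in>I. t i * K i a)"
      unfolding sum_distrib_left by (intro sum.cong) auto
    ultimately show ?thesis
      using insert.hyps by (simp add: sum.distrib power2_eq_square)
  qed
  have psd: "0 \<le> (t a)\<^sup>2 * K a a + 2 * t a * (\<Sum>i\<in>I. t i * K i a) + (\<Sum>i\<in>I. \<Sum>j\<in>I. t i * t j * K i j)" for t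
    using insert.prems(2)[of t] unfolding form .
  have upd: "(\<Sum>i\<in>I. (t(a := s)) i * K i a) = (\<Sum>i\<in>I. t i * K i a)"
    "(\<Sum>i\<in>I. \<Sum>j\<in>I. (t(a := s)) i * (t(a := s)) j * K i j) = (\<Sum>i\<in>I. \<Sum>j\<in>I. t i * t j * K i j)" for t and s :: real
    using insert.hyps by (auto intro!: sum.cong)
  have psd': "0 \<le> s\<^sup>2 * K a a + 2 * s * (\<Sum>i\<in>I. t i * K i a) + (\<Sum>i\<in>I. \<Sum>j\<in>I. t i * t j * K i j)" for t s
    using psd[of "t(a := s)"] unfolding upd by simp
  have Kaa: "0 \<le> K a a"
    using psd'[of 1 "\<lambda>_. 0"] by simp
  show ?case
  proof (cases "K a a = 0")
    case True
    have zero: "K j a = 0" if "j \<in> I" for j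
    proof (rule ccontr)
      assume nz: "K j a \<noteq> 0"
      define t where "t = (\<lambda>i. if i = j then 1 else 0 :: real)"
      have 1: "(\<Sum>i\<in>I. t i * K i a) = K j a"
        using that insert.hyps(1) by (simp add: t_def if_distrib[of "\<lambda>x. x * _"] cong: if_cong)
      define c where "c = (\<Sum>i\<in>I. \<Sum>j\<in>I. t i * t j * K i j)"
      have "0 \<le> 2 * s * K j a + c" for s
        using psd'[of s t] unfolding True 1 c_def by simp
      \<comment> \<open>At this \<open>s\<close> the affine function takes the value -1.\<close>
      from this[of "- (c + 1) / (2 * K j a)"]
      have "0 \<le> 2 * (- (c + 1) / (2 * K j a)) * K j a + c" .
      moreover have "2 * (- (c + 1) / (2 * K j a)) * K j a = - (c + 1)"
        using nz by (simp add: divide_simps)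
      ultimately show False by linarith
    qed
    obtain L where L: "\<forall>i\<in>I. \<forall>j\<in>I. K i j = (\<Sum>r\<in>I. L i r * L j r)"
      using insert.IH[of K] insert.prems(1) psd'[of 0] by auto
    define L' where "L' i r = (if i = a \<or> r = a then 0 else L i r)" for i r
    have "(\<Sum>r\<in>insert a I. L' i r * L' j r) = (if i = a \<or> j = a then 0 else \<Sum>r\<in>I. L i r * L j r)" for i j
      using insert.hyps by (auto simp: L'_def intro!: sum.cong)
    then show ?thesis
      using L zero sym True by (intro exI[of _ L']) auto
  next
    case False
    with Kaa have pos: "0 < K a a" by simp
    define K' where "K' i j = K i j - K i a * K j a / K a a" for i j
    have "0 \<le> (\<Sum>i\<in>I. \<Sum>j\<in>I. t i * t j * K' i j)" for t
    proof -
      let ?S = "\<Sum>i\<in>I. t i * K i a"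
      have "(\<Sum>i\<in>I. \<Sum>j\<in>I. t i * t j * K' i j)
        = (\<Sum>i\<in>I. \<Sum>j\<in>I. t i * t j * K i j) - (\<Sum>i\<in>I. \<Sum>j\<in>I. (t i * K i a) * (t j * K j a) / K a a)"
        unfolding sum_subtractf[symmetric] K'_def by (intro sum.cong refl) (simp add: field_simps)
      also have "(\<Sum>i\<in>I. \<Sum>j\<in>I. (t i * K i a) * (t j * K j a) / K a a) = ?S\<^sup>2 / K a a"
        by (simp add: power2_eq_square sum_product sum_divide_distrib)
      finally have "(\<Sum>i\<in>I. \<Sum>j\<in>I. t i * t j * K' i j) = (\<Sum>i\<in>I. \<Sum>j\<in>I. t i * t j * K i j) - ?S\<^sup>2 / K a a" .
      moreover have "(- ?S / K a a)\<^sup>2 * K a a + 2 * (- ?S / K a a) * ?S = - (?S\<^sup>2 / K a a)"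
        using pos by (simp add: field_simps power2_eq_square)
      ultimately show ?thesis
        \<comment> \<open>The minimizer of the quadratic form in the direction \<open>a\<close>; its
          minimal value is the form of the Schur complement.\<close>
        using psd'[of "- ?S / K a a" t] by linarith
    qed
    then obtain L where L: "\<forall>i\<in>I. \<forall>j\<in>I. K' i j = (\<Sum>r\<in>I. L i r * L j r)"
      using insert.IH[of K'] insert.prems(1) by (auto simp: K'_def)
    define L' where "L' i r = (if r = a then K i a / sqrt (K a a) else if i = a then 0 else L i r)" for i r
    have sum: "(\<Sum>r\<in>insert a I. L' i r * L' j r)
        = K i a * K j a / K a a + (if i = a \<or> j = a then 0 else \<Sum>r\<in>I. L i r * L j r)" for i j
    proof -
      have "(\<Sum>r\<in>I. L' i r * L' j r) = (if i = a \<or> j = a then 0 else \<Sum>r\<in>I. L i r * L j r)"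
        using insert.hyps by (auto simp: L'_def intro!: sum.cong sum.neutral)
      moreover have "L' i a * L' j a = K i a * K j a / K a a"
        using pos by (simp add: L'_def)
      ultimately show ?thesis
        using insert.hyps by simp
    qed
    have "K i j = (\<Sum>r\<in>insert a I. L' i r * L' j r)" if "i \<in> insert a I" "j \<in> insert a I" for i j
    proof (cases "i = a \<or> j = a")
      case True
      then show ?thesis
      proof
        assume "i = a"
        then show ?thesis
          unfolding sum using insert.prems(1)[of j a] that pos by simp
      next
        assume "j = a"
        then show ?thesis
          unfolding sum using pos by simp
      qed
    next
      case False
      with that have "i \<in> I" "j \<in> I" by auto
      with L have "(\<Sum>r\<in>I. L i r * L j r) = K' i j" by simp
      then show ?thesis
        unfolding sum using False by (simp add: K'_def)
    qed
    then show ?thesis by blast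
  qed
qed

section \<open>Real Gaussian laws and uniqueness of finite-dimensional laws\<close>

lemma cis_conv_iexp: "cis x = iexp x"
  by (simp add: cis_conv_exp)

lemma integral_cis_std_normal:
  "(\<integral>x. cis (c * x) \<partial>std_normal_distribution) = complex_of_real (exp (- c\<^sup>2 / 2))"
  using fun_cong[OF char_std_normal_distribution, of c]
  by (simp add: char_def cis_conv_iexp)

text \<open>Levy uniqueness identifies the law of \<open>Y\<close> with that of sqrt v times a
  standard normal variable, from which the second moment is read off. For v = 0 there is no density;
  a vanishing second moment then gives the degenerate alternative of
  \<open>centered_real_gaussian\<close>.\<close>

lemma normal_law:
  fixes Y :: "'x \<Rightarrow> real"
  assumes M: "prob_space M" and Y: "Y \<in> borel_measurable M" and v: "0 \<le> v"
    and char: "\<And>t. (\<integral>x. cis (t * Y x) \<partial>M) = complex_of_real (exp (- v * t\<^sup>2 / 2))"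
  shows "centered_real_gaussian M Y" and "integrable M (\<lambda>x. (Y x)\<^sup>2)" and "(\<integral>x. (Y x)\<^sup>2 \<partial>M) = v"
proof -
  interpret prob_space M by fact
  interpret std: real_distribution std_normal_distribution
    by (rule real_dist_normal_dist)
  define s where "s = sqrt v"
  have s: "0 \<le> s" "s\<^sup>2 = v" using v by (auto simp: s_def)
  have law: "distr M borel Y = distr std_normal_distribution borel (\<lambda>x. s * x)"
  proof (rule Levy_uniqueness)
    show "real_distribution (distr M borel Y)"
      using Y by (rule real_distribution_distr)
    show "real_distribution (distr std_normal_distribution borel (\<lambda>x. s * x))"
      by (rule std.real_distribution_distr) simp
    show "char (distr M borel Y) = char (distr std_normal_distribution borel (\<lambda>x. s * x))"
    proof
      fix t
      have "char (distr M borel Y) t = (\<integral>x. cis (t * Y x) \<partial>M)"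
        unfolding char_def cis_conv_iexp[symmetric] using Y by (subst integral_distr) auto
      also have "\<dots> = complex_of_real (exp (- (t * s)\<^sup>2 / 2))"
        unfolding char using s by (simp add: power_mult_distrib mult.commute)
      also have "\<dots> = (\<integral>x. cis (t * s * x) \<partial>std_normal_distribution)"
        by (rule integral_cis_std_normal[symmetric])
      also have "\<dots> = char (distr std_normal_distribution borel (\<lambda>x. s * x)) t"
        unfolding char_def cis_conv_iexp[symmetric] by (subst integral_distr) (auto simp: mult.assoc)
      finally show "char (distr M borel Y) t = char (distr std_normal_distribution borel (\<lambda>x. s * x)) t" .
    qed
  qed
  have "integrable std_normal_distribution (\<lambda>x. (s * x)\<^sup>2)"
    unfolding power_mult_distrib by (intro integrable_mult_right integrable_std_normal_distribution_moment)
  then have "integrable (distr std_normal_distribution borel (\<lambda>x. s * x)) (\<lambda>y. y\<^sup>2)"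
    by (subst integrable_distr_eq) auto
  then have i: "integrable (distr M borel Y) (\<lambda>y. y\<^sup>2)"
    by (simp only: law)
  then show iY: "integrable M (\<lambda>x. (Y x)\<^sup>2)"
    using Y by (subst (asm) integrable_distr_eq) auto
  have "(\<integral>x. (Y x)\<^sup>2 \<partial>M) = (\<integral>y. y\<^sup>2 \<partial>distr M borel Y)"
    using Y by (subst integral_distr) auto
  also have "\<dots> = (\<integral>x. (s * x)\<^sup>2 \<partial>std_normal_distribution)"
    unfolding law by (subst integral_distr) auto
  also have "\<dots> = v * (\<integral>x. x\<^sup>2 \<partial>std_normal_distribution)"
    by (simp add: power_mult_distrib s)
  also have "(\<integral>x. x\<^sup>2 \<partial>std_normal_distribution) = 1"
    using std_normal_distribution_even_moments[of 1] by (auto simp: numeral_2_eq_2)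
  finally show vY: "(\<integral>x. (Y x)\<^sup>2 \<partial>M) = v" by simp
  show "centered_real_gaussian M Y"
  proof (cases "v = 0")
    case True
    then have "AE x in M. (Y x)\<^sup>2 = 0"
      using integral_nonneg_eq_0_iff_AE[OF iY] vY by simp
    then show ?thesis
      by (simp add: centered_real_gaussian_def)
  next
    case False
    with v have "0 < s" by (simp add: s_def)
    have "distributed std_normal_distribution lborel (\<lambda>x. x) (normal_density 0 1)"
      unfolding distributed_def
    proof (intro conjI)
      show "distr std_normal_distribution lborel (\<lambda>x. x) = std_normal_distribution"
        by (rule distr_id2) simp
    qed auto
    from std.normal_density_affine[OF this, of s 0] \<open>0 < s\<close>
    have d: "distributed std_normal_distribution lborel (\<lambda>x. s * x) (normal_density 0 s)"
      by simp
    have "distr M lborel Y = distr M borel Y"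
      by (intro distr_cong) auto
    also have "\<dots> = distr std_normal_distribution lborel (\<lambda>x. s * x)"
      unfolding law by (intro distr_cong) auto
    also have "\<dots> = density lborel (normal_density 0 s)"
      using d by (simp add: distributed_def)
    finally have "distributed M lborel Y (normal_density 0 s)"
      using Y by (simp add: distributed_def)
    then show ?thesis
      using \<open>0 < s\<close> unfolding centered_real_gaussian_def by blast
  qed
qed

text \<open>\<open>char_convergence_laws\<close> for a constant sequence identifies the integrals of
  bounded continuous functions. Continuous cutoffs extend this to the boxes of points below a given
  one, which form an intersection-stable generator.\<close>

lemma law_unique:
  fixes M1 M2 :: "('j \<Rightarrow> real) measure"
  assumes I: "finite I"
    and M1: "prob_space M1" "sets M1 = sets (PiM I (\<lambda>_. borel))" "\<And>i. i \<in> I \<Longrightarrow> integrable M1 (\<lambda>x. (x i)\<^sup>2)"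
    and M2: "prob_space M2" "sets M2 = sets (PiM I (\<lambda>_. borel))" "\<And>i. i \<in> I \<Longrightarrow> integrable M2 (\<lambda>x. (x i)\<^sup>2)"
    and char: "\<And>t. (\<integral>x. cis (\<Sum>i\<in>I. t i * x i) \<partial>M1) = (\<integral>x. cis (\<Sum>i\<in>I. t i * x i) \<partial>M2)"
  shows "M1 = M2"
proof -
  let ?B = "PiM UNIV (\<lambda>_. borel) :: (nat \<Rightarrow> real) measure"
  define m where "m = card I"
  obtain e where e: "bij_betw e {..<m} I"
    using ex_bij_betw_nat_finite[OF I] by (auto simp: m_def atLeast0LessThan)
  have eI: "e n \<in> I" if "n < m" for n
    using e that by (auto simp: bij_betw_def)
  \<comment> \<open>Relabelling by an enumeration of \<open>I\<close>, padded with 0: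
    \<open>char_convergence_laws\<close> works over a countable index type, whereas
    \<open>'j\<close> is arbitrary.\<close>
  define \<Phi> where "\<Phi> x = (\<lambda>n. if n < m then x (e n) else 0)" for x :: "'j \<Rightarrow> real"
  have comp: "(\<lambda>x. x i) \<in> borel_measurable M" if "sets M = sets (PiM I (\<lambda>_. borel))" "i \<in> I" for i and M :: "('j \<Rightarrow> real) measure"
    unfolding measurable_cong_sets[OF that(1) refl] by (rule measurable_component_singleton[OF that(2)])
  have \<Phi>_meas: "\<Phi> \<in> measurable M ?B" if "sets M = sets (PiM I (\<lambda>_. borel))" for M
    unfolding \<Phi>_def
  proof (rule measurable_PiM_single')
    show "(\<lambda>x. if n < m then x (e n) else 0) \<in> borel_measurable M" for n
      using comp[OF that eI] by (cases "n < m") auto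
  qed auto
  have cis_meas: "(\<lambda>y. cis (\<Sum>i<m. t i * y i)) \<in> borel_measurable ?B" for t
    by (rule borel_measurable_continuous_on[where f = cis])
      (auto intro!: continuous_intros borel_measurable_sum borel_measurable_times measurable_component_singleton)
  have chard: "(\<integral>y. cis (\<Sum>i<m. t i * y i) \<partial>distr M ?B \<Phi>) = (\<integral>x. cis (\<Sum>i\<in>I. t (inv_into {..<m} e i) * x i) \<partial>M)"
    if "sets M = sets (PiM I (\<lambda>_. borel))" for M t
  proof -
    have "(\<Sum>i<m. t i * \<Phi> x i) = (\<Sum>i\<in>I. t (inv_into {..<m} e i) * x i)" for x
      using e by (subst sum.reindex_bij_betw[OF e, symmetric]) (auto simp: \<Phi>_def bij_betw_def intro!: sum.cong)
    then show ?thesis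
      by (subst integral_distr[OF \<Phi>_meas[OF that] cis_meas]) simp
  qed
  have distr_prob: "prob_space (distr M ?B \<Phi>)" if "prob_space M" "sets M = sets (PiM I (\<lambda>_. borel))" for M
    by (rule prob_space.prob_space_distr[OF that(1) \<Phi>_meas[OF that(2)]])
  have sq: "integrable (distr M ?B \<Phi>) (\<lambda>y. (y i)\<^sup>2) \<and> (\<integral>y. (y i)\<^sup>2 \<partial>distr M ?B \<Phi>) = (\<integral>x. (x (e i))\<^sup>2 \<partial>M)"
    if "sets M = sets (PiM I (\<lambda>_. borel))" "\<And>i. i \<in> I \<Longrightarrow> integrable M (\<lambda>x. (x i)\<^sup>2)" "i < m" for M i
  proof -
    have m2: "(\<lambda>y. (y i)\<^sup>2) \<in> borel_measurable ?B"
      by (intro borel_measurable_power measurable_component_singleton) simp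
    show ?thesis
      using that eI[OF that(3)] 
      by (simp add: integrable_distr_eq[OF \<Phi>_meas[OF that(1)] m2] integral_distr[OF \<Phi>_meas[OF that(1)] m2]) (simp add: \<Phi>_def)
  qed
  have int_eq: "(\<integral>x. f (\<Phi> x) \<partial>M1) = (\<integral>x. f (\<Phi> x) \<partial>M2)"
    if f: "continuous_on UNIV f" "bounded (range f)" for f :: "(nat \<Rightarrow> real) \<Rightarrow> real"
  proof -
    define C where "C = (\<Sum>i\<in>I. (\<integral>x. (x i)\<^sup>2 \<partial>M1) + (\<integral>x. (x i)\<^sup>2 \<partial>M2))"
    have C: "(\<integral>x. (x i)\<^sup>2 \<partial>M1) \<le> C" "(\<integral>x. (x i)\<^sup>2 \<partial>M2) \<le> C" if "i \<in> I" for i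
    proof -
      have "(\<integral>x. (x i)\<^sup>2 \<partial>M1) + (\<integral>x. (x i)\<^sup>2 \<partial>M2) \<le> C"
        unfolding C_def by (rule member_le_sum[OF that]) (use I in \<open>auto intro!: add_nonneg_nonneg integral_nonneg\<close>)
      moreover have "0 \<le> (\<integral>x. (x i)\<^sup>2 \<partial>M1)" "0 \<le> (\<integral>x. (x i)\<^sup>2 \<partial>M2)"
        by (auto intro!: integral_nonneg)
      ultimately show "(\<integral>x. (x i)\<^sup>2 \<partial>M1) \<le> C" "(\<integral>x. (x i)\<^sup>2 \<partial>M2) \<le> C" by linarith+
    qed
    have "(\<lambda>n::nat. \<integral>y. f (\<lambda>i. if i \<in> {..<m} then y i else 0) \<partial>distr M1 ?B \<Phi>)
       \<longlonglongrightarrow> (\<integral>y. f (\<lambda>i. if i \<in> {..<m} then y i else 0) \<partial>distr M2 ?B \<Phi>)"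
    proof (rule char_convergence_laws[OF _ _ _ _ _ _ _ _ _ _ f, of _ _ _ C])
      show "(\<lambda>n::nat. \<integral>y. cis (\<Sum>i<m. t i * y i) \<partial>distr M1 ?B \<Phi>) \<longlonglongrightarrow> (\<integral>y. cis (\<Sum>i<m. t i * y i) \<partial>distr M2 ?B \<Phi>)" for t
        unfolding chard[OF M1(2)] chard[OF M2(2)] char by simp
    qed (use distr_prob[OF M1(1,2)] distr_prob[OF M2(1,2)] sq[OF M1(2,3)] sq[OF M2(2,3)] C eI in auto)
    then have eq: "(\<integral>y. f (\<lambda>i. if i \<in> {..<m} then y i else 0) \<partial>distr M1 ?B \<Phi>)
       = (\<integral>y. f (\<lambda>i. if i \<in> {..<m} then y i else 0) \<partial>distr M2 ?B \<Phi>)"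
      by (simp only: LIMSEQ_const_iff)
    have "(\<lambda>y i. if i \<in> {..<m} then y i else 0) \<in> measurable ?B ?B"
      by (rule measurable_PiM_single') auto
    moreover have "f \<in> borel_measurable ?B"
      using borel_measurable_continuous_onI[OF f(1)] by (simp add: measurable_cong_sets[OF sets_PiM_equal_borel refl])
    ultimately have fm: "(\<lambda>y. f (\<lambda>i. if i \<in> {..<m} then y i else 0)) \<in> borel_measurable ?B"
      by (rule measurable_compose)
    have "(\<lambda>i. if i \<in> {..<m} then \<Phi> x i else 0) = \<Phi> x" for x
      by (auto simp: \<Phi>_def)
    then show ?thesis
      using eq unfolding integral_distr[OF \<Phi>_meas[OF M1(2)] fm] integral_distr[OF \<Phi>_meas[OF M2(2)] fm] by simp
  qed
  have box: "measure M1 (PiE I (\<lambda>i. {..a i})) = measure M2 (PiE I (\<lambda>i. {..a i}))" for a :: "'j \<Rightarrow> real"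
  proof -
    \<comment> \<open>A product of ramps that equal 1 up to the corner of the box and fall to 0 with
      slope k beyond it, so that the pointwise limit is the indicator of the closed box.\<close>
    define g where "g k y = (\<Prod>n<m. max 0 (min 1 (1 - real k * (y n - a (e n)))))" for k :: nat and y :: "nat \<Rightarrow> real"
    have g01: "0 \<le> g k y" "g k y \<le> 1" for k y
      unfolding g_def by (auto intro!: prod_nonneg prod_le_1)
    have cont: "continuous_on UNIV (g k)" for k
      unfolding g_def by (intro continuous_intros continuous_on_product_coordinates)
    have bdd: "bounded (range (g k))" for k
      using g01 by (intro boundedI[of _ 1]) auto
    have lim: "(\<lambda>k. g k (\<Phi> x)) \<longlonglongrightarrow> indicator (PiE I (\<lambda>i. {..a i})) x" if x: "x \<in> extensional I" for x
    proof -
      have one: "(\<lambda>k. max 0 (min 1 (1 - real k * u))) \<longlonglongrightarrow> (if u \<le> 0 then 1 else 0)" for u :: real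
      proof (cases "u \<le> 0")
        case True
        then have "max 0 (min 1 (1 - real k * u)) = 1" for k
          using mult_nonneg_nonpos[of "real k" u] by (auto simp: max_def min_def)
        then show ?thesis using True by simp
      next
        case False
        then have u: "0 < u" by simp
        then obtain k0 :: nat where k0: "1 / u \<le> real k0"
          using real_arch_simple by blast
        have "max 0 (min 1 (1 - real k * u)) = 0" if "k \<ge> k0" for k
        proof -
          have "1 / u \<le> real k" using k0 that by linarith
          then have "1 \<le> real k * u" using u by (simp add: field_simps)
          then show ?thesis by (simp add: max_def min_def)
        qed
        then have "eventually (\<lambda>k. max 0 (min 1 (1 - real k * u)) = 0) sequentially"
          by (auto simp: eventually_sequentially)
        then show ?thesis
          using False by (simp add: tendsto_eventually)
      qed
      have "(\<lambda>k. g k (\<Phi> x)) \<longlonglongrightarrow> (\<Prod>n<m. if \<Phi> x n - a (e n) \<le> 0 then 1 else 0)"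
        unfolding g_def by (intro tendsto_prod one)
      also have "(\<Prod>n<m. if \<Phi> x n - a (e n) \<le> 0 then 1 else 0) = (\<Prod>i\<in>I. if x i - a i \<le> 0 then 1 else 0 :: real)"
        by (subst prod.reindex_bij_betw[OF e, symmetric]) (auto simp: \<Phi>_def intro!: prod.cong)
      also have "\<dots> = indicator (PiE I (\<lambda>i. {..a i})) x"
      proof (cases "x \<in> PiE I (\<lambda>i. {..a i})")
        case True
        then show ?thesis by (auto simp: PiE_iff)
      next
        case False
        with x obtain i where "i \<in> I" "\<not> x i - a i \<le> 0"
          by (auto simp: PiE_iff)
        then show ?thesis
          using False I by (auto intro!: prod_zero)
      qed
      finally show ?thesis .
    qed
    have "(\<lambda>k. \<integral>x. g k (\<Phi> x) \<partial>M) \<longlonglongrightarrow> measure M (PiE I (\<lambda>i. {..a i}))"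
      if M: "prob_space M" and sM: "sets M = sets (PiM I (\<lambda>_. borel))" for M
    proof -
      interpret prob_space M by fact
      have bs: "PiE I (\<lambda>i. {..a i}) \<in> sets M"
        unfolding sM using I by (intro sets_PiM_I_finite) auto
      have "(\<lambda>k. \<integral>x. g k (\<Phi> x) \<partial>M) \<longlonglongrightarrow> (\<integral>x. indicator (PiE I (\<lambda>i. {..a i})) x \<partial>M)"
      proof (rule integral_dominated_convergence[where w = "\<lambda>_. 1"])
        show "AE x in M. (\<lambda>k. g k (\<Phi> x)) \<longlonglongrightarrow> indicator (PiE I (\<lambda>i. {..a i})) x"
          using sets_eq_imp_space_eq[OF sM] by (intro AE_I2 lim) (auto simp: space_PiM PiE_iff)
        show "(\<lambda>x. g k (\<Phi> x)) \<in> borel_measurable M" for k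
          using borel_measurable_continuous_onI[OF cont]
          by (intro measurable_compose[OF \<Phi>_meas[OF sM]]) (simp add: measurable_cong_sets[OF sets_PiM_equal_borel refl])
      qed (use bs g01 in \<open>auto simp: abs_of_nonneg\<close>)
      then show ?thesis
        using bs by (simp add: measure_def)
    qed
    from this[OF M1(1,2)] this[OF M2(1,2)] show ?thesis
      unfolding int_eq[OF cont bdd] by (rule LIMSEQ_unique)
  qed
  define E where "E = {PiE I F | F. \<forall>i\<in>I. F i \<in> range (\<lambda>a::real. {..a})}"
  define A where "A k = PiE I (\<lambda>i. {..real k})" for k :: nat
  have UA: "(\<Union>j. {..real j}) = UNIV"
    using real_arch_simple by auto
  show ?thesis
  proof (rule measure_eqI_generator_eq)
    show "Int_stable E"
    proof (rule Int_stableI)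
      fix X Y assume "X \<in> E" "Y \<in> E"
      then obtain F G where "X = PiE I F" "Y = PiE I G"
        and F: "\<forall>i\<in>I. F i \<in> range (\<lambda>a::real. {..a})" and G: "\<forall>i\<in>I. G i \<in> range (\<lambda>a::real. {..a})"
        unfolding E_def by blast
      then have "X \<inter> Y = PiE I (\<lambda>i. F i \<inter> G i)"
        by (simp add: PiE_Int)
      moreover have "\<forall>i\<in>I. F i \<inter> G i \<in> range (\<lambda>a::real. {..a})"
      proof
        fix i assume "i \<in> I"
        then obtain a b where "F i = {..a}" "G i = {..b}" using F G by blast
        then have "F i \<inter> G i = {..min a b}" by auto
        then show "F i \<inter> G i \<in> range (\<lambda>a::real. {..a})" by blast
      qed
      ultimately show "X \<inter> Y \<in> E" unfolding E_def by blast
    qed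
    show "E \<subseteq> Pow (PiE I (\<lambda>_. UNIV))"
      unfolding E_def by (auto simp: PiE_iff)
    have "sets (PiM I (\<lambda>_. borel :: real measure)) = sets (sigma (PiE I (\<lambda>_. UNIV))
        {{f \<in> PiE I (\<lambda>_. UNIV). \<forall>i\<in>j. f i \<in> A i} | A j. j \<in> {I} \<and> A \<in> Pi j (\<lambda>_. range (\<lambda>a::real. {..a}))})"
      unfolding borel_eq_atMost
    proof (rule sets_PiM_sigma)
      show "\<exists>S\<subseteq>range (\<lambda>a::real. {..a}). countable S \<and> UNIV = \<Union>S" for i :: 'j
        using UA by (intro exI[of _ "range (\<lambda>j::nat. {..real j})"]) auto
    qed (use I in auto)
    also have "{{f \<in> PiE I (\<lambda>_. UNIV). \<forall>i\<in>j. f i \<in> A i} | A j. j \<in> {I} \<and> A \<in> Pi j (\<lambda>_. range (\<lambda>a::real. {..a}))} = E"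
    proof -
      have "{f \<in> PiE I (\<lambda>_. UNIV). \<forall>i\<in>I. f i \<in> A i} = PiE I A" for A :: "'j \<Rightarrow> real set"
        by (auto simp: PiE_iff extensional_def)
      then show ?thesis
        unfolding E_def by (auto simp: Pi_iff)
    qed
    also have "sets (sigma (PiE I (\<lambda>_. UNIV)) E) = sigma_sets (PiE I (\<lambda>_. UNIV)) E"
      by (rule sets_measure_of) (auto simp: E_def PiE_iff)
    finally have "sets (PiM I (\<lambda>_. borel :: real measure)) = sigma_sets (PiE I (\<lambda>_. UNIV)) E" .
    then show "sets M1 = sigma_sets (PiE I (\<lambda>_. UNIV)) E" "sets M2 = sigma_sets (PiE I (\<lambda>_. UNIV)) E"
      unfolding M1 M2 by simp_all
    show "emeasure M1 X = emeasure M2 X" if "X \<in> E" for X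
    proof -
      interpret M1: prob_space M1 by fact
      interpret M2: prob_space M2 by fact
      from that obtain F where X: "X = PiE I F" and "\<forall>i\<in>I. F i \<in> range (\<lambda>a::real. {..a})"
        unfolding E_def by blast
      then have "\<forall>i\<in>I. \<exists>a. F i = {..a}" by blast
      then obtain a where "\<And>i. i \<in> I \<Longrightarrow> F i = {..a i}" by metis
      then have "X = PiE I (\<lambda>i. {..a i})"
        unfolding X by (intro PiE_cong) auto
      then show ?thesis
        using box[of a] by (simp add: M1.emeasure_eq_measure M2.emeasure_eq_measure)
    qed
    show "range A \<subseteq> E"
      unfolding A_def E_def by blast
    show "(\<Union>k. A k) = PiE I (\<lambda>_. UNIV)"
    proof (intro equalityI subsetI)
      fix x assume x: "x \<in> PiE I (\<lambda>_. UNIV :: real set)"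
      obtain k :: nat where k: "(\<Sum>i\<in>I. \<bar>x i\<bar>) \<le> real k"
        using real_arch_simple by blast
      have "x i \<le> real k" if "i \<in> I" for i
      proof -
        have "\<bar>x i\<bar> \<le> (\<Sum>i\<in>I. \<bar>x i\<bar>)"
          using that I by (intro member_le_sum) auto
        with k show ?thesis by linarith
      qed
      with x have "x \<in> A k" by (auto simp: A_def PiE_iff)
      then show "x \<in> (\<Union>k. A k)" by blast
    qed (auto simp: A_def PiE_iff)
    show "emeasure M1 (A k) \<noteq> \<infinity>" for k
    proof -
      interpret M1: prob_space M1 by fact
      show ?thesis by simp
    qed
  qed
qed

text \<open>Specified by the characteristic function and not by a density, so that singular
  covariance matrices are included.\<close>

definition gaussian_law :: "('j \<Rightarrow> 'j \<Rightarrow> real) \<Rightarrow> 'j set \<Rightarrow> ('j \<Rightarrow> real) measure \<Rightarrow> bool" where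
  "gaussian_law K I M \<longleftrightarrow> prob_space M \<and> sets M = sets (PiM I (\<lambda>_. borel)) \<and>
     (\<forall>t. (\<integral>x. cis (\<Sum>i\<in>I. t i * x i) \<partial>M)
        = complex_of_real (exp (- (\<Sum>i\<in>I. \<Sum>j\<in>I. t i * t j * K i j) / 2)))"

text \<open>The law is the image of independent standard normals under the factor \<open>L\<close>
  of \<open>psd_factor\<close>; independence turns the characteristic function into a product of
  one-dimensional ones.\<close>

lemma gaussian_law_exists:
  fixes K :: "'j \<Rightarrow> 'j \<Rightarrow> real"
  assumes I: "finite I" and sym: "\<And>i j. i \<in> I \<Longrightarrow> j \<in> I \<Longrightarrow> K i j = K j i"
    and psd: "\<And>t. 0 \<le> (\<Sum>i\<in>I. \<Sum>j\<in>I. t i * t j * K i j)"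
  shows "\<exists>M. gaussian_law K I M"
proof -
  obtain L where L: "\<And>i j. i \<in> I \<Longrightarrow> j \<in> I \<Longrightarrow> K i j = (\<Sum>r\<in>I. L i r * L j r)"
    using psd_factor[OF I sym psd] by blast
  interpret std: real_distribution std_normal_distribution
    by (rule real_dist_normal_dist)
  interpret product_prob_space "\<lambda>_::'j. std_normal_distribution" I
    by unfold_locales
  interpret finite_product_prob_space "\<lambda>_::'j. std_normal_distribution" I
    by unfold_locales (rule I)
  let ?S = "PiM I (\<lambda>_. std_normal_distribution)"
  define T where "T \<xi> = (\<lambda>i\<in>I. \<Sum>r\<in>I. L i r * \<xi> r)" for \<xi> :: "'j \<Rightarrow> real"
  have comp [measurable]: "(\<lambda>\<xi>. \<xi> r) \<in> borel_measurable ?S" if "r \<in> I" for r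
    using measurable_component_singleton[OF that, of "\<lambda>_. std_normal_distribution"] by simp
  have T: "T \<in> measurable ?S (PiM I (\<lambda>_. borel))"
    unfolding T_def by (rule measurable_restrict) (auto intro!: borel_measurable_sum borel_measurable_times comp)
  have "(\<integral>x. cis (\<Sum>i\<in>I. t i * x i) \<partial>distr ?S (PiM I (\<lambda>_. borel)) T)
        = complex_of_real (exp (- (\<Sum>i\<in>I. \<Sum>j\<in>I. t i * t j * K i j) / 2))" for t
  proof -
    define c where "c r = (\<Sum>i\<in>I. t i * L i r)" for r
    have lin: "(\<Sum>i\<in>I. t i * T \<xi> i) = (\<Sum>r\<in>I. c r * \<xi> r)" for \<xi>
    proof -
      have "(\<Sum>i\<in>I. t i * T \<xi> i) = (\<Sum>i\<in>I. \<Sum>r\<in>I. t i * L i r * \<xi> r)"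
        by (simp add: T_def sum_distrib_left mult.assoc)
      also have "\<dots> = (\<Sum>r\<in>I. \<Sum>i\<in>I. t i * L i r * \<xi> r)"
        by (rule sum.swap)
      finally show ?thesis
        by (simp add: c_def sum_distrib_right)
    qed
    have cis_sum: "cis (\<Sum>r\<in>J. f r) = (\<Prod>r\<in>J. cis (f r))" for f :: "'j \<Rightarrow> real" and J
      by (induction J rule: infinite_finite_induct) (auto simp: cis_mult[symmetric])
    have m: "(\<lambda>x. cis (\<Sum>i\<in>I. t i * x i)) \<in> borel_measurable (PiM I (\<lambda>_. borel))"
      by (intro borel_measurable_cis borel_measurable_sum borel_measurable_times measurable_component_singleton) auto
    have "(\<integral>x. cis (\<Sum>i\<in>I. t i * x i) \<partial>distr ?S (PiM I (\<lambda>_. borel)) T) = (\<integral>\<xi>. (\<Prod>r\<in>I. cis (c r * \<xi> r)) \<partial>?S)"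
      by (subst integral_distr[OF T m]) (simp only: lin cis_sum)
    also have "\<dots> = (\<Prod>r\<in>I. \<integral>x. cis (c r * x) \<partial>std_normal_distribution)"
    proof (rule product_integral_prod[OF I])
      show "integrable std_normal_distribution (\<lambda>x. cis (c r * x))" for r
        by (rule std.integrable_const_bound[of _ 1]) auto
    qed
    also have "\<dots> = (\<Prod>r\<in>I. complex_of_real (exp (- (c r)\<^sup>2 / 2)))"
      unfolding integral_cis_std_normal ..
    also have "\<dots> = complex_of_real (exp (\<Sum>r\<in>I. - (c r)\<^sup>2 / 2))"
      by (simp only: exp_sum[OF I] of_real_prod)
    also have "(\<Sum>r\<in>I. - (c r)\<^sup>2 / 2) = - (\<Sum>r\<in>I. (c r)\<^sup>2) / 2"
      by (simp add: sum_negf sum_divide_distrib)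
    also have "(\<Sum>r\<in>I. (c r)\<^sup>2) = (\<Sum>r\<in>I. \<Sum>i\<in>I. \<Sum>j\<in>I. t i * t j * (L i r * L j r))"
      by (simp add: c_def power2_eq_square sum_product mult_ac)
    also have "\<dots> = (\<Sum>i\<in>I. \<Sum>r\<in>I. \<Sum>j\<in>I. t i * t j * (L i r * L j r))"
      by (rule sum.swap)
    also have "\<dots> = (\<Sum>i\<in>I. \<Sum>j\<in>I. \<Sum>r\<in>I. t i * t j * (L i r * L j r))"
      by (intro sum.cong refl sum.swap)
    also have "\<dots> = (\<Sum>i\<in>I. \<Sum>j\<in>I. t i * t j * K i j)"
      by (intro sum.cong refl) (simp add: L sum_distrib_left)
    finally show ?thesis .
  qed
  then show ?thesis
    unfolding gaussian_law_def
    by (intro exI[of _ "distr ?S (PiM I (\<lambda>_. borel)) T"]) (auto intro: prob_space_distr[OF T])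
qed

text \<open>A single coordinate is normal with variance \<open>K i i\<close>, so
  \<open>normal_law\<close> supplies the second moments that \<open>law_unique\<close> asks
  for.\<close>

lemma gaussian_law_square_integrable:
  fixes K :: "'j \<Rightarrow> 'j \<Rightarrow> real"
  assumes I: "finite I" and psd: "\<And>t. 0 \<le> (\<Sum>i\<in>I. \<Sum>j\<in>I. t i * t j * K i j)"
    and M: "gaussian_law K I M" and i: "i \<in> I"
  shows "integrable M (\<lambda>x. (x i)\<^sup>2)"
proof -
  have M': "prob_space M" "sets M = sets (PiM I (\<lambda>_. borel))"
    using M by (auto simp: gaussian_law_def)
  have unit: "(\<Sum>k\<in>I. (if k = i then t else 0) * f k) = t * f i" for t :: real and f
    using I i by (simp add: if_distrib[of "\<lambda>x. x * _"] cong: if_cong)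
  have form: "(\<Sum>k\<in>I. \<Sum>j\<in>I. (if k = i then t else 0) * (if j = i then t else 0) * K k j) = K i i * t\<^sup>2" for t
    by (simp add: mult.assoc unit power2_eq_square flip: sum_distrib_left)
  show ?thesis
  proof (rule normal_law(2)[OF M'(1), of "\<lambda>x. x i" "K i i"])
    show "(\<lambda>x. x i) \<in> borel_measurable M"
      unfolding measurable_cong_sets[OF M'(2) refl] by (rule measurable_component_singleton[OF i])
    show "0 \<le> K i i"
      using psd[of "\<lambda>k. if k = i then 1 else 0"] unfolding form by simp
    fix t
    have "(\<integral>x. cis (\<Sum>k\<in>I. (if k = i then t else 0) * x k) \<partial>M)
        = complex_of_real (exp (- (\<Sum>k\<in>I. \<Sum>j\<in>I. (if k = i then t else 0) * (if j = i then t else 0) * K k j) / 2))"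
      using M unfolding gaussian_law_def by (elim conjE) (erule spec)
    then show "(\<integral>x. cis (t * x i) \<partial>M) = complex_of_real (exp (- K i i * t\<^sup>2 / 2))"
      unfolding unit form by simp
  qed
qed

text \<open>Kolmogorov extension. The finite-dimensional laws are consistent because a restriction
  of a Gaussian law has the characteristic function prescribed for the smaller set, and
  \<open>law_unique\<close> turns this into equality of measures.\<close>

theorem gaussian_process_exists:
  fixes K :: "'j \<Rightarrow> 'j \<Rightarrow> real"
  assumes Ksym: "\<And>i j. K i j = K j i"
    and psd: "\<And>I t. finite I \<Longrightarrow> 0 \<le> (\<Sum>i\<in>I. \<Sum>j\<in>I. t i * t j * K i j)"
  shows "\<exists>Q :: ('j \<Rightarrow> real) measure. prob_space Q \<and> sets Q = sets (PiM UNIV (\<lambda>_. borel)) \<and>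
     (\<forall>I t. finite I \<longrightarrow> (\<integral>x. cis (\<Sum>i\<in>I. t i * x i) \<partial>Q)
        = complex_of_real (exp (- (\<Sum>i\<in>I. \<Sum>j\<in>I. t i * t j * K i j) / 2)))"
proof -
  define PP where "PP J = (SOME M. gaussian_law K J M)" for J
  have PP: "gaussian_law K J (PP J)" if "finite J" for J
    unfolding PP_def by (rule someI_ex[OF gaussian_law_exists[OF that Ksym psd[OF that]]])
  have PP': "prob_space (PP J)" "sets (PP J) = sets (PiM J (\<lambda>_. borel))"
    and PPchar: "\<And>t. (\<integral>x. cis (\<Sum>i\<in>J. t i * x i) \<partial>PP J)
        = complex_of_real (exp (- (\<Sum>i\<in>J. \<Sum>j\<in>J. t i * t j * K i j) / 2))" if "finite J" for J
    using PP[OF that] by (auto simp: gaussian_law_def)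
  have cis_meas: "(\<lambda>x. cis (\<Sum>i\<in>J. t i * x i)) \<in> borel_measurable (PiM J (\<lambda>_. borel))" for J :: "'j set" and t
    by (intro borel_measurable_cis borel_measurable_sum borel_measurable_times measurable_component_singleton) auto
  have consistent: "PP J = distr (PP H) (PiM J (\<lambda>_. borel)) (\<lambda>f. restrict f J)"
    if JH: "J \<subseteq> H" and H: "finite H" for J H
  proof -
    have J: "finite J" using JH H by (rule finite_subset)
    have r: "(\<lambda>f. restrict f J) \<in> measurable (PP H) (PiM J (\<lambda>_. borel))"
      unfolding measurable_cong_sets[OF PP'(2)[OF H] refl] by (rule measurable_restrict_subset[OF JH])
    have "gaussian_law K J (distr (PP H) (PiM J (\<lambda>_. borel)) (\<lambda>f. restrict f J))"
      unfolding gaussian_law_def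
    proof (intro conjI allI)
      show "prob_space (distr (PP H) (PiM J (\<lambda>_. borel)) (\<lambda>f. restrict f J))"
        by (rule prob_space.prob_space_distr[OF PP'(1)[OF H] r])
      fix t :: "'j \<Rightarrow> real"
      \<comment> \<open>Extending the frequencies by 0 expresses the characteristic function of the
        restriction through that of the larger family.\<close>
      let ?t = "\<lambda>i. if i \<in> J then t i else 0"
      have 1: "(\<Sum>i\<in>J. t i * restrict x J i) = (\<Sum>i\<in>H. ?t i * x i)" for x
      proof -
        have "(\<Sum>i\<in>H. ?t i * x i) = (\<Sum>i\<in>J. ?t i * x i)"
          using JH H by (intro sum.mono_neutral_right) auto
        then show ?thesis by simp
      qed
      have 2: "(\<Sum>i\<in>H. \<Sum>j\<in>H. ?t i * ?t j * K i j) = (\<Sum>i\<in>J. \<Sum>j\<in>J. t i * t j * K i j)"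
      proof -
        have "(\<Sum>i\<in>H. \<Sum>j\<in>H. ?t i * ?t j * K i j) = (\<Sum>i\<in>H. \<Sum>j\<in>J. ?t i * ?t j * K i j)"
          using JH H by (intro sum.cong refl sum.mono_neutral_right) auto
        also have "\<dots> = (\<Sum>i\<in>J. \<Sum>j\<in>J. ?t i * ?t j * K i j)"
          using JH H by (intro sum.mono_neutral_right) auto
        finally show ?thesis by simp
      qed
      show "(\<integral>x. cis (\<Sum>i\<in>J. t i * x i) \<partial>distr (PP H) (PiM J (\<lambda>_. borel)) (\<lambda>f. restrict f J))
        = complex_of_real (exp (- (\<Sum>i\<in>J. \<Sum>j\<in>J. t i * t j * K i j) / 2))"
        unfolding integral_distr[OF r cis_meas] 1 PPchar[OF H] 2 ..
    qed simp
    note G = this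
    have "(\<integral>x. cis (\<Sum>i\<in>J. t i * x i) \<partial>PP J)
         = (\<integral>x. cis (\<Sum>i\<in>J. t i * x i) \<partial>distr (PP H) (PiM J (\<lambda>_. borel)) (\<lambda>f. restrict f J))" for t
      using G unfolding PPchar[OF J] gaussian_law_def by (elim conjE) (rule sym, erule spec)
    moreover have "prob_space (distr (PP H) (PiM J (\<lambda>_. borel)) (\<lambda>f. restrict f J))"
      using G by (simp only: gaussian_law_def)
    ultimately show ?thesis
      by (intro law_unique[OF J PP'[OF J] gaussian_law_square_integrable[OF J psd[OF J] PP[OF J]]
            _ sets_distr gaussian_law_square_integrable[OF J psd[OF J] G]])
  qed
  have "projective_family UNIV PP (\<lambda>_. borel)"
    by (rule projective_family.intro) (use consistent PP'(1) in blast)+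
  then interpret polish_projective UNIV PP
    unfolding polish_projective_def .
  have "(\<integral>x. cis (\<Sum>i\<in>I. t i * x i) \<partial>lim) = complex_of_real (exp (- (\<Sum>i\<in>I. \<Sum>j\<in>I. t i * t j * K i j) / 2))"
    if I: "finite I" for I t
  proof -
    have r: "(\<lambda>f. restrict f I) \<in> measurable lim (PiM I (\<lambda>_. borel))"
      unfolding measurable_cong_sets[OF sets_lim refl] by (rule measurable_restrict_subset) simp
    have "distr lim (PiM I (\<lambda>_. borel)) (\<lambda>f. restrict f I) = PP I"
    proof (rule measure_eqI)
      fix X assume "X \<in> sets (distr lim (PiM I (\<lambda>_. borel)) (\<lambda>f. restrict f I))"
      then have X: "X \<in> sets (PiM I (\<lambda>_. borel))" by simp
      have "emeasure (distr lim (PiM I (\<lambda>_. borel)) (\<lambda>f. restrict f I)) X = emeasure lim (emb UNIV I X)"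
        using X r by (simp add: emeasure_distr prod_emb_def space_PiM)
      also have "\<dots> = emeasure (PP I) X"
        by (rule emeasure_lim_emb[OF _ I X]) simp
      finally show "emeasure (distr lim (PiM I (\<lambda>_. borel)) (\<lambda>f. restrict f I)) X = emeasure (PP I) X" .
    qed (simp add: PP'(2)[OF I])
    then have "(\<integral>x. cis (\<Sum>i\<in>I. t i * restrict x I i) \<partial>lim) = (\<integral>x. cis (\<Sum>i\<in>I. t i * x i) \<partial>PP I)"
      unfolding integral_distr[OF r cis_meas, symmetric] by simp
    then show ?thesis
      unfolding PPchar[OF I] by simp
  qed
  then show ?thesis
    using P.prob_space_axioms by (intro exI[of _ lim]) auto
qed

subsection \<open>The limiting complex Gaussian process\<close>

text \<open>Real and imaginary parts are \<open>Re (re_im b * z)\<close>; the index \<open>True\<close> stands for the imaginary part.\<close>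

definition re_im :: "bool \<Rightarrow> complex" where
  "re_im b = (if b then - \<i> else 1)"

definition coord :: "'i \<times> bool \<Rightarrow> ('i \<Rightarrow> complex) \<Rightarrow> real" where
  "coord s x = Re (re_im (snd s) * x (fst s))"

lemma coord_simps [simp]: "coord (i, False) x = Re (x i)" "coord (i, True) x = Im (x i)"
  by (simp_all add: coord_def re_im_def)

text \<open>From Re u Re w = Re (u w + u cnj w) / 2: this is the covariance of two real coordinates,
  each a real or an imaginary part, of a centered complex vector with E Z_i Z_j =
  \<open>p i j\<close> and E Z_i cnj Z_j = \<open>q i j\<close>.\<close>

definition cov_kernel :: "('i \<Rightarrow> 'i \<Rightarrow> complex) \<Rightarrow> ('i \<Rightarrow> 'i \<Rightarrow> complex) \<Rightarrow> 'i \<times> bool \<Rightarrow> 'i \<times> bool \<Rightarrow> real" where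
  "cov_kernel p q s s' = Re (re_im (snd s) * re_im (snd s') * p (fst s) (fst s')
     + re_im (snd s) * cnj (re_im (snd s')) * q (fst s) (fst s')) / 2"

lemma kernel_sym:
  assumes "\<And>i j. p i j = p j i" "\<And>i j. q i j = cnj (q j i)"
  shows "cov_kernel p q s s' = cov_kernel p q s' s"
proof -
  have "Re (re_im (snd s) * cnj (re_im (snd s')) * q (fst s) (fst s'))
     = Re (cnj (re_im (snd s) * cnj (re_im (snd s')) * q (fst s) (fst s')))"
    by (simp only: cnj.sel)
  also have "\<dots> = Re (re_im (snd s') * cnj (re_im (snd s)) * q (fst s') (fst s))"
    using assms(2)[of "fst s'" "fst s"] by (simp add: mult_ac)
  finally show ?thesis
    unfolding cov_kernel_def using assms(1)[of "fst s" "fst s'"] by (simp add: mult_ac)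
qed

text \<open>Links the variance \<open>v\<close> of \<open>linear_statistic_asymptotics\<close>, for
  coefficients of the form \<open>of_real (t s) * re_im _\<close>, to a real quadratic form of the
  kernel.\<close>

lemma kernel_quadratic:
  "Re (\<Sum>s\<in>S. \<Sum>s'\<in>S. (of_real (t s) * re_im (snd (\<phi> s))) * (of_real (t s') * re_im (snd (\<phi> s'))) * p (fst (\<phi> s)) (fst (\<phi> s'))
      + (of_real (t s) * re_im (snd (\<phi> s))) * cnj (of_real (t s') * re_im (snd (\<phi> s'))) * q (fst (\<phi> s)) (fst (\<phi> s'))) / 2
    = (\<Sum>s\<in>S. \<Sum>s'\<in>S. t s * t s' * cov_kernel p q (\<phi> s) (\<phi> s'))"
proof -
  have "Re ((of_real (t s) * re_im (snd (\<phi> s))) * (of_real (t s') * re_im (snd (\<phi> s'))) * p (fst (\<phi> s)) (fst (\<phi> s'))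
      + (of_real (t s) * re_im (snd (\<phi> s))) * cnj (of_real (t s') * re_im (snd (\<phi> s'))) * q (fst (\<phi> s)) (fst (\<phi> s')))
    = 2 * (t s * t s' * cov_kernel p q (\<phi> s) (\<phi> s'))" for s s'
  proof -
    have "(of_real (t s) * re_im (snd (\<phi> s))) * (of_real (t s') * re_im (snd (\<phi> s'))) * p (fst (\<phi> s)) (fst (\<phi> s'))
      + (of_real (t s) * re_im (snd (\<phi> s))) * cnj (of_real (t s') * re_im (snd (\<phi> s'))) * q (fst (\<phi> s)) (fst (\<phi> s'))
     = of_real (t s * t s') * (re_im (snd (\<phi> s)) * re_im (snd (\<phi> s')) * p (fst (\<phi> s)) (fst (\<phi> s'))
         + re_im (snd (\<phi> s)) * cnj (re_im (snd (\<phi> s'))) * q (fst (\<phi> s)) (fst (\<phi> s')))"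
      by (simp add: algebra_simps)
    then show ?thesis
      unfolding cov_kernel_def by (simp only: times_complex.sel Re_complex_of_real Im_complex_of_real)
  qed
  then show ?thesis
    by (simp only: Re_sum sum_distrib_left[symmetric])
qed

lemma sum_reindex_image:
  fixes t :: "'s \<Rightarrow> real"
  assumes "finite S"
  shows "(\<Sum>s\<in>S. t s * h (\<phi> s)) = (\<Sum>j\<in>\<phi> ` S. (\<Sum>s\<in>{s \<in> S. \<phi> s = j}. t s) * h j)"
proof -
  have "(\<Sum>s\<in>S. t s * h (\<phi> s)) = (\<Sum>j\<in>\<phi> ` S. \<Sum>s\<in>{s \<in> S. \<phi> s = j}. t s * h (\<phi> s))"
    by (rule sum.image_gen[OF assms])
  also have "\<dots> = (\<Sum>j\<in>\<phi> ` S. (\<Sum>s\<in>{s \<in> S. \<phi> s = j}. t s) * h j)"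
    by (intro sum.cong refl) (simp add: sum_distrib_right)
  finally show ?thesis .
qed

text \<open>\<open>\<phi>\<close> need not be injective, since a finite-dimensional marginal may
  list an index repeatedly; frequencies attached to the same coordinate are added up.\<close>

lemma gaussian_char_reindex:
  fixes Q :: "('j \<Rightarrow> real) measure" and t :: "'s \<Rightarrow> real"
  assumes Q: "\<And>I t. finite I \<Longrightarrow> (\<integral>x. cis (\<Sum>i\<in>I. t i * x i) \<partial>Q)
        = complex_of_real (exp (- (\<Sum>i\<in>I. \<Sum>j\<in>I. t i * t j * K i j) / 2))"
    and S: "finite S"
  shows "(\<integral>x. cis (\<Sum>s\<in>S. t s * x (\<phi> s)) \<partial>Q)
        = complex_of_real (exp (- (\<Sum>s\<in>S. \<Sum>s'\<in>S. t s * t s' * K (\<phi> s) (\<phi> s')) / 2))"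
proof -
  define T where "T j = (\<Sum>s\<in>{s \<in> S. \<phi> s = j}. t s)" for j
  have lin: "(\<Sum>s\<in>S. t s * h (\<phi> s)) = (\<Sum>j\<in>\<phi> ` S. T j * h j)" for h
    unfolding T_def by (rule sum_reindex_image[OF S])
  have "(\<Sum>s\<in>S. \<Sum>s'\<in>S. t s * t s' * K (\<phi> s) (\<phi> s')) = (\<Sum>s\<in>S. t s * (\<Sum>s'\<in>S. t s' * K (\<phi> s) (\<phi> s')))"
    by (simp add: sum_distrib_left mult.assoc)
  also have "\<dots> = (\<Sum>s\<in>S. t s * (\<Sum>j\<in>\<phi> ` S. T j * K (\<phi> s) j))"
    by (simp only: lin)
  also have "\<dots> = (\<Sum>i\<in>\<phi> ` S. T i * (\<Sum>j\<in>\<phi> ` S. T j * K i j))"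
    by (rule lin)
  also have "\<dots> = (\<Sum>i\<in>\<phi> ` S. \<Sum>j\<in>\<phi> ` S. T i * T j * K i j)"
    by (simp add: sum_distrib_left mult.assoc)
  finally have "(\<Sum>s\<in>S. \<Sum>s'\<in>S. t s * t s' * K (\<phi> s) (\<phi> s')) = (\<Sum>i\<in>\<phi> ` S. \<Sum>j\<in>\<phi> ` S. T i * T j * K i j)" .
  then show ?thesis
    using Q[of "\<phi> ` S" T] S by (simp add: lin)
qed

lemma coord_measurable: "coord s \<in> borel_measurable (PiM UNIV (\<lambda>_. borel))"
proof -
  have "(\<lambda>x. x (fst s)) \<in> borel_measurable (PiM UNIV (\<lambda>_. borel))"
    by (rule measurable_component_singleton) simp
  then show ?thesis
    unfolding coord_def[abs_def] by measurable
qed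

text \<open>A real process indexed by the real and imaginary parts is reassembled into a complex
  one. The characteristic function is delivered in two forms: along families with possible
  repetitions, as needed for marginals, and on sets of distinct coordinates, as needed for
  moments.\<close>

lemma complex_gaussian_process_exists:
  fixes p q :: "'i \<Rightarrow> 'i \<Rightarrow> complex"
  assumes sym: "\<And>i j. p i j = p j i" "\<And>i j. q i j = cnj (q j i)"
    and psd: "\<And>I t. finite I \<Longrightarrow> 0 \<le> (\<Sum>s\<in>I. \<Sum>s'\<in>I. t s * t s' * cov_kernel p q s s')"
  obtains Q :: "('i \<Rightarrow> complex) measure" where "prob_space Q" "sets Q = sets (PiM UNIV (\<lambda>_. borel))"
    "\<And>(I :: (nat \<times> bool) set) t \<phi>. finite I \<Longrightarrow> (\<integral>x. cis (\<Sum>s\<in>I. t s * coord (\<phi> s) x) \<partial>Q)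
        = complex_of_real (exp (- (\<Sum>s\<in>I. \<Sum>s'\<in>I. t s * t s' * cov_kernel p q (\<phi> s) (\<phi> s')) / 2))"
    "\<And>(I :: ('i \<times> bool) set) t. finite I \<Longrightarrow> (\<integral>x. cis (\<Sum>s\<in>I. t s * coord s x) \<partial>Q)
        = complex_of_real (exp (- (\<Sum>s\<in>I. \<Sum>s'\<in>I. t s * t s' * cov_kernel p q s s') / 2))"
proof -
  obtain R :: "('i \<times> bool \<Rightarrow> real) measure" where R: "prob_space R" "sets R = sets (PiM UNIV (\<lambda>_. borel))"
    and char: "\<And>I t. finite I \<Longrightarrow> (\<integral>x. cis (\<Sum>i\<in>I. t i * x i) \<partial>R)
        = complex_of_real (exp (- (\<Sum>i\<in>I. \<Sum>j\<in>I. t i * t j * cov_kernel p q i j) / 2))"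
    using gaussian_process_exists[of "cov_kernel p q", OF kernel_sym[of p q, OF sym] psd] by blast
  define \<Psi> where "\<Psi> y = (\<lambda>i. complex_of_real (y (i, False)) + \<i> * complex_of_real (y (i, True)))" for y :: "'i \<times> bool \<Rightarrow> real"
  have [measurable]: "(\<lambda>y. y s) \<in> borel_measurable R" for s
    unfolding measurable_cong_sets[OF R(2) refl] by (rule measurable_component_singleton) simp
  have \<Psi>: "\<Psi> \<in> measurable R (PiM UNIV (\<lambda>_. borel))"
    unfolding \<Psi>_def
  proof (rule measurable_PiM_single')
    show "(\<lambda>y. complex_of_real (y (i, False)) + \<i> * complex_of_real (y (i, True))) \<in> borel_measurable R" for i
      by measurable
  qed auto
  have coord: "coord s (\<Psi> y) = y s" for s y
    by (cases s; cases "snd s") (auto simp: coord_def re_im_def \<Psi>_def)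
  have tr: "(\<integral>x. cis (\<Sum>s\<in>I. t s * coord (\<phi> s) x) \<partial>distr R (PiM UNIV (\<lambda>_. borel)) \<Psi>)
      = (\<integral>y. cis (\<Sum>s\<in>I. t s * y (\<phi> s)) \<partial>R)" for I :: "'s set" and t \<phi>
    by (subst integral_distr[OF \<Psi>])
      (auto intro!: borel_measurable_cis borel_measurable_sum borel_measurable_times coord_measurable simp: coord)
  show thesis
  proof
    show "prob_space (distr R (PiM UNIV (\<lambda>_. borel)) \<Psi>)"
      by (rule prob_space.prob_space_distr[OF R(1) \<Psi>])
    show "sets (distr R (PiM UNIV (\<lambda>_. borel)) \<Psi>) = sets (PiM UNIV (\<lambda>_. borel))"
      by simp
    show "(\<integral>x. cis (\<Sum>s\<in>I. t s * coord (\<phi> s) x) \<partial>distr R (PiM UNIV (\<lambda>_. borel)) \<Psi>)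
        = complex_of_real (exp (- (\<Sum>s\<in>I. \<Sum>s'\<in>I. t s * t s' * cov_kernel p q (\<phi> s) (\<phi> s')) / 2))"
      if "finite I" for I :: "(nat \<times> bool) set" and t \<phi>
      unfolding tr by (rule gaussian_char_reindex[where K = "cov_kernel p q", OF char that])
    show "(\<integral>x. cis (\<Sum>s\<in>I. t s * coord s x) \<partial>distr R (PiM UNIV (\<lambda>_. borel)) \<Psi>)
        = complex_of_real (exp (- (\<Sum>s\<in>I. \<Sum>s'\<in>I. t s * t s' * cov_kernel p q s s') / 2))"
      if "finite I" for I :: "('i \<times> bool) set" and t
      unfolding tr by (rule char[OF that])
  qed
qed

text \<open>Every finite real combination of coordinates is normal by \<open>normal_law\<close>,
  which also gives its variance. Covariances of real coordinates follow by polarization, and the two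
  complex moments by recombining four of them.\<close>

lemma complex_gaussian_process_properties:
  fixes Q :: "('i \<Rightarrow> complex) measure"
  assumes Q: "prob_space Q" "sets Q = sets (PiM UNIV (\<lambda>_. borel))"
    and sym: "\<And>i j. p i j = p j i" "\<And>i j. q i j = cnj (q j i)"
    and psd: "\<And>I t. finite I \<Longrightarrow> 0 \<le> (\<Sum>s\<in>I. \<Sum>s'\<in>I. t s * t s' * cov_kernel p q s s')"
    and char: "\<And>I t. finite I \<Longrightarrow> (\<integral>x. cis (\<Sum>s\<in>I. t s * coord s x) \<partial>Q)
        = complex_of_real (exp (- (\<Sum>s\<in>I. \<Sum>s'\<in>I. t s * t s' * cov_kernel p q s s') / 2))"
  shows "complex_centered_gaussian Q (\<lambda>i x. x i)"
    and "integrable Q (\<lambda>x. (coord s x)\<^sup>2)" and "(\<integral>x. (coord s x)\<^sup>2 \<partial>Q) = cov_kernel p q s s"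
    and "(\<integral>x. x i * x j \<partial>Q) = p i j" and "(\<integral>x. x i * cnj (x j) \<partial>Q) = q i j"
proof -
  have cm: "coord s \<in> borel_measurable Q" for s
    unfolding measurable_cong_sets[OF Q(2) refl] by (rule coord_measurable)
  let ?K = "cov_kernel p q"
  have law: "centered_real_gaussian Q (\<lambda>x. \<Sum>s\<in>I. t s * coord s x)"
    "integrable Q (\<lambda>x. (\<Sum>s\<in>I. t s * coord s x)\<^sup>2)"
    "(\<integral>x. (\<Sum>s\<in>I. t s * coord s x)\<^sup>2 \<partial>Q) = (\<Sum>s\<in>I. \<Sum>s'\<in>I. t s * t s' * ?K s s')"
    if I: "finite I" for I t
  proof -
    let ?v = "\<Sum>s\<in>I. \<Sum>s'\<in>I. t s * t s' * ?K s s'"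
    have m: "(\<lambda>x. \<Sum>s\<in>I. t s * coord s x) \<in> borel_measurable Q"
      by (intro borel_measurable_sum borel_measurable_times cm) auto
    have c: "(\<integral>x. cis (u * (\<Sum>s\<in>I. t s * coord s x)) \<partial>Q) = complex_of_real (exp (- ?v * u\<^sup>2 / 2))" for u
    proof -
      have "(\<integral>x. cis (u * (\<Sum>s\<in>I. t s * coord s x)) \<partial>Q) = (\<integral>x. cis (\<Sum>s\<in>I. (u * t s) * coord s x) \<partial>Q)"
        by (simp add: sum_distrib_left mult.assoc)
      also have "\<dots> = complex_of_real (exp (- (\<Sum>s\<in>I. \<Sum>s'\<in>I. (u * t s) * (u * t s') * ?K s s') / 2))"
        by (rule char[OF I])
      also have "(\<Sum>s\<in>I. \<Sum>s'\<in>I. (u * t s) * (u * t s') * ?K s s') = ?v * u\<^sup>2"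
        unfolding sum_distrib_right by (intro sum.cong refl) (simp add: power2_eq_square)
      finally show ?thesis by simp
    qed
    show "centered_real_gaussian Q (\<lambda>x. \<Sum>s\<in>I. t s * coord s x)"
      "integrable Q (\<lambda>x. (\<Sum>s\<in>I. t s * coord s x)\<^sup>2)"
      "(\<integral>x. (\<Sum>s\<in>I. t s * coord s x)\<^sup>2 \<partial>Q) = ?v"
      using normal_law[OF Q(1) m psd[OF I] c] by blast+
  qed
  show "complex_centered_gaussian Q (\<lambda>i x. x i)"
    unfolding complex_centered_gaussian_def
  proof (intro allI impI)
    fix I :: "'i set" and a b :: "'i \<Rightarrow> real" assume I: "finite I"
    define t where "t s = (if snd s then b (fst s) else a (fst s))" for s :: "'i \<times> bool"
    have "(\<Sum>s\<in>I \<times> UNIV. t s * coord s x) = (\<Sum>i\<in>I. a i * Re (x i) + b i * Im (x i))" for x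
    proof -
      have "(\<Sum>s\<in>I \<times> UNIV. t s * coord s x) = (\<Sum>i\<in>I. \<Sum>c\<in>UNIV. t (i, c) * coord (i, c) x)"
        by (simp add: sum.cartesian_product)
      also have "\<dots> = (\<Sum>i\<in>I. a i * Re (x i) + b i * Im (x i))"
        by (simp add: UNIV_bool t_def)
      finally show ?thesis .
    qed
    then show "centered_real_gaussian Q (\<lambda>x. \<Sum>i\<in>I. a i * Re (x i) + b i * Im (x i))"
      using law(1)[of "I \<times> UNIV" t] I by simp
  qed
  have sq: "integrable Q (\<lambda>x. (coord s x)\<^sup>2)" "(\<integral>x. (coord s x)\<^sup>2 \<partial>Q) = ?K s s" for s
    using law(2,3)[of "{s}" "\<lambda>_. 1"] by simp_all
  show "integrable Q (\<lambda>x. (coord s x)\<^sup>2)" "(\<integral>x. (coord s x)\<^sup>2 \<partial>Q) = cov_kernel p q s s"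
    by (rule sq)+
  have cov: "integrable Q (\<lambda>x. coord s x * coord s' x) \<and> (\<integral>x. coord s x * coord s' x \<partial>Q) = ?K s s'" for s s'
  proof (cases "s = s'")
    case True
    then show ?thesis using sq[of s] by (simp add: power2_eq_square)
  next
    case False
    have i2: "integrable Q (\<lambda>x. (coord s x + coord s' x)\<^sup>2)"
      and v2: "(\<integral>x. (coord s x + coord s' x)\<^sup>2 \<partial>Q) = ?K s s + 2 * ?K s s' + ?K s' s'"
      using law(2,3)[of "{s, s'}" "\<lambda>_. 1"] False kernel_sym[of p q s' s, OF sym] by simp_all
    have eq: "coord s x * coord s' x = ((coord s x + coord s' x)\<^sup>2 - (coord s x)\<^sup>2 - (coord s' x)\<^sup>2) / 2" for x
      by (simp add: power2_eq_square algebra_simps)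
    show ?thesis
      unfolding eq using i2 v2 sq[of s] sq[of s'] by simp
  qed
  have ci: "integrable Q (\<lambda>x. coord s x * coord s' x)" "(\<integral>x. coord s x * coord s' x \<partial>Q) = ?K s s'" for s s'
    using cov[of s s'] by blast+
  define r where "r a b x = coord (i, a) x * coord (j, b) x" for a b x
  have r: "integrable Q (r a b)" "(\<integral>x. r a b x \<partial>Q) = ?K (i, a) (j, b)" for a b
    unfolding r_def using ci by auto
  have x1: "x i * x j = of_real (r False False x - r True True x) + \<i> * of_real (r False True x + r True False x)" for x
    by (simp add: r_def complex_eq_iff)
  have x2: "x i * cnj (x j) = of_real (r False False x + r True True x) + \<i> * of_real (r True False x - r False True x)" for x
    by (simp add: r_def complex_eq_iff)
  have "(\<integral>x. x i * x j \<partial>Q) = of_real (?K (i, False) (j, False) - ?K (i, True) (j, True))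
      + \<i> * of_real (?K (i, False) (j, True) + ?K (i, True) (j, False))"
    unfolding x1 using r by simp
  also have "\<dots> = p i j"
    by (simp add: cov_kernel_def re_im_def complex_eq_iff field_simps)
  finally show "(\<integral>x. x i * x j \<partial>Q) = p i j" .
  have "(\<integral>x. x i * cnj (x j) \<partial>Q) = of_real (?K (i, False) (j, False) + ?K (i, True) (j, True))
      + \<i> * of_real (?K (i, True) (j, False) - ?K (i, False) (j, True))"
    unfolding x2 using r by simp
  also have "\<dots> = q i j"
    by (simp add: cov_kernel_def re_im_def complex_eq_iff field_simps)
  finally show "(\<integral>x. x i * cnj (x j) \<partial>Q) = q i j" .
qed

text \<open>The m complex coordinates are read as 2m real ones indexed by
  \<open>nat \<times> bool\<close>, a countable type even when \<open>'i\<close> is not, so that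
  \<open>char_convergence_laws\<close> applies to the laws of these coordinates.\<close>

lemma fdd_convergesI:
  fixes X :: "nat \<Rightarrow> 'i \<Rightarrow> 'a \<Rightarrow> complex" and Q :: "('i \<Rightarrow> complex) measure"
  assumes P: "\<And>N. prob_space (P N)" and X: "\<And>N i. X N i \<in> borel_measurable (P N)"
    and Q: "prob_space Q" "sets Q = sets (PiM UNIV (\<lambda>_. borel))"
    and mom: "\<And>i. \<exists>B. \<forall>N. integrable (P N) (\<lambda>\<omega>. (cmod (X N i \<omega>))\<^sup>2) \<and> (\<integral>\<omega>. (cmod (X N i \<omega>))\<^sup>2 \<partial>P N) \<le> B"
    and momQ: "\<And>s. integrable Q (\<lambda>x. (coord s x)\<^sup>2)"
    and char: "\<And>(I :: (nat \<times> bool) set) t \<phi>. finite I \<Longrightarrow>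
       (\<lambda>N. \<integral>\<omega>. cis (\<Sum>s\<in>I. t s * coord (\<phi> s) (\<lambda>i. X N i \<omega>)) \<partial>P N) \<longlonglongrightarrow> (\<integral>x. cis (\<Sum>s\<in>I. t s * coord (\<phi> s) x) \<partial>Q)"
  shows "fdd_converges P X Q (\<lambda>i x. x i)"
  unfolding fdd_converges_def
proof (intro allI impI)
  fix m :: nat and idx :: "nat \<Rightarrow> 'i" and f :: "(nat \<Rightarrow> complex) \<Rightarrow> real"
  assume f: "continuous_on UNIV f" "bounded (range f)"
  let ?B = "PiM UNIV (\<lambda>_. borel) :: (nat \<times> bool \<Rightarrow> real) measure"
  define I where "I = {..<m} \<times> (UNIV :: bool set)"
  have I: "finite I" by (simp add: I_def)
  define \<phi> where "\<phi> s = (idx (fst s), snd s)" for s :: "nat \<times> bool"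
  define h where "h y = f (\<lambda>i. complex_of_real (y (i, False)) + \<i> * complex_of_real (y (i, True)))" for y :: "nat \<times> bool \<Rightarrow> real"
  have h: "continuous_on UNIV h"
    unfolding h_def
    by (rule continuous_on_compose2[OF f(1)])
      (auto intro!: continuous_on_coordinatewise_then_product continuous_intros continuous_on_product_coordinates)
  have hb: "bounded (range h)"
    by (rule bounded_subset[OF f(2)]) (auto simp: h_def)
  define Y where "Y N \<omega> = (\<lambda>s. coord (\<phi> s) (\<lambda>i. X N i \<omega>))" for N \<omega>
  define Z where "Z x = (\<lambda>s. coord (\<phi> s) x)" for x
  have Y: "Y N \<in> measurable (P N) ?B" for N
    unfolding Y_def coord_def
  proof (rule measurable_PiM_single')
    show "(\<lambda>\<omega>. Re (re_im (snd (\<phi> s)) * X N (fst (\<phi> s)) \<omega>)) \<in> borel_measurable (P N)" for s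
      using X[of N "fst (\<phi> s)"] by measurable
  qed auto
  have Z: "Z \<in> measurable Q ?B"
    unfolding Z_def
    by (rule measurable_PiM_single') (auto intro: coord_measurable simp: measurable_cong_sets[OF Q(2) refl])
  have sqm: "(\<lambda>y. (y s)\<^sup>2) \<in> borel_measurable ?B" for s
    by (intro borel_measurable_power measurable_component_singleton) simp
  have cism: "(\<lambda>y. cis (\<Sum>s\<in>I. t s * y s)) \<in> borel_measurable ?B" for t
    by (intro borel_measurable_cis borel_measurable_sum borel_measurable_times measurable_component_singleton) auto
  obtain B where B: "\<And>i N. integrable (P N) (\<lambda>\<omega>. (cmod (X N i \<omega>))\<^sup>2)" "\<And>i N. (\<integral>\<omega>. (cmod (X N i \<omega>))\<^sup>2 \<partial>P N) \<le> B i"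
    using mom by metis
  have cle: "(coord s x)\<^sup>2 \<le> (cmod (x (fst s)))\<^sup>2" for s and x :: "'i \<Rightarrow> complex"
  proof -
    have "\<bar>coord s x\<bar> \<le> cmod (x (fst s))"
      unfolding coord_def by (rule order_trans[OF abs_Re_le_cmod]) (simp add: re_im_def norm_mult)
    then show ?thesis
      using power_mono[of "\<bar>coord s x\<bar>" "cmod (x (fst s))" 2] by simp
  qed
  have YB: "integrable (P N) (\<lambda>\<omega>. (Y N \<omega> s)\<^sup>2)" "(\<integral>\<omega>. (Y N \<omega> s)\<^sup>2 \<partial>P N) \<le> B (fst (\<phi> s))" for N s
  proof -
    have m: "(\<lambda>\<omega>. (Y N \<omega> s)\<^sup>2) \<in> borel_measurable (P N)"
      using measurable_compose[OF Y sqm] .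
    show i: "integrable (P N) (\<lambda>\<omega>. (Y N \<omega> s)\<^sup>2)"
      by (rule Bochner_Integration.integrable_bound[OF B(1)[of N "fst (\<phi> s)"] m])
        (use cle[of "\<phi> s"] in \<open>auto simp: Y_def\<close>)
    have "(\<integral>\<omega>. (Y N \<omega> s)\<^sup>2 \<partial>P N) \<le> (\<integral>\<omega>. (cmod (X N (fst (\<phi> s)) \<omega>))\<^sup>2 \<partial>P N)"
      by (intro integral_mono i B) (use cle[of "\<phi> s"] in \<open>auto simp: Y_def\<close>)
    then show "(\<integral>\<omega>. (Y N \<omega> s)\<^sup>2 \<partial>P N) \<le> B (fst (\<phi> s))"
      using B(2)[of N "fst (\<phi> s)"] by linarith
  qed
  \<comment> \<open>One constant is needed for all coordinates and for both the approximating laws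
    and the limit; the finite sum dominates each of them.\<close>
  define C where "C = (\<Sum>s\<in>I. \<bar>B (fst (\<phi> s))\<bar> + (\<integral>x. (Z x s)\<^sup>2 \<partial>Q))"
  have C: "\<bar>B (fst (\<phi> s))\<bar> + (\<integral>x. (Z x s)\<^sup>2 \<partial>Q) \<le> C" if "s \<in> I" for s
    unfolding C_def by (rule member_le_sum[OF that]) (use I in \<open>auto intro!: add_nonneg_nonneg integral_nonneg\<close>)
  have C': "B (fst (\<phi> s)) \<le> C" "(\<integral>x. (Z x s)\<^sup>2 \<partial>Q) \<le> C" if "s \<in> I" for s
  proof -
    have "0 \<le> (\<integral>x. (Z x s)\<^sup>2 \<partial>Q)" by (simp add: integral_nonneg)
    then show "B (fst (\<phi> s)) \<le> C" "(\<integral>x. (Z x s)\<^sup>2 \<partial>Q) \<le> C"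
      using C[OF that] by linarith+
  qed
  have "(\<lambda>N. \<integral>y. h (\<lambda>s. if s \<in> I then y s else 0) \<partial>distr (P N) ?B (Y N))
     \<longlonglongrightarrow> (\<integral>y. h (\<lambda>s. if s \<in> I then y s else 0) \<partial>distr Q ?B Z)"
  proof (rule char_convergence_laws[OF I _ _ _ _ _ _ _ _ _ h hb, where C = C])
    show "prob_space (distr (P N) ?B (Y N))" for N
      by (rule prob_space.prob_space_distr[OF P Y])
    show "prob_space (distr Q ?B Z)"
      by (rule prob_space.prob_space_distr[OF Q(1) Z])
    show "integrable (distr (P N) ?B (Y N)) (\<lambda>y. (y s)\<^sup>2)" for N s
      by (subst integrable_distr_eq[OF Y sqm]) (rule YB)
    show "integrable (distr Q ?B Z) (\<lambda>y. (y s)\<^sup>2)" for s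
      by (subst integrable_distr_eq[OF Z sqm]) (simp add: Z_def momQ)
    show "(\<integral>y. (y s)\<^sup>2 \<partial>distr (P N) ?B (Y N)) \<le> C" if "s \<in> I" for N s
      unfolding integral_distr[OF Y sqm] using YB(2)[of N s] C'(1)[OF that] by linarith
    show "(\<integral>y. (y s)\<^sup>2 \<partial>distr Q ?B Z) \<le> C" if "s \<in> I" for s
      unfolding integral_distr[OF Z sqm] by (rule C'(2)[OF that])
    show "(\<lambda>N. \<integral>y. cis (\<Sum>s\<in>I. t s * y s) \<partial>distr (P N) ?B (Y N)) \<longlonglongrightarrow> (\<integral>y. cis (\<Sum>s\<in>I. t s * y s) \<partial>distr Q ?B Z)" for t
      unfolding integral_distr[OF Y cism] integral_distr[OF Z cism] unfolding Y_def Z_def by (rule char[OF I])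
  qed simp_all
  moreover have hm: "(\<lambda>y. h (\<lambda>s. if s \<in> I then y s else 0)) \<in> borel_measurable ?B"
  proof (rule measurable_compose[where g = h and N = ?B])
    show "(\<lambda>y s. if s \<in> I then y s else 0) \<in> measurable ?B ?B"
      by (rule measurable_PiM_single') auto
    show "h \<in> borel_measurable ?B"
      using borel_measurable_continuous_onI[OF h] by (simp add: measurable_cong_sets[OF sets_PiM_equal_borel refl])
  qed
  moreover have "h (\<lambda>s. if s \<in> I then coord (\<phi> s) x else 0) = f (\<lambda>i. if i < m then x (idx i) else 0)" for x
    unfolding h_def by (intro arg_cong[of _ _ f]) (auto simp: I_def \<phi>_def complex_eq_iff)
  ultimately show "(\<lambda>N. \<integral>\<omega>. f (\<lambda>i. if i < m then X N (idx i) \<omega> else 0) \<partial>P N)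
          \<longlonglongrightarrow> (\<integral>x. f (\<lambda>i. if i < m then x (idx i) else 0) \<partial>Q)"
    unfolding integral_distr[OF Y hm] integral_distr[OF Z hm] Y_def Z_def by simp
qed

section \<open>Limits in mean and passage from the random matrices to their law\<close>

lemma L2_limit_imp_L1_limit:
  fixes G :: "nat \<Rightarrow> 'a \<Rightarrow> complex"
  assumes P: "\<And>N. prob_space (P N)" and G: "\<And>N. G N \<in> borel_measurable (P N)"
    and L2: "(\<lambda>N. \<integral>\<^sup>+\<omega>. ennreal ((cmod (G N \<omega>))\<^sup>2) \<partial>P N) \<longlonglongrightarrow> 0"
  shows "(\<lambda>N. \<integral>\<omega>. cmod (G N \<omega>) \<partial>P N) \<longlonglongrightarrow> 0"
proof (rule LIMSEQ_I)
  fix r :: real assume r: "0 < r"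
  define \<delta> where "\<delta> = r / 2"
  have \<delta>: "0 < \<delta>" using r by (simp add: \<delta>_def)
  \<comment> \<open>The hypothesis is about extended nonnegative integrals, so square integrability
    is known only from some index on and is extracted together with smallness.\<close>
  have "eventually (\<lambda>N. (\<integral>\<^sup>+\<omega>. ennreal ((cmod (G N \<omega>))\<^sup>2) \<partial>P N) < ennreal (\<delta>\<^sup>2)) sequentially"
    by (rule order_tendstoD(2)[OF L2]) (use \<delta> in simp)
  then obtain n0 where n0: "\<And>N. N \<ge> n0 \<Longrightarrow> (\<integral>\<^sup>+\<omega>. ennreal ((cmod (G N \<omega>))\<^sup>2) \<partial>P N) < ennreal (\<delta>\<^sup>2)"
    by (auto simp: eventually_sequentially)
  show "\<exists>n0. \<forall>N\<ge>n0. norm ((\<integral>\<omega>. cmod (G N \<omega>) \<partial>P N) - 0) < r"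
  proof (intro exI[of _ n0] allI impI)
    fix N assume "n0 \<le> N"
    note b = n0[OF this]
    interpret prob_space "P N" by (rule P)
    note [measurable] = G[of N]
    have i2: "integrable (P N) (\<lambda>\<omega>. (cmod (G N \<omega>))\<^sup>2)"
      using b by (intro integrableI_bounded) (auto intro: order_less_trans simp: less_top[symmetric])
    have v2: "(\<integral>\<omega>. (cmod (G N \<omega>))\<^sup>2 \<partial>P N) \<le> \<delta>\<^sup>2"
      by (rule integral_real_bounded) (use b in auto)
    \<comment> \<open>Arithmetic-geometric inequality weighted by \<open>\<delta>\<close>;
      integrated, it bounds the first moment by \<open>\<delta>\<close> once the second is at most
      its square.\<close>
    have pw: "cmod (G N \<omega>) \<le> (\<delta> + (cmod (G N \<omega>))\<^sup>2 / \<delta>) / 2" for \<omega>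
      using sum_squares_bound[of "cmod (G N \<omega>)" \<delta>] \<delta> by (simp add: field_simps power2_eq_square)
    have i1: "integrable (P N) (\<lambda>\<omega>. cmod (G N \<omega>))"
      by (rule Bochner_Integration.integrable_bound[of _ "\<lambda>\<omega>. (\<delta> + (cmod (G N \<omega>))\<^sup>2 / \<delta>) / 2"])
        (use i2 pw in \<open>auto intro!: AE_I2 intro: order_trans[OF _ abs_ge_self]\<close>)
    have "(\<integral>\<omega>. cmod (G N \<omega>) \<partial>P N) \<le> (\<integral>\<omega>. (\<delta> + (cmod (G N \<omega>))\<^sup>2 / \<delta>) / 2 \<partial>P N)"
      by (intro integral_mono i1 pw) (use i2 in auto)
    also have "\<dots> = (\<delta> + (\<integral>\<omega>. (cmod (G N \<omega>))\<^sup>2 \<partial>P N) / \<delta>) / 2"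
      using i2 by (simp add: prob_space)
    also have "\<dots> \<le> (\<delta> + \<delta>\<^sup>2 / \<delta>) / 2"
      using v2 \<delta> by (intro divide_right_mono add_left_mono) auto
    also have "\<dots> < r"
      using r by (simp add: \<delta>_def power2_eq_square)
    finally show "norm ((\<integral>\<omega>. cmod (G N \<omega>) \<partial>P N) - 0) < r"
      by (simp add: abs_of_nonneg)
  qed
qed

text \<open>Serves to derive the symmetry of \<open>tau\<close> and the Hermitian symmetry of
  \<open>taubar\<close>, which the covariance kernel requires and which the convergence assumptions
  contain only implicitly.\<close>

lemma L1_limit_unique:
  fixes X :: "nat \<Rightarrow> 'a \<Rightarrow> complex"
  assumes P: "\<And>N. prob_space (P N)" and X: "\<And>N. 0 < N \<Longrightarrow> integrable (P N) (X N)"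
    and s: "(\<lambda>N. \<integral>\<omega>. cmod (X N \<omega> - s) \<partial>P N) \<longlonglongrightarrow> 0"
    and t: "(\<lambda>N. \<integral>\<omega>. cmod (X N \<omega> - t) \<partial>P N) \<longlonglongrightarrow> 0"
  shows "s = t"
proof -
  have "(\<lambda>N. (\<integral>\<omega>. cmod (X N \<omega> - s) \<partial>P N) + (\<integral>\<omega>. cmod (X N \<omega> - t) \<partial>P N)) \<longlonglongrightarrow> 0 + 0"
    by (intro tendsto_add s t)
  moreover have "cmod (s - t) \<le> (\<integral>\<omega>. cmod (X N \<omega> - s) \<partial>P N) + (\<integral>\<omega>. cmod (X N \<omega> - t) \<partial>P N)" if "0 < N" for N
  proof -
    interpret prob_space "P N" by (rule P)
    have i: "integrable (P N) (\<lambda>\<omega>. cmod (X N \<omega> - u))" for u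
      using X[OF that] by auto
    have "cmod (s - t) = (\<integral>\<omega>. cmod (s - t) \<partial>P N)"
      by (simp add: prob_space)
    also have "\<dots> \<le> (\<integral>\<omega>. cmod (X N \<omega> - s) + cmod (X N \<omega> - t) \<partial>P N)"
    proof (rule integral_mono)
      fix \<omega>
      show "cmod (s - t) \<le> cmod (X N \<omega> - s) + cmod (X N \<omega> - t)"
        using norm_triangle_ineq4[of "X N \<omega> - t" "X N \<omega> - s"] by simp
    qed (use i in auto)
    finally show ?thesis using i by simp
  qed
  ultimately have "cmod (s - t) \<le> 0 + 0"
    by (intro LIMSEQ_le_const) (auto intro!: exI[of _ 1])
  then show ?thesis by simp
qed

text \<open>The assumption is the trace bound with p = 2 and q = 1, written with
  \<open>powr 1\<close> to match it literally. The trace of the square of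
  \<open>mmult N A (madj A)\<close> is the squared norm of
  \<open>mmult N (madj A) A\<close>.\<close>

lemma fourth_moment_le:
  fixes A :: "'a \<Rightarrow> cmat"
  assumes meas: "\<And>i j. (\<lambda>\<omega>. A \<omega> i j) \<in> borel_measurable P" and C: "0 \<le> C"
    and b: "(\<integral>\<^sup>+\<omega>. ennreal (cmod (mtrace N (mpow N (mmult N (A \<omega>) (madj (A \<omega>))) 2) / of_nat N) powr 1) \<partial>P) \<le> ennreal C"
  shows "(\<integral>\<omega>. fro N (mmult N (madj (A \<omega>)) (A \<omega>)) \<partial>P) \<le> C * real N"
proof (cases "N = 0")
  case False
  define F where "F \<omega> = fro N (mmult N (madj (A \<omega>)) (A \<omega>))" for \<omega>
  note [measurable] = meas
  have "(\<lambda>\<omega>. madj (A \<omega>) i j) \<in> borel_measurable P" for i j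
    unfolding madj_def by (rule borel_measurable_continuous_on[where f = cnj]) (auto intro: continuous_intros)
  note [measurable] = this
  have Fm: "F \<in> borel_measurable P"
    unfolding F_def fro_def mmult_def by measurable
  have tr: "mtrace N (mpow N (mmult N B (madj B)) 2) = of_real (fro N (mmult N (madj B) B))" for B
  proof -
    let ?B = "mmult N B (madj B)"
    have "mtrace N (mpow N ?B 2) = mtrace N (mmult N ?B (mmult N ?B mid))"
      by (simp add: numeral_2_eq_2)
    also have "\<dots> = mtrace N (mmult N ?B ?B)"
      by (intro mtrace_cong mmult_cong mmult_mid_right) auto
    also have "\<dots> = mtrace N (mmult N ?B (madj ?B))"
      by (simp add: madj_mmult)
    also have "\<dots> = of_real (fro N (mmult N (madj B) B))"
      by (simp only: fro_eq_mtrace[symmetric] fro_madj_commute)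
    finally show ?thesis .
  qed
  have "(\<integral>\<omega>. F \<omega> / real N \<partial>P) \<le> C"
  proof (rule integral_real_bounded)
    have "(\<integral>\<^sup>+\<omega>. ennreal (F \<omega> / real N) \<partial>P)
      = (\<integral>\<^sup>+\<omega>. ennreal (cmod (mtrace N (mpow N (mmult N (A \<omega>) (madj (A \<omega>))) 2) / of_nat N) powr 1) \<partial>P)"
      unfolding tr by (intro nn_integral_cong) (simp add: F_def norm_divide)
    with b show "(\<integral>\<^sup>+\<omega>. ennreal (F \<omega> / real N) \<partial>P) \<le> ennreal C" by simp
  qed (rule C)
  then have "(\<integral>\<omega>. F \<omega> \<partial>P) / real N \<le> C"
    by simp
  then show ?thesis
    using False by (simp add: F_def field_simps)
qed (simp add: fro_def)

theorem theorem2p2: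
  fixes P :: "nat \<Rightarrow> 'a measure"
    and A :: "nat \<Rightarrow> 'k \<Rightarrow> 'a \<Rightarrow> cmat"
    and Mt :: "nat \<Rightarrow> 'l \<Rightarrow> cmat"
    and tau taubar :: "'k \<Rightarrow> 'k \<Rightarrow> complex"
    and eta beta :: "'l \<Rightarrow> 'l \<Rightarrow> complex"
  assumes prob: "\<And>N. prob_space (P N)"
    and meas: "\<And>N k i j. (\<lambda>\<omega>. A N k \<omega> i j) \<in> borel_measurable (P N)"
    and a_inv: "\<And>N U. unitary_mat N U \<Longrightarrow>
        joint_law (P N) N (A N)
          = joint_law (P N) N (\<lambda>k \<omega>. mmult N (mmult N U (A N k \<omega>)) (madj U))"
    and b_bdd: "\<And>k (p::nat) (q::real). p \<ge> 1 \<Longrightarrow> q \<ge> 1 \<Longrightarrow>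
        \<exists>C. \<forall>N. (\<integral>\<^sup>+\<omega>. ennreal (cmod (mtrace N (mpow N (mmult N (A N k \<omega>) (madj (A N k \<omega>))) p) / of_nat N) powr q) \<partial>P N) \<le> ennreal C"
    and c1: "\<And>k k'. (\<lambda>N. \<integral>\<^sup>+\<omega>. ennreal ((cmod (
            mtrace N (mmult N (A N k \<omega>) (A N k' \<omega>)) / of_nat N
            - (mtrace N (A N k \<omega>) / of_nat N) * (mtrace N (A N k' \<omega>) / of_nat N)
            - tau k k'))\<^sup>2) \<partial>P N) \<longlonglongrightarrow> 0"
    and c2: "\<And>k k'. (\<lambda>N. \<integral>\<^sup>+\<omega>. ennreal ((cmod (
            mtrace N (mmult N (A N k \<omega>) (madj (A N k' \<omega>))) / of_nat N
            - (mtrace N (A N k \<omega>) / of_nat N) * (mtrace N (madj (A N k' \<omega>)) / of_nat N)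
            - taubar k k'))\<^sup>2) \<partial>P N) \<longlonglongrightarrow> 0"
    and d1: "\<And>l l'. (\<lambda>N. mtrace N (mmult N (Mt N l) (Mt N l')) / of_nat N
            - (mtrace N (Mt N l) / of_nat N) * (mtrace N (Mt N l') / of_nat N)) \<longlonglongrightarrow> eta l l'"
    and d2: "\<And>l l'. (\<lambda>N. mtrace N (mmult N (Mt N l) (madj (Mt N l'))) / of_nat N
            - (mtrace N (Mt N l) / of_nat N) * (mtrace N (madj (Mt N l')) / of_nat N)) \<longlonglongrightarrow> beta l l'"
    and trace0: "\<And>N l. mtrace N (Mt N l) = 0"
  shows "\<exists>Q :: ('k \<times> 'l \<Rightarrow> complex) measure.
           prob_space Q \<and> sets Q = sets (PiM UNIV (\<lambda>_. borel))
         \<and> complex_centered_gaussian Q (\<lambda>kl x. x kl)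
         \<and> (\<forall>k l k' l'.
              (\<integral>x. x (k, l) * x (k', l') \<partial>Q) = eta l l' * tau k k'
            \<and> (\<integral>x. x (k, l) * cnj (x (k', l')) \<partial>Q) = beta l l' * taubar k k')
         \<and> fdd_converges P (\<lambda>N (k, l) \<omega>. mtrace N (mmult N (A N k \<omega>) (Mt N l))) Q (\<lambda>kl x. x kl)"
proof -
  define \<mu> where "\<mu> N = joint_law (P N) N (A N)" for N
  let ?C = "\<lambda>N k x. center N (slice k x)"
  have em: "embed N (A N) \<in> measurable (P N) (PiM UNIV (\<lambda>_. borel))" for N
    by (rule embed_measurable[OF meas])
  have U: "unitary_invariant N (\<mu> N)" for N
    unfolding \<mu>_def
  proof (rule unitary_invariant_joint_law[OF prob meas a_inv])
    fix k i j n assume ij: "i < N" "j < N"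
    show "integrable (P N) (\<lambda>\<omega>. cmod (A N k \<omega> i j) ^ n)"
    proof (rule entry_moments[OF prob meas _ ij])
      fix q :: real assume "1 \<le> q"
      then have "\<exists>C. \<forall>N. (\<integral>\<^sup>+\<omega>. ennreal (cmod (mtrace N (mpow N (mmult N (A N k \<omega>) (madj (A N k \<omega>))) 1) / of_nat N) powr q) \<partial>P N) \<le> ennreal C"
        by (rule b_bdd[OF order_refl])
      then obtain C where C: "\<And>N. (\<integral>\<^sup>+\<omega>. ennreal (cmod (mtrace N (mpow N (mmult N (A N k \<omega>) (madj (A N k \<omega>))) 1) / of_nat N) powr q) \<partial>P N) \<le> ennreal C"
        by blast
      show "(\<integral>\<^sup>+\<omega>. ennreal (cmod (mtrace N (mpow N (mmult N (A N k \<omega>) (madj (A N k \<omega>))) 1) / of_nat N) powr q) \<partial>P N) < \<infinity>"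
        using le_less_trans[OF C ennreal_less_top] by simp
    qed
  qed
  have transfer: "(\<integral>x. F x \<partial>\<mu> N) = (\<integral>\<omega>. F (embed N (A N) \<omega>) \<partial>P N)"
    if "F \<in> borel_measurable (\<mu> N)" for F :: "_ \<Rightarrow> 'z::{banach, second_countable_topology}" and N
    using that unfolding \<mu>_def joint_law_eq_embed by (intro integral_distr em) simp
  have entry: "(\<lambda>x. slice k x i j) \<in> borel_measurable (\<mu> N)" for k i j N
    unfolding slice_def \<mu>_def joint_law_eq_embed
    by (simp add: measurable_component_singleton)
  have centry: "(\<lambda>x. center N (slice k x) i j) \<in> borel_measurable (\<mu> N)" for k i j N
  proof -
    note [measurable] = entry
    show ?thesis unfolding center_def mtrace_def by measurable
  qed
  have cnjm: "(\<lambda>x. cnj (f x)) \<in> borel_measurable M" if "f \<in> borel_measurable M" for f and M :: "'y measure"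
    by (rule borel_measurable_continuous_on[where f = cnj, OF _ that]) (auto intro: continuous_intros)
  have mm: "(\<lambda>x. mmult N (B x) (B' x) i j) \<in> borel_measurable M"
    if "\<And>i j. (\<lambda>x. B x i j) \<in> borel_measurable M" "\<And>i j. (\<lambda>x. B' x i j) \<in> borel_measurable M"
    for B B' i j N and M :: "'y measure"
    unfolding mmult_def using that by (intro borel_measurable_sum borel_measurable_times)
  have trm: "(\<lambda>x. mtrace N (B x)) \<in> borel_measurable M"
    if "\<And>i j. (\<lambda>x. B x i j) \<in> borel_measurable M" for B N and M :: "'y measure"
    unfolding mtrace_def using that by (intro borel_measurable_sum)
  have adm: "(\<lambda>x. madj (B x) i j) \<in> borel_measurable M"
    if "\<And>i j. (\<lambda>x. B x i j) \<in> borel_measurable M" for B i j and M :: "'y measure"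
    unfolding madj_def by (rule cnjm[OF that])
  have trslice: "mtrace N (slice k (embed N (A N) \<omega>)) = mtrace N (A N k \<omega>)" for N k \<omega>
    by (intro mtrace_cong slice_embed)
  \<comment> \<open>Divided by N this is exactly the expression in the convergence assumptions:
    subtracting the product of normalised traces amounts to centering the matrices.\<close>
  have trcc: "mtrace N (mmult N (center N B) (center N B')) = mtrace N (mmult N B B') - mtrace N B * mtrace N B' / of_nat N" for N B B'
  proof -
    have "mtrace N (mmult N (center N B) (center N B')) = mtrace N (mmult N B (center N B'))"
      unfolding mtrace_center_mmult mtrace_center by simp
    also have "\<dots> = mtrace N (mmult N (center N B') B)"
      by (rule mtrace_commute)
    finally show ?thesis
      unfolding mtrace_center_mmult by (simp add: mtrace_commute[of N B' B])
  qed
  have a: "\<exists>a\<ge>0. \<forall>N. (\<integral>x. fro N (mmult N (madj (?C N k x)) (?C N k x)) \<partial>\<mu> N) \<le> a * real N" for k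
  proof -
    obtain C where C: "\<And>N. (\<integral>\<^sup>+\<omega>. ennreal (cmod (mtrace N (mpow N (mmult N (A N k \<omega>) (madj (A N k \<omega>))) 2) / of_nat N) powr 1) \<partial>P N) \<le> ennreal C"
      using b_bdd[of 2 1 k] by auto
    \<comment> \<open>\<open>ennreal\<close> truncates negative reals, so the constant may be
      replaced by its positive part, which provides the nonnegativity demanded by
      \<open>fourth_moment_le\<close>.\<close>
    have C': "(\<integral>\<^sup>+\<omega>. ennreal (cmod (mtrace N (mpow N (mmult N (A N k \<omega>) (madj (A N k \<omega>))) 2) / of_nat N) powr 1) \<partial>P N) \<le> ennreal (max C 0)" for N
      by (rule order_trans[OF C]) (simp add: ennreal_leI)
    have "(\<integral>x. fro N (mmult N (madj (?C N k x)) (?C N k x)) \<partial>\<mu> N) \<le> (16 * max C 0) * real N" for N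
    proof (cases "N = 0")
      case False
      then have N: "0 < N" by simp
      interpret unitary_invariant N "\<mu> N" by (rule U)
      have cov: "covariant (slice k)"
        unfolding slice_def[abs_def] by (rule covariant_entry)
      note mg = covariant_mgood[OF cov] covariant_mgood[OF covariant_center[OF cov]]
      have int: "integrable (\<mu> N) (\<lambda>x. fro N (mmult N (madj (?C N k x)) (?C N k x)))"
        "integrable (\<mu> N) (\<lambda>x. fro N (mmult N (madj (slice k x)) (slice k x)))"
        by (intro rgood_integrable[OF _ N] rgood_fro mgood_mmult mgood_madj mg)+
      have "(\<integral>x. fro N (mmult N (madj (?C N k x)) (?C N k x)) \<partial>\<mu> N)
        \<le> (\<integral>x. 16 * fro N (mmult N (madj (slice k x)) (slice k x)) \<partial>\<mu> N)"
        by (intro integral_mono fro_center_square_le) (use int in auto)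
      also have "\<dots> = 16 * (\<integral>x. fro N (mmult N (madj (slice k x)) (slice k x)) \<partial>\<mu> N)"
        by simp
      also have "(\<integral>x. fro N (mmult N (madj (slice k x)) (slice k x)) \<partial>\<mu> N)
        = (\<integral>\<omega>. fro N (mmult N (madj (slice k (embed N (A N) \<omega>))) (slice k (embed N (A N) \<omega>))) \<partial>P N)"
        by (rule transfer[OF borel_measurable_integrable[OF int(2)]])
      also have "\<dots> = (\<integral>\<omega>. fro N (mmult N (madj (A N k \<omega>)) (A N k \<omega>)) \<partial>P N)"
        by (intro Bochner_Integration.integral_cong refl fro_cong mmult_cong) (auto simp: slice_embed madj_def)
      also have "\<dots> \<le> max C 0 * real N"
        by (rule fourth_moment_le[OF meas _ C']) simp
      finally show ?thesis by simp
    qed (simp add: fro_def)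
    then show ?thesis by (intro exI[of _ "16 * max C 0"]) auto
  qed
  have c1': "(\<lambda>N. \<integral>x. cmod (mtrace N (mmult N (?C N k x) (?C N k' x)) / of_nat N - tau k k') \<partial>\<mu> N) \<longlonglongrightarrow> 0" for k k'
  proof -
    let ?G = "\<lambda>N \<omega>. mtrace N (mmult N (A N k \<omega>) (A N k' \<omega>)) / of_nat N
            - (mtrace N (A N k \<omega>) / of_nat N) * (mtrace N (A N k' \<omega>) / of_nat N) - tau k k'"
    have m: "?G N \<in> borel_measurable (P N)" for N
      unfolding divide_inverse by (intro borel_measurable_diff borel_measurable_times borel_measurable_const trm mm meas)
    have "(\<integral>x. cmod (mtrace N (mmult N (?C N k x) (?C N k' x)) / of_nat N - tau k k') \<partial>\<mu> N) = (\<integral>\<omega>. cmod (?G N \<omega>) \<partial>P N)" for N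
    proof -
      have "(\<integral>x. cmod (mtrace N (mmult N (?C N k x) (?C N k' x)) / of_nat N - tau k k') \<partial>\<mu> N)
        = (\<integral>\<omega>. cmod (mtrace N (mmult N (?C N k (embed N (A N) \<omega>)) (?C N k' (embed N (A N) \<omega>))) / of_nat N - tau k k') \<partial>P N)"
      proof (rule transfer)
        have "(\<lambda>x. mtrace N (mmult N (?C N k x) (?C N k' x))) \<in> borel_measurable (\<mu> N)"
          by (intro trm mm centry)
        then show "(\<lambda>x. cmod (mtrace N (mmult N (?C N k x) (?C N k' x)) / of_nat N - tau k k')) \<in> borel_measurable (\<mu> N)"
          by measurable
      qed
      moreover have "mtrace N (mmult N (slice k (embed N (A N) \<omega>)) (slice k' (embed N (A N) \<omega>))) = mtrace N (mmult N (A N k \<omega>) (A N k' \<omega>))" for \<omega>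
        by (intro mtrace_cong mmult_cong slice_embed)
      ultimately show ?thesis
        unfolding trcc trslice by (simp add: diff_divide_distrib)
    qed
    then show ?thesis
      using L2_limit_imp_L1_limit[OF prob m c1] by simp
  qed
  have c2': "(\<lambda>N. \<integral>x. cmod (mtrace N (mmult N (?C N k x) (madj (?C N k' x))) / of_nat N - taubar k k') \<partial>\<mu> N) \<longlonglongrightarrow> 0" for k k'
  proof -
    let ?G = "\<lambda>N \<omega>. mtrace N (mmult N (A N k \<omega>) (madj (A N k' \<omega>))) / of_nat N
            - (mtrace N (A N k \<omega>) / of_nat N) * (mtrace N (madj (A N k' \<omega>)) / of_nat N) - taubar k k'"
    have m: "?G N \<in> borel_measurable (P N)" for N
      unfolding divide_inverse by (intro borel_measurable_diff borel_measurable_times borel_measurable_const trm mm adm meas)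
    have "(\<integral>x. cmod (mtrace N (mmult N (?C N k x) (madj (?C N k' x))) / of_nat N - taubar k k') \<partial>\<mu> N) = (\<integral>\<omega>. cmod (?G N \<omega>) \<partial>P N)" for N
    proof -
      have "(\<integral>x. cmod (mtrace N (mmult N (?C N k x) (madj (?C N k' x))) / of_nat N - taubar k k') \<partial>\<mu> N)
        = (\<integral>\<omega>. cmod (mtrace N (mmult N (?C N k (embed N (A N) \<omega>)) (madj (?C N k' (embed N (A N) \<omega>)))) / of_nat N - taubar k k') \<partial>P N)"
      proof (rule transfer)
        have "(\<lambda>x. mtrace N (mmult N (?C N k x) (madj (?C N k' x)))) \<in> borel_measurable (\<mu> N)"
          by (intro trm mm adm centry)
        then show "(\<lambda>x. cmod (mtrace N (mmult N (?C N k x) (madj (?C N k' x))) / of_nat N - taubar k k')) \<in> borel_measurable (\<mu> N)"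
          by measurable
      qed
      moreover have "mtrace N (mmult N (slice k (embed N (A N) \<omega>)) (madj (slice k' (embed N (A N) \<omega>)))) = mtrace N (mmult N (A N k \<omega>) (madj (A N k' \<omega>)))" for \<omega>
        by (intro mtrace_cong mmult_cong) (auto simp: slice_embed madj_def)
      ultimately show ?thesis
        unfolding madj_center trcc mtrace_madj trslice by (simp add: diff_divide_distrib)
    qed
    then show ?thesis
      using L2_limit_imp_L1_limit[OF prob m c2] by simp
  qed
  have d1': "(\<lambda>N. mtrace N (mmult N (Mt N l) (Mt N l')) / of_nat N) \<longlonglongrightarrow> eta l l'" for l l'
    using d1[of l l'] by (simp add: trace0)
  have d2': "(\<lambda>N. mtrace N (mmult N (Mt N l) (madj (Mt N l'))) / of_nat N) \<longlonglongrightarrow> beta l l'" for l l'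
    using d2[of l l'] by (simp add: trace0)

  define p where "p i j = eta (snd i) (snd j) * tau (fst i) (fst j)" for i j :: "'k \<times> 'l"
  define q where "q i j = beta (snd i) (snd j) * taubar (fst i) (fst j)" for i j :: "'k \<times> 'l"
  have \<mu>P: "prob_space (\<mu> N)" for N
    using U[of N] by (rule unitary_invariant.prob)
  have intX: "integrable (\<mu> N) (\<lambda>x. mtrace N (mmult N (?C N k x) (B x)) / of_nat N)"
    if "0 < N" "unitary_invariant.covariant N (\<mu> N) B" for N k B
  proof -
    interpret unitary_invariant N "\<mu> N" by (rule U)
    have "covariant (?C N k)"
      unfolding slice_def by (intro covariant_center covariant_entry)
    then show ?thesis
      unfolding divide_inverse mult.commute[of _ "inverse _"]
      by (intro good_integrable[OF _ that(1)] good_cmult good_mtrace mgood_mmult covariant_mgood that(2))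
  qed
  have cov: "unitary_invariant.covariant N (\<mu> N) (?C N k)" "unitary_invariant.covariant N (\<mu> N) (\<lambda>x. madj (?C N k x))" for N k
  proof -
    interpret unitary_invariant N "\<mu> N" by (rule U)
    show "covariant (?C N k)"
      unfolding slice_def by (intro covariant_center covariant_entry)
    then show "covariant (\<lambda>x. madj (?C N k x))"
      by (rule covariant_madj)
  qed
  \<comment> \<open>Cyclicity of the trace exchanges the two centered matrices, so both values are
    limits in mean of the same sequence.\<close>
  have tau_sym: "tau k k' = tau k' k" for k k'
  proof (rule L1_limit_unique[OF \<mu>P _ c1'])
    show "(\<lambda>N. \<integral>x. cmod (mtrace N (mmult N (?C N k x) (?C N k' x)) / of_nat N - tau k' k) \<partial>\<mu> N) \<longlonglongrightarrow> 0"
      using c1'[of k' k] by (subst mtrace_commute)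
  qed (intro intX cov)
  have taubar_sym: "taubar k k' = cnj (taubar k' k)" for k k'
  proof (rule L1_limit_unique[OF \<mu>P _ c2'])
    have "cmod (mtrace N (mmult N (?C N k x) (madj (?C N k' x))) / of_nat N - cnj (taubar k' k))
      = cmod (mtrace N (mmult N (?C N k' x) (madj (?C N k x))) / of_nat N - taubar k' k)" for N x
    proof -
      have "mtrace N (mmult N (?C N k x) (madj (?C N k' x))) = cnj (mtrace N (mmult N (?C N k' x) (madj (?C N k x))))"
        by (simp add: madj_mmult flip: mtrace_madj)
      then have "mtrace N (mmult N (?C N k x) (madj (?C N k' x))) / of_nat N - cnj (taubar k' k)
        = cnj (mtrace N (mmult N (?C N k' x) (madj (?C N k x))) / of_nat N - taubar k' k)"
        by simp
      then show ?thesis by (simp only: complex_mod_cnj)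
    qed
    then show "(\<lambda>N. \<integral>x. cmod (mtrace N (mmult N (?C N k x) (madj (?C N k' x))) / of_nat N - cnj (taubar k' k)) \<partial>\<mu> N) \<longlonglongrightarrow> 0"
      using c2'[of k' k] by (simp only:)
  qed (intro intX cov)
  have eta_sym: "eta l l' = eta l' l" for l l'
  proof (rule LIMSEQ_unique[OF d1'])
    show "(\<lambda>N. mtrace N (mmult N (Mt N l) (Mt N l')) / of_nat N) \<longlonglongrightarrow> eta l' l"
      using d1'[of l' l] by (subst mtrace_commute)
  qed
  have beta_sym: "beta l l' = cnj (beta l' l)" for l l'
  proof (rule LIMSEQ_unique[OF d2'])
    have "mtrace N (mmult N (Mt N l) (madj (Mt N l'))) / of_nat N = cnj (mtrace N (mmult N (Mt N l') (madj (Mt N l))) / of_nat N)" for N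
      by (simp add: madj_mmult flip: mtrace_madj)
    then show "(\<lambda>N. mtrace N (mmult N (Mt N l) (madj (Mt N l'))) / of_nat N) \<longlonglongrightarrow> cnj (beta l' l)"
      using tendsto_cnj[OF d2'[of l' l]] by (simp only:)
  qed
  have p_sym: "p i j = p j i" for i j
    unfolding p_def by (simp add: tau_sym[of "fst i"] eta_sym[of "snd i"])
  have q_sym: "q i j = cnj (q j i)" for i j
    unfolding q_def by (simp add: taubar_sym[of "fst i"] beta_sym[of "snd i"])

  \<comment> \<open>The type of the labels is left free: the first fact serves for sets of
    coordinates, where it is positive semidefiniteness of the kernel, the second for families
    labelled by \<open>nat \<times> bool\<close>.\<close>
  have asym: "0 \<le> (\<Sum>s\<in>S. \<Sum>s'\<in>S. t s * t s' * cov_kernel p q (\<phi> s) (\<phi> s'))"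
    "(\<lambda>N. \<integral>x. cis (Re (\<Sum>s\<in>S. (of_real (t s) * re_im (snd (\<phi> s))) * mtrace N (mmult N (?C N (fst (fst (\<phi> s))) x) (Mt N (snd (fst (\<phi> s))))))) \<partial>\<mu> N)
      \<longlonglongrightarrow> of_real (exp (- (\<Sum>s\<in>S. \<Sum>s'\<in>S. t s * t s' * cov_kernel p q (\<phi> s) (\<phi> s')) / 2))"
    for S :: "'s set" and t :: "'s \<Rightarrow> real" and \<phi> :: "'s \<Rightarrow> ('k \<times> 'l) \<times> bool"
  proof -
    have a': "\<exists>a. \<forall>N. (\<integral>x. fro N (mmult N (madj (?C N k x)) (?C N k x)) \<partial>\<mu> N) \<le> a * real N" for k
      using a[of k] by blast
    note * = linear_statistic_asymptotics[where S = S and k = "\<lambda>s. fst (fst (\<phi> s))" and l = "\<lambda>s. snd (fst (\<phi> s))"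
        and c = "\<lambda>s. of_real (t s) * re_im (snd (\<phi> s))" and Mt = Mt and eta = eta and beta = beta
        and tau = tau and taubar = taubar and \<mu> = \<mu>, OF U a' c1' c2' d1' d2' trace0]
    have v: "Re (\<Sum>s\<in>S. \<Sum>s'\<in>S. (of_real (t s) * re_im (snd (\<phi> s))) * (of_real (t s') * re_im (snd (\<phi> s')))
          * (tau (fst (fst (\<phi> s))) (fst (fst (\<phi> s'))) * eta (snd (fst (\<phi> s))) (snd (fst (\<phi> s'))))
        + (of_real (t s) * re_im (snd (\<phi> s))) * cnj (of_real (t s') * re_im (snd (\<phi> s')))
          * (taubar (fst (fst (\<phi> s))) (fst (fst (\<phi> s'))) * beta (snd (fst (\<phi> s))) (snd (fst (\<phi> s'))))) / 2
      = (\<Sum>s\<in>S. \<Sum>s'\<in>S. t s * t s' * cov_kernel p q (\<phi> s) (\<phi> s'))"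
      unfolding kernel_quadratic[symmetric] p_def q_def by (simp only: mult.commute[of "eta _ _"] mult.commute[of "beta _ _"])
    show "0 \<le> (\<Sum>s\<in>S. \<Sum>s'\<in>S. t s * t s' * cov_kernel p q (\<phi> s) (\<phi> s'))"
      using *(1) unfolding v .
    show "(\<lambda>N. \<integral>x. cis (Re (\<Sum>s\<in>S. (of_real (t s) * re_im (snd (\<phi> s))) * mtrace N (mmult N (?C N (fst (fst (\<phi> s))) x) (Mt N (snd (fst (\<phi> s))))))) \<partial>\<mu> N)
      \<longlonglongrightarrow> of_real (exp (- (\<Sum>s\<in>S. \<Sum>s'\<in>S. t s * t s' * cov_kernel p q (\<phi> s) (\<phi> s')) / 2))"
      using *(2) unfolding v .
  qed
  have psd: "0 \<le> (\<Sum>s\<in>I. \<Sum>s'\<in>I. t s * t s' * cov_kernel p q s s')" for I t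
    by (rule asym(1))
  obtain Q :: "('k \<times> 'l \<Rightarrow> complex) measure" where Q: "prob_space Q" "sets Q = sets (PiM UNIV (\<lambda>_. borel))"
    and Qchar: "\<And>(I :: (nat \<times> bool) set) t \<phi>. finite I \<Longrightarrow> (\<integral>x. cis (\<Sum>s\<in>I. t s * coord (\<phi> s) x) \<partial>Q)
        = complex_of_real (exp (- (\<Sum>s\<in>I. \<Sum>s'\<in>I. t s * t s' * cov_kernel p q (\<phi> s) (\<phi> s')) / 2))"
    and Qchar': "\<And>(I :: (('k \<times> 'l) \<times> bool) set) t. finite I \<Longrightarrow> (\<integral>x. cis (\<Sum>s\<in>I. t s * coord s x) \<partial>Q)
        = complex_of_real (exp (- (\<Sum>s\<in>I. \<Sum>s'\<in>I. t s * t s' * cov_kernel p q s s') / 2))"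
    by (rule complex_gaussian_process_exists[OF p_sym q_sym psd]) (rule that; assumption)
  note Qprop = complex_gaussian_process_properties[OF Q p_sym q_sym psd Qchar']
  let ?X = "\<lambda>N (k, l) \<omega>. mtrace N (mmult N (A N k \<omega>) (Mt N l))"
  \<comment> \<open>Since the deterministic matrices are traceless, centering the random matrix does
    not change the trace of the product; the statistics of the theorem are those analysed for
    centered matrices.\<close>
  have trA: "mtrace N (mmult N (?C N k (embed N (A N) \<omega>)) (Mt N l)) = mtrace N (mmult N (A N k \<omega>) (Mt N l))" for N k l \<omega>
  proof -
    have "mtrace N (mmult N (?C N k (embed N (A N) \<omega>)) (Mt N l)) = mtrace N (mmult N (slice k (embed N (A N) \<omega>)) (Mt N l))"
      unfolding mtrace_center_mmult by (simp add: trace0)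
    also have "\<dots> = mtrace N (mmult N (A N k \<omega>) (Mt N l))"
      by (intro mtrace_cong mmult_cong slice_embed refl)
    finally show ?thesis .
  qed
  have Cm: "(\<lambda>x. mtrace N (mmult N (?C N k x) (Mt N l))) \<in> borel_measurable (\<mu> N)" for N k l
    by (intro trm mm centry borel_measurable_const)
  have "fdd_converges P ?X Q (\<lambda>kl x. x kl)"
  proof (rule fdd_convergesI[OF prob _ Q _ Qprop(2)])
    show "?X N i \<in> borel_measurable (P N)" for N i
      by (cases i) (auto intro!: trm mm meas)
    show "\<exists>B. \<forall>N. integrable (P N) (\<lambda>\<omega>. (cmod (?X N i \<omega>))\<^sup>2) \<and> (\<integral>\<omega>. (cmod (?X N i \<omega>))\<^sup>2 \<partial>P N) \<le> B" for i
    proof -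
      obtain k l where i: "i = (k, l)" by (cases i) auto
      obtain a where a: "0 \<le> a" "\<And>N. (\<integral>x. fro N (mmult N (madj (?C N k x)) (?C N k x)) \<partial>\<mu> N) \<le> a * real N"
        using a[of k] by blast
      obtain g where g: "\<And>N. fro N (Mt N l) \<le> g * real N"
        using convergent_fro_bound[OF d2'[of l l]] by blast
      have g0: "0 \<le> g"
        using order_trans[OF fro_nonneg g[of 1]] by simp
      have "integrable (P N) (\<lambda>\<omega>. (cmod (?X N i \<omega>))\<^sup>2) \<and> (\<integral>\<omega>. (cmod (?X N i \<omega>))\<^sup>2 \<partial>P N) \<le> (1 + a) * g" for N
      proof -
        note * = linear_statistic_second_moment[OF U a(2) g g0 a(1), of N]
        have m: "(\<lambda>x. (cmod (mtrace N (mmult N (?C N k x) (Mt N l))))\<^sup>2) \<in> borel_measurable (\<mu> N)"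
          using Cm by measurable
        have "integrable (P N) (\<lambda>\<omega>. (cmod (mtrace N (mmult N (?C N k (embed N (A N) \<omega>)) (Mt N l))))\<^sup>2)"
          using *(1) m unfolding \<mu>_def joint_law_eq_embed by (subst (asm) integrable_distr_eq[OF em]) simp_all
        moreover have "(\<integral>\<omega>. (cmod (mtrace N (mmult N (?C N k (embed N (A N) \<omega>)) (Mt N l))))\<^sup>2 \<partial>P N) \<le> (1 + a) * g"
          using *(2) unfolding transfer[OF m] .
        ultimately show ?thesis
          unfolding trA i by simp
      qed
      then show ?thesis by blast
    qed
    fix I :: "(nat \<times> bool) set" and t :: "nat \<times> bool \<Rightarrow> real" and \<phi> :: "nat \<times> bool \<Rightarrow> ('k \<times> 'l) \<times> bool"
    assume I: "finite I"
    have "(\<integral>x. cis (Re (\<Sum>s\<in>I. (of_real (t s) * re_im (snd (\<phi> s))) * mtrace N (mmult N (?C N (fst (fst (\<phi> s))) x) (Mt N (snd (fst (\<phi> s))))))) \<partial>\<mu> N)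
       = (\<integral>\<omega>. cis (\<Sum>s\<in>I. t s * coord (\<phi> s) (\<lambda>i. ?X N i \<omega>)) \<partial>P N)" for N
    proof -
      have "(\<lambda>x. cis (Re (\<Sum>s\<in>I. (of_real (t s) * re_im (snd (\<phi> s))) * mtrace N (mmult N (?C N (fst (fst (\<phi> s))) x) (Mt N (snd (fst (\<phi> s)))))))) \<in> borel_measurable (\<mu> N)"
      proof (rule borel_measurable_cis)
        have "(\<lambda>x. \<Sum>s\<in>I. (of_real (t s) * re_im (snd (\<phi> s))) * mtrace N (mmult N (?C N (fst (fst (\<phi> s))) x) (Mt N (snd (fst (\<phi> s)))))) \<in> borel_measurable (\<mu> N)"
          by (intro borel_measurable_sum borel_measurable_times borel_measurable_const Cm)
        then show "(\<lambda>x. Re (\<Sum>s\<in>I. (of_real (t s) * re_im (snd (\<phi> s))) * mtrace N (mmult N (?C N (fst (fst (\<phi> s))) x) (Mt N (snd (fst (\<phi> s))))))) \<in> borel_measurable (\<mu> N)"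
          by measurable
      qed
      moreover have "Re (\<Sum>s\<in>I. (of_real (t s) * re_im (snd (\<phi> s))) * mtrace N (mmult N (A N (fst (fst (\<phi> s))) \<omega>) (Mt N (snd (fst (\<phi> s))))))
        = (\<Sum>s\<in>I. t s * coord (\<phi> s) (\<lambda>i. ?X N i \<omega>))" for \<omega>
        unfolding Re_sum coord_def case_prod_unfold mult.assoc by simp
      ultimately show ?thesis
        by (simp only: transfer trA)
    qed
    moreover have "(\<lambda>N. \<integral>x. cis (Re (\<Sum>s\<in>I. (of_real (t s) * re_im (snd (\<phi> s))) * mtrace N (mmult N (?C N (fst (fst (\<phi> s))) x) (Mt N (snd (fst (\<phi> s))))))) \<partial>\<mu> N)
      \<longlonglongrightarrow> of_real (exp (- (\<Sum>s\<in>I. \<Sum>s'\<in>I. t s * t s' * cov_kernel p q (\<phi> s) (\<phi> s')) / 2))"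
      by (rule asym(2))
    ultimately show "(\<lambda>N. \<integral>\<omega>. cis (\<Sum>s\<in>I. t s * coord (\<phi> s) (\<lambda>i. ?X N i \<omega>)) \<partial>P N)
        \<longlonglongrightarrow> (\<integral>x. cis (\<Sum>s\<in>I. t s * coord (\<phi> s) x) \<partial>Q)"
      unfolding Qchar[OF I] by (simp only:)
  qed
  moreover have "(\<integral>x. x (k, l) * x (k', l') \<partial>Q) = eta l l' * tau k k'"
    "(\<integral>x. x (k, l) * cnj (x (k', l')) \<partial>Q) = beta l l' * taubar k k'" for k l k' l'
    using Qprop(4)[of "(k, l)" "(k', l')"] Qprop(5)[of "(k, l)" "(k', l')"] by (simp_all add: p_def q_def)
  ultimately show ?thesis
    using Q Qprop(1) by blast
qed

end
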